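(* Let $N\ge2$ and let $(A_1,\dots,A_N)$ be nonnegative random variables satisfying $P\{\sum_{i}\mathbf{1}\{A_i>0\}\in\{0,1\}\}<1$, $\mathbb{E}[\sum_i\mathbf{1}\{A_i>0\}]>1$, $P\{A_i\in\{0,1\}\ \forall i\}<1$. Let $F_0$ satisfy $(\mathbf{H}_\gamma)$ (see context) for some $\gamma\in(0,2]$, let $X_0$ have distribution function $F_0$, and assume $\mu(\delta)<\mu(\gamma)$ for some $\delta>\gamma$. Let $V_t$ be a random variable whose characteristic function is $\phi(t,\cdot)$, the solution of the Cauchy problem in the context with initial datum the characteristic function of $F_0$, and let $V_\infty$ be a random variable with characteristic function $\xi\mapsto\int_{[0,\infty)}\hat g_\gamma(\xi z^{1/\gamma})\zeta_{\infty,\gamma}(dz)$. Then for every $t\ge0$ $$\mathcal{Z}_\delta(e^{-\mu(\gamma)t}V_t,V_\infty)\le\mathcal{Z}_\delta(X_0,V_\infty)e^{-t\delta[\mu(\gamma)-\mu(\delta)]}.$$ In particular, if $\gamma=2$, $\delta\le3$ and $\mathbb{E}|X_0|^\delta<+\infty$, then $\mathcal{Z}_\delta(e^{-\mu(\gamma)t}V_t,V_\infty)\le c\,e^{-t\delta[\mu(\gamma)-\mu(\delta)]}$, where $c:=\frac{1}{\Gamma(1+\delta)}(\mathbb{E}|X_0|^\delta+\mathbb{E}|V_\infty|^\delta)<+\infty$.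
   Context: $\mathcal{Q}(s)=\mathbb{E}[\sum_{j=1}^N A_j^s]-1$ ($0^0=0$), $\mu(s)=\mathcal{Q}(s)/s$. Cauchy problem: $\phi(t,\cdot)$ characteristic functions with $\partial_t\phi(t,\xi)+\phi(t,\xi)=\mathbb{E}[\prod_{i=1}^N\phi(t,A_i\xi)]$, $\phi(0,\cdot)=\phi_0$ (unique solution). $(\mathbf{H}_\gamma)$: if $\gamma=1$: either (a) $\int|v|dF_0<\infty$, $m_0=\int v\,dF_0$, or (b) $F_0$ symmetric, $\lim_{x\to+\infty}x(1-F_0(x))=c_0^+=\lim_{x\to-\infty}|x|F_0(x)$, $0<c_0^+<\infty$. If $\gamma=2$: $0<\sigma_0^2:=\int v^2dF_0<\infty$ and $\int v\,dF_0=0$. If $\gamma\in(0,1)\cup(1,2)$: $\lim_{x\to+\infty}x^\gamma(1-F_0(x))=c_0^+<\infty$, $\lim_{x\to-\infty}|x|^\gamma F_0(x)=c_0^-<\infty$, $c_0^++c_0^->0$, and $\int v\,dF_0=0$ if $\gamma>1$. $\hat g_\gamma(\xi)$: $e^{im_0\xi}$ if $\gamma=1$, (a); $e^{-\pi c_0^+|\xi|}$ if $\gamma=1$, (b); $e^{-\sigma_0^2\xi^2/2}$ if $\gamma=2$; $\exp\{-k_0|\xi|^\gamma(1-i\eta_0\tan(\pi\gamma/2)\mathrm{sign}\,\xi)\}$ otherwise, with $k_0=(c_0^++c_0^-)\frac{\pi}{2\Gamma(\gamma)\sin(\pi\gamma/2)}$, $\eta_0=\frac{c_0^+-c_0^-}{c_0^++c_0^-}$.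 $\zeta_{\infty,\gamma}$: the unique probability on $[0,\infty)$ with mean $1$ whose Fourier–Stieltjes transform $v$ solves $v(\xi)=\int_0^1\mathbb{E}[\prod_{i=1}^N v(\xi A_i^\gamma\tau^{\mathcal{Q}(\gamma)})]d\tau$. Zolotarev metric: for $s=m+\alpha$ with $m\ge0$ integer and $0<\alpha\le1$, $\mathcal{Z}_s(X,Y)=\sup\{\mathbb{E}[f(X)-f(Y)]:f\in\mathcal{F}_s\}$, where $\mathcal{F}_s$ is the set of real functions on $\mathbb{R}$ having an $m$-th derivative everywhere with $|f^{(m)}(x)-f^{(m)}(y)|\le|x-y|^\alpha$. *)

theory Defs
  imports "HOL-Probability.Probability"
begin

definition real_prob :: "real measure \<Rightarrow> bool" where
  "real_prob P \<longleftrightarrow> prob_space P \<and> sets P = sets borel"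

definition distfun :: "real measure \<Rightarrow> real \<Rightarrow> real" where
  "distfun F x = measure F {..x}"

definition c0p :: "real \<Rightarrow> real measure \<Rightarrow> real" where
  "c0p \<gamma> F = Lim at_top (\<lambda>x. x powr \<gamma> * (1 - distfun F x))"

definition c0m :: "real \<Rightarrow> real measure \<Rightarrow> real" where
  "c0m \<gamma> F = Lim at_bot (\<lambda>x. \<bar>x\<bar> powr \<gamma> * distfun F x)"

definition m0 :: "real measure \<Rightarrow> real" where
  "m0 F = (\<integral>v. v \<partial>F)"

definition sigma0sq :: "real measure \<Rightarrow> real" where
  "sigma0sq F = (\<integral>v. v\<^sup>2 \<partial>F)"

definition H_gamma :: "real \<Rightarrow> real measure \<Rightarrow> bool" where
  "H_gamma \<gamma> F \<longleftrightarrow>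
     (\<gamma> = 1 \<longrightarrow>
        (integrable F (\<lambda>v. v)) \<or>
        (distr F borel uminus = F \<and>
         (\<exists>c. 0 < c \<and>
            ((\<lambda>x. x * (1 - distfun F x)) \<longlongrightarrow> c) at_top \<and>
            ((\<lambda>x. \<bar>x\<bar> * distfun F x) \<longlongrightarrow> c) at_bot))) \<and>
     (\<gamma> = 2 \<longrightarrow>
        integrable F (\<lambda>v. v\<^sup>2) \<and> 0 < (\<integral>v. v\<^sup>2 \<partial>F) \<and>
        integrable F (\<lambda>v. v) \<and> (\<integral>v. v \<partial>F) = 0) \<and>
     (\<gamma> \<noteq> 1 \<and> \<gamma> \<noteq> 2 \<longrightarrow>
        (\<exists>cp cm.
            ((\<lambda>x. x powr \<gamma> * (1 - distfun F x)) \<longlongrightarrow> cp) at_top \<and>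
            ((\<lambda>x. \<bar>x\<bar> powr \<gamma> * distfun F x) \<longlongrightarrow> cm) at_bot \<and>
            0 < cp + cm) \<and>
        (1 < \<gamma> \<longrightarrow> integrable F (\<lambda>v. v) \<and> (\<integral>v. v \<partial>F) = 0))"

definition k0 :: "real \<Rightarrow> real measure \<Rightarrow> real" where
  "k0 \<gamma> F = (c0p \<gamma> F + c0m \<gamma> F) * (pi / (2 * Gamma \<gamma> * sin (pi * \<gamma> / 2)))"

definition eta0 :: "real \<Rightarrow> real measure \<Rightarrow> real" where
  "eta0 \<gamma> F = (c0p \<gamma> F - c0m \<gamma> F) / (c0p \<gamma> F + c0m \<gamma> F)"

(* \<hat>g_gamma ; for gamma = 1, case (a) is "F integrable", case (b) otherwise
   (under (H_1) exactly one of (a),(b) holds) *)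
definition g_hat :: "real \<Rightarrow> real measure \<Rightarrow> real \<Rightarrow> complex" where
  "g_hat \<gamma> F \<xi> =
     (if \<gamma> = 1 then
        (if integrable F (\<lambda>v. v) then iexp (m0 F * \<xi>)
         else complex_of_real (exp (- pi * c0p 1 F * \<bar>\<xi>\<bar>)))
      else if \<gamma> = 2 then complex_of_real (exp (- sigma0sq F * \<xi>\<^sup>2 / 2))
      else exp (- complex_of_real (k0 \<gamma> F * \<bar>\<xi>\<bar> powr \<gamma>) *
                (1 - \<i> * complex_of_real (eta0 \<gamma> F * tan (pi * \<gamma> / 2) * sgn \<xi>))))"

(* Q(s) = E[sum_j A_j^s] - 1 (0 powr s = 0, matching 0^0 = 0), mu(s) = Q(s)/s;
   L is the joint law of (A_1,...,A_N) on real^'n, N = CARD('n) *)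
definition QQ :: "(real ^ 'n::finite) measure \<Rightarrow> real \<Rightarrow> real" where
  "QQ L s = (\<integral>a. (\<Sum>i\<in>UNIV. (a $ i) powr s) \<partial>L) - 1"

definition mu :: "(real ^ 'n::finite) measure \<Rightarrow> real \<Rightarrow> real" where
  "mu L s = QQ L s / s"

definition cauchy_solution ::
  "(real ^ 'n::finite) measure \<Rightarrow> (real \<Rightarrow> complex) \<Rightarrow> (real \<Rightarrow> real \<Rightarrow> complex) \<Rightarrow> bool" where
  "cauchy_solution L phi0 phi \<longleftrightarrow>
     (\<forall>t\<ge>0. \<exists>P. real_prob P \<and> phi t = char P) \<and>
     phi 0 = phi0 \<and>
     (\<forall>t\<ge>0. \<forall>\<xi>.
        ((\<lambda>s. phi s \<xi>) has_vector_derivative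
           ((CLINT a|L. (\<Prod>i\<in>UNIV. phi t (a $ i * \<xi>))) - phi t \<xi>)) (at t within {0..}))"

definition zeta_infty :: "(real ^ 'n::finite) measure \<Rightarrow> real \<Rightarrow> real measure \<Rightarrow> bool" where
  "zeta_infty L \<gamma> Z \<longleftrightarrow>
     real_prob Z \<and> measure Z {0..} = 1 \<and>
     integrable Z (\<lambda>z. z) \<and> (\<integral>z. z \<partial>Z) = 1 \<and>
     (\<forall>\<xi>. char Z \<xi> =
        (CLBINT \<tau>:{0..1}. (CLINT a|L.
            (\<Prod>i\<in>UNIV. char Z (\<xi> * (a $ i) powr \<gamma> * \<tau> powr QQ L \<gamma>)))))"

definition zol_class :: "real \<Rightarrow> (real \<Rightarrow> real) set" where
  "zol_class s = {f.
     (let m = nat (\<lceil>s\<rceil> - 1); \<alpha> = s - real m in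
       (\<forall>k<m. \<forall>x. ((deriv ^^ k) f) differentiable (at x)) \<and>
       (\<forall>x y. \<bar>(deriv ^^ m) f x - (deriv ^^ m) f y\<bar> \<le> \<bar>x - y\<bar> powr \<alpha>))}"

definition zolotarev :: "real \<Rightarrow> real measure \<Rightarrow> real measure \<Rightarrow> ereal" where
  "zolotarev s P Q =
     (SUP f \<in> {f \<in> zol_class s. integrable P f \<and> integrable Q f}.
        ereal ((\<integral>x. f x \<partial>P) - (\<integral>x. f x \<partial>Q)))"

end

theory Submission
  imports Defs "HOL-Computational_Algebra.Polynomial"
begin

text \<open>
  Write \<open>T\<close> for the smoothing transform that sends a law \<open>P\<close> to the law of \<open>\<Sum>i. A\<^sub>i X\<^sub>i\<close> with independent
  \<open>X\<^sub>i\<close> of law \<open>P\<close>. The Cauchy problem says that the law \<open>P\<^sub>t\<close> of \<open>V\<^sub>t\<close> satisfies \<open>\<partial>\<^sub>t P = T P - P\<close>, and the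
  fixed point equation of \<open>\<zeta>\<close> says that the law of \<open>exp (\<mu>(\<gamma>) t) V\<^sub>\<infinity>\<close> solves the same problem. A function
  \<open>f\<close> whose derivative of order \<open>m\<close> is \<open>\<alpha>\<close>-Hoelder with constant \<open>c\<close> becomes, after an affine substitution
  with slope \<open>a\<close>, such a function with constant \<open>c a\<^sup>\<delta>\<close>; replacing the summands of \<open>\<Sum>i. A\<^sub>i X\<^sub>i\<close> one by one
  shows that \<open>T\<close> expands the distance at most by \<open>E (\<Sum>i. A\<^sub>i\<^sup>\<delta>) = Q(\<delta>) + 1\<close>, and Duhamel's formula turns this
  into the growth rate \<open>exp (Q(\<delta>) t)\<close>. Rescaling gives the claim.

  A test function need not be integrable under the mixed sums of this argument. It is therefore replaced
  by bounded ones: multiplication by averages of a bump function over many dyadic scales changes the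
  Hoelder constant by an arbitrarily small amount only.

  For \<open>\<gamma> = 2\<close>, Taylor's formula bounds the initial distance by absolute moments of order \<open>\<delta>\<close>. Those of
  \<open>V\<^sub>\<infinity>\<close>, a Gaussian scale mixture, are finite because the fixed point \<open>\<zeta>\<close> has a moment of order \<open>\<delta> / 2\<close>:
  the remainder \<open>E exp (- s Z) - 1 + s\<close> satisfies a linear inequality that is a contraction for the weight
  \<open>s powr (- 1 - \<delta> / 2)\<close> on the positive axis.
\<close>

section \<open>Dilation-averaged cutoffs\<close>

text \<open>The derivative of order k of a test function grows like |x| to the power \<delta> - k,
  that of a cutoff at scale R is of size R to the power - k. Their product is scale invariant: one
  cutoff, however wide, perturbs the Hoelder constant by a fixed amount. At a given x essentially
  only boundedly many dyadic scales vary, so averaging over n scales divides the perturbation by n.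

  All cases of \<open>g_hat\<close> are of stable type: at
  \<open>\<xi> * z powr (1 / \<gamma>)\<close> the kernel is exp (- k(\<xi>) z) with k homogeneous
  of degree \<gamma> and Re k >= 0. The characteristic function of V_infinity is thus the Laplace
  transform of zeta at the complex point k(\<xi>), and the time evolution dilates that point. This
  treats every \<gamma> at once.

  In the moment argument linear functions of s are invariant, because the weights sum to 1 in mean,
  so the contraction alone does not control the remainder. The missing information is that the
  remainder is o(s) at 0, which holds because zeta has a finite mean. The condition \<mu>(\<delta>)
  < \<mu>(\<gamma>) makes the contraction factor less than 1.\<close>

definition deriv_chain :: "nat \<Rightarrow> (nat \<Rightarrow> real \<Rightarrow> real) \<Rightarrow> bool" where
  "deriv_chain m F \<longleftrightarrow> (\<forall>k<m. \<forall>x. (F k has_real_derivative F (Suc k) x) (at x))"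

text \<open>The derivatives are carried as an explicit family instead of iterated
  \<open>deriv\<close>, so that the product rule and substitutions act on the witnesses. The
  constant c is a parameter because every dilation changes it.\<close>

definition holder_deriv :: "nat \<Rightarrow> real \<Rightarrow> real \<Rightarrow> (real \<Rightarrow> real) \<Rightarrow> bool" where
  "holder_deriv m \<alpha> c f \<longleftrightarrow>
     (\<exists>F. F 0 = f \<and> deriv_chain m F \<and> (\<forall>x y. \<bar>F m x - F m y\<bar> \<le> c * \<bar>x - y\<bar> powr \<alpha>))"

lemma deriv_chain_D: "deriv_chain m F \<Longrightarrow> k < m \<Longrightarrow> (F k has_real_derivative F (Suc k) x) (at x)"
  by (simp add: deriv_chain_def)

lemma deriv_chain_funpow:
  assumes "deriv_chain m F" "k \<le> m"
  shows "(deriv ^^ k) (F 0) = F k"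
  using assms(2)
proof (induction k)
  case (Suc k)
  then have "(deriv ^^ Suc k) (F 0) = deriv (F k)" by simp
  also have "\<dots> = F (Suc k)"
    using Suc.prems assms(1) by (intro ext DERIV_imp_deriv deriv_chain_D) auto
  finally show ?case .
qed simp

lemma zol_class_iff:
  assumes "m = nat (\<lceil>\<delta>\<rceil> - 1)" "\<alpha> = \<delta> - real m"
  shows "f \<in> zol_class \<delta> \<longleftrightarrow> holder_deriv m \<alpha> 1 f"
proof
  assume f: "f \<in> zol_class \<delta>"
  define F where "F k = (deriv ^^ k) f" for k
  have "deriv_chain m F"
    using f assms unfolding deriv_chain_def zol_class_def F_def Let_def
    by (auto simp: DERIV_deriv_iff_real_differentiable)
  moreover have "\<bar>F m x - F m y\<bar> \<le> 1 * \<bar>x - y\<bar> powr \<alpha>" for x y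
    using f assms unfolding zol_class_def F_def Let_def by simp
  ultimately show "holder_deriv m \<alpha> 1 f"
    unfolding holder_deriv_def by (intro exI[of _ F]) (auto simp: F_def)
next
  assume "holder_deriv m \<alpha> 1 f"
  then obtain F where F: "F 0 = f" "deriv_chain m F"
      "\<And>x y. \<bar>F m x - F m y\<bar> \<le> 1 * \<bar>x - y\<bar> powr \<alpha>"
    unfolding holder_deriv_def by blast
  have "(deriv ^^ k) f = F k" if "k \<le> m" for k
    using deriv_chain_funpow[OF F(2) that] F(1) by simp
  then show "f \<in> zol_class \<delta>"
    using F(2,3) unfolding zol_class_def Let_def assms(1)[symmetric] assms(2)[symmetric]
    by (auto simp: real_differentiable_def deriv_chain_def)
qed

lemma holder_deriv_mono:
  "holder_deriv m \<alpha> c f \<Longrightarrow> c \<le> d \<Longrightarrow> holder_deriv m \<alpha> d f"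
proof -
  assume "holder_deriv m \<alpha> c f" and cd: "c \<le> d"
  then obtain F where F: "F 0 = f" "deriv_chain m F" "\<And>x y. \<bar>F m x - F m y\<bar> \<le> c * \<bar>x - y\<bar> powr \<alpha>"
    unfolding holder_deriv_def by blast
  have "\<bar>F m x - F m y\<bar> \<le> d * \<bar>x - y\<bar> powr \<alpha>" for x y
    using F(3)[of x y] mult_right_mono[OF cd, of "\<bar>x - y\<bar> powr \<alpha>"] by simp
  then show ?thesis unfolding holder_deriv_def using F(1,2) by blast
qed

lemma holder_deriv_affine:
  assumes "holder_deriv m \<alpha> c f" "0 \<le> a" "0 < \<alpha>" "0 \<le> b"
  shows "holder_deriv m \<alpha> (b * c * a powr (real m + \<alpha>)) (\<lambda>x. b * f (a * x + r))"
proof -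
  obtain F where F: "F 0 = f" "deriv_chain m F" "\<And>x y. \<bar>F m x - F m y\<bar> \<le> c * \<bar>x - y\<bar> powr \<alpha>"
    using assms(1) unfolding holder_deriv_def by blast
  define G where "G k x = b * a ^ k * F k (a * x + r)" for k x
  have "deriv_chain m G"
    unfolding deriv_chain_def G_def
    by (auto intro!: derivative_eq_intros DERIV_chain2[OF deriv_chain_D[OF F(2)]])
  moreover have "\<bar>G m x - G m y\<bar> \<le> b * c * a powr (real m + \<alpha>) * \<bar>x - y\<bar> powr \<alpha>" for x y
  proof -
    have "\<bar>G m x - G m y\<bar> = b * a ^ m * \<bar>F m (a * x + r) - F m (a * y + r)\<bar>"
      using assms by (simp add: G_def abs_mult flip: right_diff_distrib)
    also have "\<dots> \<le> b * a ^ m * (c * \<bar>(a * x + r) - (a * y + r)\<bar> powr \<alpha>)"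
      using assms by (intro mult_left_mono F) auto
    also have "\<bar>(a * x + r) - (a * y + r)\<bar> = a * \<bar>x - y\<bar>"
      using assms by (simp add: abs_mult flip: right_diff_distrib)
    also have "(a * \<bar>x - y\<bar>) powr \<alpha> = a powr \<alpha> * \<bar>x - y\<bar> powr \<alpha>"
      using assms by (simp add: powr_mult)
    also have "b * a ^ m * (c * (a powr \<alpha> * \<bar>x - y\<bar> powr \<alpha>)) = b * c * (a powr \<alpha> * a ^ m) * \<bar>x - y\<bar> powr \<alpha>"
      by simp
    \<comment> \<open>Slope 0 does occur, for a vanishing coefficient of the smoothing transform;
      there \<open>0 powr x = 0\<close> keeps the formula true.\<close>
    also have "a powr \<alpha> * a ^ m = a powr (real m + \<alpha>)"
      using assms by (cases "a = 0") (auto simp: powr_add powr_realpow)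
    finally show ?thesis .
  qed
  ultimately show ?thesis
    unfolding holder_deriv_def by (intro exI[of _ G]) (auto simp: G_def F)
qed

lemma holder_deriv_continuous:
  assumes "holder_deriv m \<alpha> c f" "0 < \<alpha>"
  shows "continuous_on UNIV f"
proof -
  obtain F where F: "F 0 = f" "deriv_chain m F" "\<And>x y. \<bar>F m x - F m y\<bar> \<le> c * \<bar>x - y\<bar> powr \<alpha>"
    using assms(1) unfolding holder_deriv_def by blast
  show ?thesis
  proof (cases "m = 0")
    case True
    have "isCont f x" for x
    proof -
      have "((\<lambda>y. c * \<bar>y - x\<bar> powr \<alpha>) \<longlongrightarrow> c * \<bar>x - x\<bar> powr \<alpha>) (at x)"
        by (intro tendsto_intros tendsto_powr') (use assms(2) in auto)
      then have "((\<lambda>y. c * \<bar>y - x\<bar> powr \<alpha>) \<longlongrightarrow> 0) (at x)"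
        by simp
      then have "((\<lambda>y. f y - f x) \<longlongrightarrow> 0) (at x)"
        by (rule Lim_null_comparison[rotated]) (use F True in auto)
      then show ?thesis
        by (simp add: isCont_def LIM_zero_iff)
    qed
    then show ?thesis
      by (simp add: continuous_at_imp_continuous_on)
  next
    case False
    then have "isCont f x" for x
      using deriv_chain_D[OF F(2), of 0] F(1) DERIV_isCont by auto
    then show ?thesis
      by (simp add: continuous_at_imp_continuous_on)
  qed
qed

text \<open>The Leibniz formula as a chain: differentiating one level and regrouping by Pascal's
  rule yields the next.\<close>

lemma deriv_chain_mult:
  assumes "deriv_chain m F" "deriv_chain m G"
  shows "deriv_chain m (\<lambda>n x. \<Sum>k\<le>n. real (n choose k) * (F k x * G (n - k) x))"
  unfolding deriv_chain_def
proof (intro allI impI)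
  fix n x assume n: "n < m"
  have "((\<lambda>x. \<Sum>k\<le>n. real (n choose k) * (F k x * G (n - k) x)) has_real_derivative
      (\<Sum>k\<le>n. real (n choose k) * (F (Suc k) x * G (n - k) x + F k x * G (Suc (n - k)) x))) (at x)"
    using n
    by (intro DERIV_sum DERIV_cmult)
       (auto intro!: derivative_eq_intros deriv_chain_D[OF assms(1)] deriv_chain_D[OF assms(2)])
  also have "(\<Sum>k\<le>n. real (n choose k) * (F (Suc k) x * G (n - k) x + F k x * G (Suc (n - k)) x)) =
      (\<Sum>k\<le>n. real (n choose k) * (F (Suc k) x * G (n - k) x)) +
      (\<Sum>k\<le>n. real (n choose k) * (F k x * G (Suc n - k) x))"
    by (subst sum.distrib[symmetric]) (auto intro!: sum.cong simp: algebra_simps Suc_diff_le)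
  \<comment> \<open>The added term k = n + 1 is 0, since \<open>n choose Suc n\<close> is.\<close>
  also have "(\<Sum>k\<le>n. real (n choose k) * (F k x * G (Suc n - k) x)) =
      (\<Sum>k\<le>Suc n. real (n choose k) * (F k x * G (Suc n - k) x))"
    by simp
  also have "\<dots> = F 0 x * G (Suc n) x + (\<Sum>k\<le>n. real (n choose Suc k) * (F (Suc k) x * G (n - k) x))"
    by (subst sum.atMost_Suc_shift) simp
  also have "(\<Sum>k\<le>n. real (n choose k) * (F (Suc k) x * G (n - k) x)) + \<dots> =
      F 0 x * G (Suc n) x + (\<Sum>k\<le>n. real (Suc n choose Suc k) * (F (Suc k) x * G (n - k) x))"
    by (simp add: sum.distrib distrib_right)
  also have "\<dots> = (\<Sum>k\<le>Suc n. real (Suc n choose k) * (F k x * G (Suc n - k) x))"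
    by (simp add: sum.atMost_Suc_shift del: sum.atMost_Suc binomial_Suc_Suc)
  finally show "((\<lambda>x. \<Sum>k\<le>n. real (n choose k) * (F k x * G (n - k) x)) has_real_derivative
      (\<Sum>k\<le>Suc n. real (Suc n choose k) * (F k x * G (Suc n - k) x))) (at x)" .
qed

section \<open>Gaussian bumps and their averages over dyadic scales\<close>

lemma poly_times_gaussian_bounded:
  fixes p :: "real poly"
  shows "0 < c \<Longrightarrow> \<exists>C\<ge>0. \<forall>y. \<bar>poly p y\<bar> * exp (- c * y\<^sup>2) \<le> C"
proof (induction p arbitrary: c)
  case 0
  then show ?case by auto
next
  case (pCons a p)
  \<comment> \<open>Half of the Gaussian factor goes to the remaining polynomial and half absorbs
    the factor y; hence c is generalised in the induction.\<close>
  obtain C where C: "C \<ge> 0" "\<And>y. \<bar>poly p y\<bar> * exp (- (c/2) * y\<^sup>2) \<le> C"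
    using pCons.IH[of "c/2"] pCons.prems by auto
  have y: "\<bar>y\<bar> * exp (- (c/2) * y\<^sup>2) \<le> 1 + 2 / c" for y :: real
  proof -
    have "0 \<le> (\<bar>y\<bar> - 1)\<^sup>2" by simp
    then have "2 * \<bar>y\<bar> \<le> 1 + y\<^sup>2" by (simp add: power2_diff)
    then have "\<bar>y\<bar> \<le> 1 + y\<^sup>2" by (smt (verit) zero_le_power2)
    also have "\<dots> \<le> (1 + 2 / c) * (1 + (c/2) * y\<^sup>2)"
      using pCons.prems by (simp add: field_simps)
    also have "\<dots> \<le> (1 + 2 / c) * exp ((c/2) * y\<^sup>2)"
      using pCons.prems by (intro mult_left_mono exp_ge_add_one_self) auto
    finally show ?thesis by (simp add: exp_minus field_simps)
  qed
  have "\<bar>poly (pCons a p) y\<bar> * exp (- c * y\<^sup>2) \<le> \<bar>a\<bar> + (1 + 2 / c) * C" for y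
  proof -
    have e: "exp (- c * y\<^sup>2) = exp (- (c/2) * y\<^sup>2) * exp (- (c/2) * y\<^sup>2)"
      by (simp flip: exp_add)
    have "\<bar>poly (pCons a p) y\<bar> * exp (- c * y\<^sup>2) \<le> (\<bar>a\<bar> + \<bar>y\<bar> * \<bar>poly p y\<bar>) * exp (- c * y\<^sup>2)"
      by (intro mult_right_mono) (auto simp: abs_mult intro: order_trans[OF abs_triangle_ineq])
    also have "\<dots> = \<bar>a\<bar> * exp (- c * y\<^sup>2) + (\<bar>y\<bar> * exp (- (c/2) * y\<^sup>2)) * (\<bar>poly p y\<bar> * exp (- (c/2) * y\<^sup>2))"
      unfolding e by (simp add: algebra_simps)
    also have "\<dots> \<le> \<bar>a\<bar> * 1 + (1 + 2 / c) * C"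
      using pCons.prems C y by (intro add_mono mult_mono) (auto simp: mult_nonneg_nonneg)
    finally show ?thesis by simp
  qed
  then show ?case using C(1) pCons.prems by (intro exI[of _ "\<bar>a\<bar> + (1 + 2 / c) * C"]) auto
qed

text \<open>Up to the sign (-1)^k these are the Hermite polynomials for the weight exp (-
  y^2).\<close>

primrec gauss_poly :: "nat \<Rightarrow> real poly" where
  "gauss_poly 0 = 1"
| "gauss_poly (Suc k) = pderiv (gauss_poly k) - [:0, 2:] * gauss_poly k"

definition gauss_deriv :: "nat \<Rightarrow> real \<Rightarrow> real" where
  "gauss_deriv k y = poly (gauss_poly k) y * exp (- y\<^sup>2)"

lemma DERIV_gauss_deriv: "(gauss_deriv k has_real_derivative gauss_deriv (Suc k) y) (at y)"
  unfolding gauss_deriv_def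
  by (auto intro!: derivative_eq_intros poly_DERIV simp: algebra_simps)

lemma gauss_deriv_bounded: "\<exists>C\<ge>0. \<forall>y. \<bar>poly q y * gauss_deriv k y\<bar> \<le> C"
  using poly_times_gaussian_bounded[of 1 "q * gauss_poly k"]
  by (simp add: gauss_deriv_def abs_mult mult.assoc)

text \<open>\<open>cutoff n k\<close> is the derivative of order \<open>k\<close> of the average of \<open>exp (- (x / 2\<^sup>i)\<^sup>2)\<close> over \<open>i = 1, \<dots>, n\<close>.\<close>
definition cutoff :: "nat \<Rightarrow> nat \<Rightarrow> real \<Rightarrow> real" where
  "cutoff n k x = (\<Sum>i=1..n. (1 / 2 ^ i) ^ k * gauss_deriv k (x / 2 ^ i)) / real n"

lemma DERIV_cutoff: "(cutoff n k has_real_derivative cutoff n (Suc k) x) (at x)"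
proof -
  have "((\<lambda>x. (1 / 2 ^ i) ^ k * gauss_deriv k (x / 2 ^ i)) has_real_derivative
      (1 / 2 ^ i) ^ Suc k * gauss_deriv (Suc k) (x / 2 ^ i)) (at x)" for i
    by (auto intro!: derivative_eq_intros DERIV_chain2[OF DERIV_gauss_deriv])
  then show ?thesis
    unfolding cutoff_def by (intro DERIV_cdivide DERIV_sum)
qed

lemma gauss_deriv_0: "gauss_deriv 0 y = exp (- y\<^sup>2)"
  by (simp add: gauss_deriv_def)

lemma cutoff_0_range: "n \<ge> 1 \<Longrightarrow> 0 \<le> cutoff n 0 x \<and> cutoff n 0 x \<le> 1"
proof -
  assume n: "n \<ge> 1"
  have "(\<Sum>i=1..n. exp (- (x / 2 ^ i)\<^sup>2)) \<le> (\<Sum>i=1..n. 1)"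
    by (intro sum_mono) simp
  then have "(\<Sum>i=1..n. exp (- (x / 2 ^ i)\<^sup>2)) \<le> real n" by simp
  moreover have "0 \<le> (\<Sum>i=1..n. exp (- (x / 2 ^ i)\<^sup>2))" by (intro sum_nonneg) auto
  moreover have "cutoff n 0 x = (\<Sum>i=1..n. exp (- (x / 2 ^ i)\<^sup>2)) / real n"
    by (simp add: cutoff_def gauss_deriv_0)
  ultimately show ?thesis using n by (simp add: divide_le_eq_1)
qed

lemma cutoff_even: "cutoff n 0 (- x) = cutoff n 0 x"
  by (simp add: cutoff_def gauss_deriv_0)

lemma sum_half_powers: "(\<Sum>i=1..n. 1 / 2 ^ i) \<le> (1::real)"
proof -
  have "(\<Sum>i=1..n. 1 / 2 ^ i) = 1 - 1 / (2::real) ^ n"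
    by (induction n) (auto simp: field_simps)
  then show ?thesis by simp
qed

text \<open>The defects \<open>1 - exp (- (x / 2 ^ i)\<^sup>2)\<close> have a sum over i of at most
  x^2, so their average over n scales is at most x^2 / n.\<close>

lemma cutoff_0_tendsto: "(\<lambda>n. cutoff n 0 x) \<longlonglongrightarrow> 1"
proof -
  have "\<bar>cutoff n 0 x - 1\<bar> \<le> x\<^sup>2 * inverse (real n)" if n: "n \<ge> 1" for n
  proof -
    have "(\<Sum>i=1..n. 1 - exp (- (x / 2 ^ i)\<^sup>2)) \<le> (\<Sum>i=1..n. x\<^sup>2 * (1 / 2 ^ i))"
    proof (intro sum_mono)
      fix i
      have "1 - exp (- (x / 2 ^ i)\<^sup>2) \<le> (x / 2 ^ i)\<^sup>2"
        using exp_ge_add_one_self[of "- (x / 2 ^ i)\<^sup>2"] by linarith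
      also have "\<dots> = x\<^sup>2 * (1 / 2 ^ i) * (1 / 2 ^ i)"
        by (simp add: power2_eq_square)
      also have "\<dots> \<le> x\<^sup>2 * (1 / 2 ^ i) * 1"
        by (intro mult_left_mono) auto
      finally show "1 - exp (- (x / 2 ^ i)\<^sup>2) \<le> x\<^sup>2 * (1 / 2 ^ i)" by simp
    qed
    also have "\<dots> \<le> x\<^sup>2 * 1"
      unfolding sum_distrib_left[symmetric] by (intro mult_left_mono sum_half_powers) auto
    finally have "real n - (\<Sum>i=1..n. exp (- (x / 2 ^ i)\<^sup>2)) \<le> x\<^sup>2"
      by (simp add: sum_subtractf)
    then have "(real n - (\<Sum>i=1..n. exp (- (x / 2 ^ i)\<^sup>2))) / real n \<le> x\<^sup>2 / real n"
      by (intro divide_right_mono) auto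
    moreover have "(real n - S) / real n = 1 - S / real n" for S
      using n by (simp add: diff_divide_distrib)
    moreover have "cutoff n 0 x = (\<Sum>i=1..n. exp (- (x / 2 ^ i)\<^sup>2)) / real n"
      by (simp add: cutoff_def gauss_deriv_0)
    ultimately have "1 - cutoff n 0 x \<le> x\<^sup>2 * inverse (real n)"
      by (simp only: divide_inverse)
    then show ?thesis using cutoff_0_range[OF n, of x] by simp
  qed
  then have "\<forall>\<^sub>F n in sequentially. norm (cutoff n 0 x - 1) \<le> x\<^sup>2 * inverse (real n)"
    by (intro eventually_sequentiallyI[of 1]) simp
  moreover have "(\<lambda>n. x\<^sup>2 * inverse (real n)) \<longlonglongrightarrow> 0"
    using tendsto_mult_left[OF lim_inverse_n, of "x\<^sup>2"] by simp
  ultimately have "(\<lambda>n. cutoff n 0 x - 1) \<longlonglongrightarrow> 0"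
    by (rule Lim_null_comparison)
  then show ?thesis by (simp add: LIM_zero_iff)
qed

text \<open>\<open>y / (1 + y\<^sup>2)\<close> is \<open>y\<close> times the derivative of \<open>arctan\<close>, so its sum over dyadic scales telescopes.\<close>
lemma dyadic_sum_bound: "(\<Sum>i=1..n. \<bar>x / 2 ^ i\<bar> / (1 + (x / 2 ^ i)\<^sup>2)) \<le> 4 * pi"
proof -
  have step: "y / (1 + y\<^sup>2) \<le> 4 * (arctan (2 * y) - arctan y)" if y: "0 \<le> y" for y :: real
  proof (cases "y = 0")
    case False
    then have y: "0 < y" using y by simp
    have "\<exists>z. y < z \<and> z < 2 * y \<and> arctan (2 * y) - arctan y = (2 * y - y) * inverse (1 + z\<^sup>2)"
      by (rule MVT2) (use y in \<open>auto intro!: DERIV_arctan\<close>)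
    then obtain z where z: "y < z" "z < 2 * y" "arctan (2 * y) - arctan y = y * inverse (1 + z\<^sup>2)"
      by auto
    have "z\<^sup>2 \<le> (2 * y)\<^sup>2" using z y by (intro power_mono) auto
    then have "1 + z\<^sup>2 \<le> 4 * (1 + y\<^sup>2)" by (simp add: power_mult_distrib)
    then have "inverse (4 * (1 + y\<^sup>2)) \<le> inverse (1 + z\<^sup>2)"
      by (intro le_imp_inverse_le) (auto intro: add_pos_nonneg)
    then have "y * inverse (4 * (1 + y\<^sup>2)) \<le> arctan (2 * y) - arctan y"
      unfolding z(3) using y by (intro mult_left_mono) auto
    moreover have "y * inverse (4 * (1 + y\<^sup>2)) = y / (1 + y\<^sup>2) / 4"
      by (simp add: inverse_eq_divide)
    ultimately have "y / (1 + y\<^sup>2) / 4 \<le> arctan (2 * y) - arctan y" by (simp only:)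
    moreover have "q / 4 \<le> d \<Longrightarrow> q \<le> 4 * d" for q d :: real by simp
    ultimately show ?thesis by blast
  qed simp
  have "(\<Sum>i=1..n. \<bar>x / 2 ^ i\<bar> / (1 + (x / 2 ^ i)\<^sup>2)) = (\<Sum>i=1..n. (\<bar>x\<bar> / 2 ^ i) / (1 + (\<bar>x\<bar> / 2 ^ i)\<^sup>2))"
    by (intro sum.cong) (auto simp: power_divide)
  also have "\<dots> \<le> (\<Sum>i=1..n. 4 * (arctan (2 * (\<bar>x\<bar> / 2 ^ i)) - arctan (\<bar>x\<bar> / 2 ^ i)))"
    by (intro sum_mono step) auto
  also have "\<dots> = 4 * (\<Sum>i=1..n. arctan (2 * (\<bar>x\<bar> / 2 ^ i)) - arctan (\<bar>x\<bar> / 2 ^ i))"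
    by (rule sum_distrib_left[symmetric])
  also have "(\<Sum>i=1..n. arctan (2 * (\<bar>x\<bar> / 2 ^ i)) - arctan (\<bar>x\<bar> / 2 ^ i)) = arctan \<bar>x\<bar> - arctan (\<bar>x\<bar> / 2 ^ n)"
  proof (induction n)
    case (Suc n)
    have "2 * (\<bar>x\<bar> / 2 ^ Suc n) = \<bar>x\<bar> / 2 ^ n" by simp
    then show ?case using Suc by (simp only: sum.nat_ivl_Suc' Suc_eq_plus1[symmetric]) simp
  qed simp
  also have "4 * \<dots> \<le> 4 * pi"
    using arctan_ubound[of "\<bar>x\<bar>"] arctan_lbound[of "\<bar>x\<bar> / 2 ^ n"] by simp
  finally show ?thesis .
qed

text \<open>The factor 1 / n is the gain over a single bump. The sum over the scales is bounded
  uniformly in n: near the origin by the geometric weights 2^(-i), far away by the telescoping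
  dyadic sum. For k = 0 no such bound exists, since at a fixed point nearly all bumps are close to
  1.\<close>

lemma cutoff_deriv_bound:
  assumes "k \<ge> 1"
  shows "\<exists>C\<ge>0. \<forall>n\<ge>1. \<forall>x. \<bar>cutoff n k x\<bar> \<le> C / real n * (1 + \<bar>x\<bar>) powr (- real k)"
proof -
  obtain A where A: "A \<ge> 0" "\<And>y. \<bar>gauss_deriv k y\<bar> \<le> A"
    using gauss_deriv_bounded[of 1 k] by auto
  \<comment> \<open>The polynomial (1 + y^2) y^(k - 1) is chosen so that y^k times the derivative
    gets the profile y / (1 + y^2) of \<open>dyadic_sum_bound\<close>.\<close>
  obtain B where B: "B \<ge> 0" "\<And>y. \<bar>poly ([:1, 0, 1:] * monom 1 (k - 1)) y * gauss_deriv k y\<bar> \<le> B"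
    using gauss_deriv_bounded[of "[:1, 0, 1:] * monom 1 (k - 1)" k] by auto
  have B': "\<bar>y\<bar> ^ k * \<bar>gauss_deriv k y\<bar> \<le> B * (\<bar>y\<bar> / (1 + y\<^sup>2))" for y
  proof -
    have "(1 + y\<^sup>2) * \<bar>y\<bar> ^ (k - 1) * \<bar>gauss_deriv k y\<bar> \<le> B"
    proof -
      have "poly [:1, 0, 1:] y = 1 + y\<^sup>2" by (simp add: power2_eq_square)
      moreover have "\<bar>1 + y\<^sup>2\<bar> = 1 + y\<^sup>2" by (simp add: add_nonneg_nonneg)
      ultimately show ?thesis using B(2)[of y]
        unfolding poly_mult poly_monom abs_mult power_abs by simp
    qed
    then have "\<bar>y\<bar> * ((1 + y\<^sup>2) * \<bar>y\<bar> ^ (k - 1) * \<bar>gauss_deriv k y\<bar>) \<le> \<bar>y\<bar> * B"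
      by (intro mult_left_mono) auto
    moreover have "\<bar>y\<bar> * \<bar>y\<bar> ^ (k - 1) = \<bar>y\<bar> ^ k"
      using assms by (cases k) auto
    ultimately have "(1 + y\<^sup>2) * (\<bar>y\<bar> ^ k * \<bar>gauss_deriv k y\<bar>) \<le> \<bar>y\<bar> * B"
      by (smt (verit) mult.assoc mult.commute)
    moreover have "0 < 1 + y\<^sup>2" by (intro add_pos_nonneg) auto
    ultimately show ?thesis by (simp add: field_simps)
  qed
  define C where "C = 2 ^ k * (A + B * (4 * pi))"
  have "\<bar>cutoff n k x\<bar> \<le> C / real n * (1 + \<bar>x\<bar>) powr (- real k)" if n: "n \<ge> 1" for n x
  proof -
    let ?S = "\<Sum>i=1..n. (1 / 2 ^ i) ^ k * \<bar>gauss_deriv k (x / 2 ^ i)\<bar>"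
    have "\<bar>\<Sum>i=1..n. (1 / 2 ^ i) ^ k * gauss_deriv k (x / 2 ^ i)\<bar> \<le> ?S"
      by (rule order_trans[OF sum_abs]) (simp add: abs_mult)
    then have cS: "\<bar>cutoff n k x\<bar> \<le> ?S / real n"
      using n by (simp add: cutoff_def divide_right_mono)
    have S1: "?S \<le> A"
    proof -
      have "?S \<le> (\<Sum>i=1..n. 1 / 2 ^ i * A)"
      proof (intro sum_mono mult_mono)
        fix i :: nat
        have "(1 / 2 ^ i) ^ k \<le> (1 / 2 ^ i :: real) ^ 1"
          using assms by (intro power_decreasing) auto
        then show "(1 / 2 ^ i) ^ k \<le> (1 / 2 ^ i :: real)" by simp
      qed (use A in auto)
      also have "\<dots> = (\<Sum>i=1..n. 1 / 2 ^ i) * A" by (simp add: sum_distrib_right)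
      also have "\<dots> \<le> 1 * A" by (intro mult_right_mono sum_half_powers A)
      finally show ?thesis by simp
    qed
    have "\<bar>x\<bar> ^ k * ?S = (\<Sum>i=1..n. \<bar>x / 2 ^ i\<bar> ^ k * \<bar>gauss_deriv k (x / 2 ^ i)\<bar>)"
      by (simp add: sum_distrib_left power_divide mult.assoc)
    also have "\<dots> \<le> (\<Sum>i=1..n. B * (\<bar>x / 2 ^ i\<bar> / (1 + (x / 2 ^ i)\<^sup>2)))"
      by (intro sum_mono B')
    also have "\<dots> \<le> B * (4 * pi)"
      unfolding sum_distrib_left[symmetric] by (intro mult_left_mono dyadic_sum_bound B)
    finally have S2: "\<bar>x\<bar> ^ k * ?S \<le> B * (4 * pi)" .
    have S0: "0 \<le> ?S" by (intro sum_nonneg) auto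
    have "(1 + \<bar>x\<bar>) ^ k \<le> 2 ^ k * (1 + \<bar>x\<bar> ^ k)"
    proof -
      have "(1 + \<bar>x\<bar>) ^ k \<le> (2 * max 1 \<bar>x\<bar>) ^ k" by (intro power_mono) auto
      also have "\<dots> = 2 ^ k * (max 1 \<bar>x\<bar>) ^ k" by (simp add: power_mult_distrib)
      also have "(max 1 \<bar>x\<bar>) ^ k \<le> 1 + \<bar>x\<bar> ^ k" by (auto simp: max_def)
      finally show ?thesis by simp
    qed
    then have "(1 + \<bar>x\<bar>) ^ k * ?S \<le> 2 ^ k * (1 + \<bar>x\<bar> ^ k) * ?S"
      by (intro mult_right_mono S0)
    also have "\<dots> = 2 ^ k * (?S + \<bar>x\<bar> ^ k * ?S)" by (simp add: algebra_simps)
    also have "\<dots> \<le> C" unfolding C_def using S1 S2 by (intro mult_left_mono) auto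
    finally have "?S \<le> C / (1 + \<bar>x\<bar>) ^ k"
      by (subst pos_le_divide_eq) (auto simp: mult.commute intro!: zero_less_power)
    then have "?S / real n \<le> C / (1 + \<bar>x\<bar>) ^ k / real n"
      by (intro divide_right_mono) auto
    also have "\<dots> = C / real n * (1 + \<bar>x\<bar>) powr (- real k)"
    proof -
      have "(1 + \<bar>x\<bar>) powr (- real k) = 1 / (1 + \<bar>x\<bar>) ^ k"
        by (simp add: powr_minus powr_realpow add_pos_nonneg inverse_eq_divide)
      then show ?thesis by (simp add: mult.commute)
    qed
    finally show ?thesis using cS by linarith
  qed
  moreover have "C \<ge> 0" unfolding C_def using A(1) B(1) by auto
  ultimately show ?thesis by blast
qed

section \<open>Truncation in the Zolotarev class\<close>

text \<open>Compares u with the primitive \<open>C / \<alpha> * (z - y) powr \<alpha>\<close> of the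
  bound. The derivative is estimated on the open interval only, because for \<alpha> < 1 the bound
  blows up at y.\<close>

lemma holder_of_singular_deriv:
  fixes u u' :: "real \<Rightarrow> real"
  assumes \<alpha>: "0 < \<alpha>" and yx: "y \<le> x"
    and u: "\<And>z. (u has_real_derivative u' z) (at z)"
    and bound: "\<And>z. y < z \<Longrightarrow> z < x \<Longrightarrow> \<bar>u' z\<bar> \<le> C * (z - y) powr (\<alpha> - 1)"
  shows "\<bar>u x - u y\<bar> \<le> C / \<alpha> * (x - y) powr \<alpha>"
proof -
  \<comment> \<open>The sign s splits the absolute value into two monotonicity statements.\<close>
  have main: "s * (u x - u y) \<le> C / \<alpha> * (x - y) powr \<alpha>" if s: "\<bar>s\<bar> = 1" for s :: real
  proof -
    define h where "h z = C / \<alpha> * (z - y) powr \<alpha> - s * u z" for z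
    have "h y \<le> h x"
    proof (rule DERIV_nonneg_imp_increasing_open[OF yx])
      fix z assume z: "y < z" "z < x"
      have "(h has_real_derivative (C * (z - y) powr (\<alpha> - 1) - s * u' z)) (at z)"
        unfolding h_def using z \<alpha>
        by (auto intro!: derivative_eq_intros u simp: powr_diff)
      moreover have "s * u' z \<le> \<bar>u' z\<bar>"
        using abs_ge_self[of "s * u' z"] s by (simp only: abs_mult)
      then have "0 \<le> C * (z - y) powr (\<alpha> - 1) - s * u' z"
        using bound[OF z] by linarith
      ultimately show "\<exists>d. (h has_real_derivative d) (at z) \<and> 0 \<le> d" by blast
    next
      show "continuous_on {y..x} h"
        unfolding h_def using \<alpha>
        by (intro continuous_intros continuous_on_powr' DERIV_continuous_on[of _ u u'])
           (auto intro: u[THEN has_field_derivative_at_within])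
    qed
    then show ?thesis using \<alpha> by (simp add: h_def algebra_simps)
  qed
  show ?thesis using main[of 1] main[of "-1"] by auto
qed

text \<open>For 0 <= y the decay in 1 + |z| is stronger than the singular bound in z - y, as
  \<alpha> - 1 <= 0. Negative arguments are reflected, and an interval around 0 is cut there, which
  costs the factor 2.\<close>

lemma holder_of_decaying_deriv:
  fixes u u' :: "real \<Rightarrow> real"
  assumes \<alpha>: "0 < \<alpha>" "\<alpha> \<le> 1" and C: "0 \<le> C"
    and u: "\<And>z. (u has_real_derivative u' z) (at z)"
    and bound: "\<And>z. \<bar>u' z\<bar> \<le> C * (1 + \<bar>z\<bar>) powr (\<alpha> - 1)"
  shows "\<bar>u x - u y\<bar> \<le> 2 * C / \<alpha> * \<bar>x - y\<bar> powr \<alpha>"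
proof -
  have pos: "\<bar>v x - v y\<bar> \<le> C / \<alpha> * (x - y) powr \<alpha>"
    if "0 \<le> y" "y \<le> x" and v: "\<And>z. (v has_real_derivative v' z) (at z)"
      "\<And>z. \<bar>v' z\<bar> \<le> C * (1 + \<bar>z\<bar>) powr (\<alpha> - 1)" for v v' x y
  proof (rule holder_of_singular_deriv[OF \<alpha>(1) that(2) v(1)])
    fix z assume "y < z" "z < x"
    then have "(1 + \<bar>z\<bar>) powr (\<alpha> - 1) \<le> (z - y) powr (\<alpha> - 1)"
      using that \<alpha> by (intro powr_mono2') auto
    then show "\<bar>v' z\<bar> \<le> C * (z - y) powr (\<alpha> - 1)"
      using v(2)[of z] C by (meson mult_left_mono order_trans)
  qed
  have neg: "\<bar>u x - u y\<bar> \<le> C / \<alpha> * (x - y) powr \<alpha>" if "x \<le> 0" "y \<le> x" for x y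
  proof -
    have "\<bar>u (- (- y)) - u (- (- x))\<bar> \<le> C / \<alpha> * (- y - - x) powr \<alpha>"
    proof (rule pos[where v' = "\<lambda>z. - u' (- z)"])
      show "((\<lambda>z. u (- z)) has_real_derivative - u' (- z)) (at z)" for z
        using u[of "- z"] by (simp add: DERIV_mirror)
      show "\<bar>- u' (- z)\<bar> \<le> C * (1 + \<bar>z\<bar>) powr (\<alpha> - 1)" for z
        using bound[of "- z"] by simp
    qed (use that in auto)
    then show ?thesis by (simp add: abs_minus_commute)
  qed
  have ordered: "\<bar>u x - u y\<bar> \<le> 2 * C / \<alpha> * \<bar>x - y\<bar> powr \<alpha>" if xy: "y \<le> x" for x y
  proof -
    have nn: "0 \<le> C / \<alpha> * (x - y) powr \<alpha>" using C \<alpha> by simp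
    consider "0 \<le> y" | "x \<le> 0" | "y < 0" "0 < x" by linarith
    then show ?thesis
    proof cases
      case 1
      then show ?thesis using pos[OF 1 xy u bound] nn xy by simp
    next
      case 2
      then show ?thesis using neg[OF 2 xy] nn xy by simp
    next
      case 3
      have a: "\<bar>u x - u 0\<bar> \<le> C / \<alpha> * (x - 0) powr \<alpha>"
        using pos[OF _ _ u bound, of 0 x] 3 by simp
      have b: "\<bar>u 0 - u y\<bar> \<le> C / \<alpha> * (0 - y) powr \<alpha>"
        using neg[of 0 y] 3 by simp
      have "C / \<alpha> * (x - 0) powr \<alpha> \<le> C / \<alpha> * (x - y) powr \<alpha>"
        using 3 C \<alpha> by (intro mult_left_mono powr_mono2) auto
      moreover have "C / \<alpha> * (0 - y) powr \<alpha> \<le> C / \<alpha> * (x - y) powr \<alpha>"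
        using 3 C \<alpha> by (intro mult_left_mono powr_mono2) auto
      ultimately have "\<bar>u x - u y\<bar> \<le> 2 * (C / \<alpha> * (x - y) powr \<alpha>)"
        using a b by linarith
      then show ?thesis using xy by simp
    qed
  qed
  show ?thesis
    using ordered[of y x] ordered[of x y] by (cases "y \<le> x") (auto simp: abs_minus_commute)
qed

text \<open>Downward induction from the Hoelder bound at order m: each mean value estimate from the
  origin raises the exponent by one.\<close>

lemma deriv_chain_growth:
  assumes F: "deriv_chain m F" and \<alpha>: "0 < \<alpha>"
    and h: "\<And>x y. \<bar>F m x - F m y\<bar> \<le> c * \<bar>x - y\<bar> powr \<alpha>" and c: "0 \<le> c" and k: "k \<le> m"
  shows "\<exists>C\<ge>0. \<forall>x. \<bar>F k x\<bar> \<le> C * (1 + \<bar>x\<bar>) powr (real m + \<alpha> - real k)"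
  using k
proof (induction k rule: inc_induct)
  case base
  have "\<bar>F m x\<bar> \<le> (\<bar>F m 0\<bar> + c) * (1 + \<bar>x\<bar>) powr \<alpha>" for x
  proof -
    have "\<bar>F m x\<bar> \<le> \<bar>F m 0\<bar> + c * \<bar>x\<bar> powr \<alpha>" using h[of x 0] by simp
    also have "\<dots> \<le> \<bar>F m 0\<bar> * (1 + \<bar>x\<bar>) powr \<alpha> + c * (1 + \<bar>x\<bar>) powr \<alpha>"
      using \<alpha> c ge_one_powr_ge_zero[of "1 + \<bar>x\<bar>" \<alpha>]
      by (intro add_mono mult_left_mono powr_mono2) (auto simp: mult_le_cancel_left1)
    finally show ?thesis by (simp add: distrib_right)
  qed
  then show ?case using c by (intro exI[of _ "\<bar>F m 0\<bar> + c"]) auto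
next
  case (step k)
  obtain C where C: "C \<ge> 0" "\<And>x. \<bar>F (Suc k) x\<bar> \<le> C * (1 + \<bar>x\<bar>) powr (real m + \<alpha> - real (Suc k))"
    using step.IH by auto
  let ?e = "real m + \<alpha> - real (Suc k)"
  have e: "0 \<le> ?e" using step.hyps \<alpha> by simp
  have "\<bar>F k x\<bar> \<le> (\<bar>F k 0\<bar> + C) * (1 + \<bar>x\<bar>) powr (real m + \<alpha> - real k)" for x
  proof -
    have "norm (F k x - F k 0) \<le> (C * (1 + \<bar>x\<bar>) powr ?e) * norm (x - 0)"
    proof (rule field_differentiable_bound[of "{-\<bar>x\<bar>..\<bar>x\<bar>}"])
      fix z assume "z \<in> {-\<bar>x\<bar>..\<bar>x\<bar>}"
      then have "(1 + \<bar>z\<bar>) powr ?e \<le> (1 + \<bar>x\<bar>) powr ?e"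
        using e by (intro powr_mono2) auto
      then show "norm (F (Suc k) z) \<le> C * (1 + \<bar>x\<bar>) powr ?e"
        using C(1) C(2)[of z] by (simp) (meson mult_left_mono order_trans)
    qed (auto intro!: has_field_derivative_at_within deriv_chain_D[OF F] step.hyps)
    then have "\<bar>F k x\<bar> \<le> \<bar>F k 0\<bar> + C * (1 + \<bar>x\<bar>) powr ?e * \<bar>x\<bar>" by simp
    also have "\<dots> \<le> \<bar>F k 0\<bar> * (1 + \<bar>x\<bar>) powr (real m + \<alpha> - real k) + C * (1 + \<bar>x\<bar>) powr ?e * (1 + \<bar>x\<bar>)"
      using C e ge_one_powr_ge_zero[of "1 + \<bar>x\<bar>" "real m + \<alpha> - real k"]
      by (intro add_mono mult_left_mono) (auto simp: mult_le_cancel_left1)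
    also have "C * (1 + \<bar>x\<bar>) powr ?e * (1 + \<bar>x\<bar>) = C * (1 + \<bar>x\<bar>) powr (?e + 1)"
      by (simp only: powr_add) simp
    also have "?e + 1 = real m + \<alpha> - real k" by simp
    finally show ?thesis by (simp add: distrib_right)
  qed
  then show ?case using C by (intro exI[of _ "\<bar>F k 0\<bar> + C"]) auto
qed

text \<open>Since \<open>\<bar>\<chi>'(z)\<bar> \<le> \<epsilon> / (1 + \<bar>z\<bar>)\<close>, the increment of the even cutoff \<open>\<chi>\<close> over \<open>[\<bar>y\<bar>, \<bar>x\<bar>]\<close> compensates the growth of a function of order \<open>\<alpha>\<close> at the
  endpoint closer to the origin, and only there.\<close>
lemma cutoff_increment:
  assumes \<alpha>: "0 < \<alpha>" "\<alpha> \<le> 1" and C: "0 \<le> C"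
    and d: "\<And>z. \<bar>cutoff n 1 z\<bar> \<le> C * (1 + \<bar>z\<bar>) powr (- 1)" and yx: "\<bar>y\<bar> \<le> \<bar>x\<bar>"
  shows "(1 + \<bar>y\<bar>) powr \<alpha> * \<bar>cutoff n 0 x - cutoff n 0 y\<bar> \<le> C / \<alpha> * \<bar>x - y\<bar> powr \<alpha>"
proof -
  have even: "cutoff n 0 z = cutoff n 0 \<bar>z\<bar>" for z
    using cutoff_even[of n z] by (cases "0 \<le> z") auto
  define u where "u z = (1 + \<bar>y\<bar>) powr \<alpha> * cutoff n 0 z" for z
  have "\<bar>u \<bar>x\<bar> - u \<bar>y\<bar>\<bar> \<le> C / \<alpha> * (\<bar>x\<bar> - \<bar>y\<bar>) powr \<alpha>"
  proof (rule holder_of_singular_deriv[OF \<alpha>(1) yx])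
    show "(u has_real_derivative (1 + \<bar>y\<bar>) powr \<alpha> * cutoff n 1 z) (at z)" for z
      unfolding u_def using DERIV_cutoff[of n 0] by (auto intro!: DERIV_cmult)
    fix z assume z: "\<bar>y\<bar> < z" "z < \<bar>x\<bar>"
    have "(1 + \<bar>y\<bar>) powr \<alpha> * \<bar>cutoff n 1 z\<bar> \<le> (1 + \<bar>z\<bar>) powr \<alpha> * (C * (1 + \<bar>z\<bar>) powr (- 1))"
      using z \<alpha> by (intro mult_mono d powr_mono2) auto
    also have "\<dots> = C * (1 + \<bar>z\<bar>) powr (\<alpha> - 1)"
      by (simp add: powr_diff powr_minus divide_inverse)
    also have "\<dots> \<le> C * (z - \<bar>y\<bar>) powr (\<alpha> - 1)"
      using z \<alpha> C by (intro mult_left_mono powr_mono2') auto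
    finally show "\<bar>(1 + \<bar>y\<bar>) powr \<alpha> * cutoff n 1 z\<bar> \<le> C * (z - \<bar>y\<bar>) powr (\<alpha> - 1)"
      by (simp add: abs_mult)
  qed
  also have "\<dots> \<le> C / \<alpha> * \<bar>x - y\<bar> powr \<alpha>"
    using yx \<alpha> C by (intro mult_left_mono powr_mono2) auto
  finally show ?thesis
    by (simp add: u_def abs_mult even[of x] even[of y] flip: right_diff_distrib)
qed

text \<open>Every bump in the average lies below the widest one, i = n, whose Gaussian decay beats
  any power. The bound may depend on n.\<close>

lemma cutoff_times_power_bounded:
  assumes f: "\<And>x. \<bar>f x\<bar> \<le> C * (1 + \<bar>x\<bar>) powr s" and C: "0 \<le> C" and n: "n \<ge> 1"
  shows "\<exists>B. \<forall>x. \<bar>f x * cutoff n 0 x\<bar> \<le> B"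
proof -
  define k where "k = nat \<lceil>s\<rceil>"
  define c :: real where "c = (1 / 2 ^ n)\<^sup>2"
  have c: "0 < c" by (simp add: c_def)
  obtain B where B: "B \<ge> 0" "\<And>y. \<bar>poly (monom 1 k) y\<bar> * exp (- c * y\<^sup>2) \<le> B"
    using poly_times_gaussian_bounded[OF c, of "monom 1 k"] by auto
  have co: "cutoff n 0 x \<le> exp (- c * x\<^sup>2)" for x
  proof -
    have "(\<Sum>i=1..n. exp (- (x / 2 ^ i)\<^sup>2)) \<le> (\<Sum>i=1..n. exp (- c * x\<^sup>2))"
    proof (intro sum_mono)
      fix i assume "i \<in> {1..n}"
      then have "(1 / 2 ^ n)\<^sup>2 \<le> (1 / 2 ^ i :: real)\<^sup>2"
        by (intro power_mono divide_left_mono power_increasing) auto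
      then have "c * x\<^sup>2 \<le> (1 / 2 ^ i)\<^sup>2 * x\<^sup>2"
        unfolding c_def by (intro mult_right_mono) auto
      then show "exp (- (x / 2 ^ i)\<^sup>2) \<le> exp (- c * x\<^sup>2)"
        by (simp add: power_divide)
    qed
    then show ?thesis using n by (simp add: cutoff_def gauss_deriv_0 divide_simps mult.commute)
  qed
  have "\<bar>f x * cutoff n 0 x\<bar> \<le> C * (2 ^ k * (1 + B))" for x
  proof -
    have "(1 + \<bar>x\<bar>) powr s \<le> (1 + \<bar>x\<bar>) powr (real k)"
      unfolding k_def by (intro powr_mono) linarith+
    also have "\<dots> = (1 + \<bar>x\<bar>) ^ k" by (simp add: powr_realpow add_pos_nonneg)
    also have "\<dots> \<le> (2 * max 1 \<bar>x\<bar>) ^ k" by (intro power_mono) auto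
    also have "\<dots> = 2 ^ k * (max 1 \<bar>x\<bar>) ^ k" by (simp add: power_mult_distrib)
    also have "\<dots> \<le> 2 ^ k * (1 + \<bar>x\<bar> ^ k)"
      by (intro mult_left_mono) (auto simp: max_def)
    finally have fx: "\<bar>f x\<bar> \<le> C * (2 ^ k * (1 + \<bar>x\<bar> ^ k))"
      using f[of x] C by (meson mult_left_mono order_trans)
    have "\<bar>f x * cutoff n 0 x\<bar> \<le> C * (2 ^ k * (1 + \<bar>x\<bar> ^ k)) * exp (- c * x\<^sup>2)"
      unfolding abs_mult using fx co[of x] cutoff_0_range[OF n, of x] C
      by (intro mult_mono) auto
    also have "\<dots> = C * (2 ^ k * (exp (- c * x\<^sup>2) + \<bar>x\<bar> ^ k * exp (- c * x\<^sup>2)))"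
      by (simp add: algebra_simps)
    also have "\<dots> \<le> C * (2 ^ k * (1 + B))"
      using B(2)[of x] c C
      by (intro mult_left_mono add_mono) (auto simp: poly_monom power_abs)
    finally show ?thesis .
  qed
  then show ?thesis by blast
qed

text \<open>In the Leibniz expansion of the m-th derivative, a summand with k < m has a derivative
  of size (1 / n) (1 + |z|)^(\<alpha> - 1), growth and decay exponents adding up to \<alpha> - 1, so
  it is Hoelder with constant O(1 / n). The summand k = m contributes the constant 1 from f and
  another O(1 / n) from the increments of the cutoff.\<close>

lemma holder_deriv_truncation:
  assumes \<alpha>: "0 < \<alpha>" "\<alpha> \<le> 1" and f: "holder_deriv m \<alpha> 1 f"
  obtains C g where "\<And>n. n \<ge> 1 \<Longrightarrow> holder_deriv m \<alpha> (1 + C / real n) (g n)"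
    "\<And>n. n \<ge> 1 \<Longrightarrow> \<exists>B. \<forall>x. \<bar>g n x\<bar> \<le> B"
    "\<And>n x. n \<ge> 1 \<Longrightarrow> \<bar>g n x\<bar> \<le> \<bar>f x\<bar>" "\<And>x. (\<lambda>n. g n x) \<longlonglongrightarrow> f x" "0 \<le> C"
proof -
  obtain F where F: "F 0 = f" "deriv_chain m F" "\<And>x y. \<bar>F m x - F m y\<bar> \<le> 1 * \<bar>x - y\<bar> powr \<alpha>"
    using f unfolding holder_deriv_def by blast
  have "\<forall>k\<le>m. \<exists>C\<ge>0. \<forall>x. \<bar>F k x\<bar> \<le> C * (1 + \<bar>x\<bar>) powr (real m + \<alpha> - real k)"
    using deriv_chain_growth[OF F(2) \<alpha>(1) F(3)] by auto
  then obtain A where A: "\<And>k. k \<le> m \<Longrightarrow> A k \<ge> 0"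
      "\<And>k x. k \<le> m \<Longrightarrow> \<bar>F k x\<bar> \<le> A k * (1 + \<bar>x\<bar>) powr (real m + \<alpha> - real k)"
    by metis
  have "\<forall>k\<ge>1. \<exists>C\<ge>0. \<forall>n\<ge>1. \<forall>x. \<bar>cutoff n k x\<bar> \<le> C / real n * (1 + \<bar>x\<bar>) powr (- real k)"
    using cutoff_deriv_bound by blast
  then obtain B where B: "\<And>k. k \<ge> 1 \<Longrightarrow> B k \<ge> 0"
      "\<And>k n x. k \<ge> 1 \<Longrightarrow> n \<ge> 1 \<Longrightarrow> \<bar>cutoff n k x\<bar> \<le> B k / real n * (1 + \<bar>x\<bar>) powr (- real k)"
    by metis
  \<comment> \<open>\<open>D k\<close> bounds the two terms in the derivative of
    \<open>F k * cutoff n (m - k)\<close>. In C, the factor 2 / \<alpha> is the loss in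
    \<open>holder_of_decaying_deriv\<close>, and the first summand comes from
    \<open>cutoff_increment\<close>.\<close>
  define D where "D k = A (Suc k) * B (m - k) + A k * B (Suc (m - k))" for k
  define C where "C = A m * B 1 / \<alpha> + (\<Sum>k<m. real (m choose k) * (2 * D k / \<alpha>))"
  have D0: "0 \<le> D k" if "k < m" for k
    using that A(1) B(1) unfolding D_def by (intro add_nonneg_nonneg mult_nonneg_nonneg) auto
  have C0: "0 \<le> C"
    unfolding C_def using A(1) B(1) \<alpha>
    by (intro add_nonneg_nonneg divide_nonneg_pos sum_nonneg mult_nonneg_nonneg D0) auto
  define g where "g n x = f x * cutoff n 0 x" for n x
  have "holder_deriv m \<alpha> (1 + C / real n) (g n)" if n: "n \<ge> 1" for n
  proof -
    define G where "G j x = (\<Sum>k\<le>j. real (j choose k) * (F k x * cutoff n (j - k) x))" for j x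
    have cc: "deriv_chain m (cutoff n)"
      by (simp add: deriv_chain_def DERIV_cutoff)
    have "deriv_chain m G"
      unfolding G_def by (rule deriv_chain_mult[OF F(2) cc])
    moreover have "G 0 = g n" by (auto simp: G_def g_def F(1))
    moreover have "\<bar>G m x - G m y\<bar> \<le> (1 + C / real n) * \<bar>x - y\<bar> powr \<alpha>" for x y
    proof -
      have low: "\<bar>F k x * cutoff n (m - k) x - F k y * cutoff n (m - k) y\<bar> \<le>
          2 * (D k / real n) / \<alpha> * \<bar>x - y\<bar> powr \<alpha>" if k: "k < m" for k
      proof (rule holder_of_decaying_deriv[OF \<alpha>])
        show "0 \<le> D k / real n" using D0[OF k] by simp
        show "((\<lambda>z. F k z * cutoff n (m - k) z) has_real_derivative
            F (Suc k) z * cutoff n (m - k) z + F k z * cutoff n (Suc (m - k)) z) (at z)" for z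
          by (auto intro!: derivative_eq_intros deriv_chain_D[OF F(2) k] DERIV_cutoff)
        show "\<bar>F (Suc k) z * cutoff n (m - k) z + F k z * cutoff n (Suc (m - k)) z\<bar>
            \<le> D k / real n * (1 + \<bar>z\<bar>) powr (\<alpha> - 1)" for z
        proof -
          have "\<bar>F (Suc k) z * cutoff n (m - k) z\<bar> \<le>
              (A (Suc k) * (1 + \<bar>z\<bar>) powr (real m + \<alpha> - real (Suc k))) *
              (B (m - k) / real n * (1 + \<bar>z\<bar>) powr (- real (m - k)))"
            unfolding abs_mult using k n A(1)
            by (intro mult_mono A B) auto
          also have "\<dots> = A (Suc k) * B (m - k) / real n *
              ((1 + \<bar>z\<bar>) powr (real m + \<alpha> - real (Suc k)) * (1 + \<bar>z\<bar>) powr (- real (m - k)))"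
            by simp
          also have "(1 + \<bar>z\<bar>) powr (real m + \<alpha> - real (Suc k)) * (1 + \<bar>z\<bar>) powr (- real (m - k))
              = (1 + \<bar>z\<bar>) powr (\<alpha> - 1)"
            using k by (subst powr_add[symmetric]) (simp add: of_nat_diff)
          finally have 1: "\<bar>F (Suc k) z * cutoff n (m - k) z\<bar> \<le>
              A (Suc k) * B (m - k) / real n * (1 + \<bar>z\<bar>) powr (\<alpha> - 1)" .
          have "\<bar>F k z * cutoff n (Suc (m - k)) z\<bar> \<le>
              (A k * (1 + \<bar>z\<bar>) powr (real m + \<alpha> - real k)) *
              (B (Suc (m - k)) / real n * (1 + \<bar>z\<bar>) powr (- real (Suc (m - k))))"
            unfolding abs_mult using k n A(1)
            by (intro mult_mono A B) auto
          also have "\<dots> = A k * B (Suc (m - k)) / real n *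
              ((1 + \<bar>z\<bar>) powr (real m + \<alpha> - real k) * (1 + \<bar>z\<bar>) powr (- real (Suc (m - k))))"
            by simp
          also have "(1 + \<bar>z\<bar>) powr (real m + \<alpha> - real k) * (1 + \<bar>z\<bar>) powr (- real (Suc (m - k)))
              = (1 + \<bar>z\<bar>) powr (\<alpha> - 1)"
            using k by (subst powr_add[symmetric]) (simp add: of_nat_diff)
          finally have 2: "\<bar>F k z * cutoff n (Suc (m - k)) z\<bar> \<le>
              A k * B (Suc (m - k)) / real n * (1 + \<bar>z\<bar>) powr (\<alpha> - 1)" .
          have "D k / real n * (1 + \<bar>z\<bar>) powr (\<alpha> - 1) =
              A (Suc k) * B (m - k) / real n * (1 + \<bar>z\<bar>) powr (\<alpha> - 1) +
              A k * B (Suc (m - k)) / real n * (1 + \<bar>z\<bar>) powr (\<alpha> - 1)"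
            by (simp add: D_def add_divide_distrib distrib_right)
          then show ?thesis using 1 2 by linarith
        qed
      qed
      have top: "\<bar>F m x * cutoff n 0 x - F m y * cutoff n 0 y\<bar> \<le>
          (1 + A m * B 1 / \<alpha> / real n) * \<bar>x - y\<bar> powr \<alpha>"
      proof -
        \<comment> \<open>The increment of the product is split so that the increment of the cutoff
          meets \<open>F m\<close> at the endpoint closer to the origin, as
          \<open>cutoff_increment\<close> requires; exchanging x and y covers the other
          case.\<close>
        have *: "\<bar>F m x * cutoff n 0 x - F m y * cutoff n 0 y\<bar> \<le>
          (1 + A m * B 1 / \<alpha> / real n) * \<bar>x - y\<bar> powr \<alpha>" if yx: "\<bar>y\<bar> \<le> \<bar>x\<bar>" for x y
        proof -
          have "F m x * cutoff n 0 x - F m y * cutoff n 0 y =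
              (F m x - F m y) * cutoff n 0 x + F m y * (cutoff n 0 x - cutoff n 0 y)"
            by (simp add: algebra_simps)
          then have "\<bar>F m x * cutoff n 0 x - F m y * cutoff n 0 y\<bar> \<le>
              \<bar>F m x - F m y\<bar> * cutoff n 0 x + \<bar>F m y\<bar> * \<bar>cutoff n 0 x - cutoff n 0 y\<bar>"
            using abs_triangle_ineq[of "(F m x - F m y) * cutoff n 0 x" "F m y * (cutoff n 0 x - cutoff n 0 y)"]
              cutoff_0_range[OF n, of x] by (simp add: abs_mult)
          also have "\<bar>F m x - F m y\<bar> * cutoff n 0 x \<le> \<bar>x - y\<bar> powr \<alpha> * 1"
            using F(3)[of x y] cutoff_0_range[OF n, of x] by (intro mult_mono) auto
          also have "\<bar>F m y\<bar> * \<bar>cutoff n 0 x - cutoff n 0 y\<bar> \<le>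
              (A m * (1 + \<bar>y\<bar>) powr \<alpha>) * \<bar>cutoff n 0 x - cutoff n 0 y\<bar>"
            using A(2)[of m y] by (intro mult_right_mono) auto
          also have "\<dots> = A m * ((1 + \<bar>y\<bar>) powr \<alpha> * \<bar>cutoff n 0 x - cutoff n 0 y\<bar>)" by simp
          also have "\<dots> \<le> A m * (B 1 / real n / \<alpha> * \<bar>x - y\<bar> powr \<alpha>)"
            using A(1)[of m] B(1)[of 1] B(2)[of 1 n] n yx
            by (intro mult_left_mono cutoff_increment[OF \<alpha>]) auto
          finally show ?thesis by (simp add: algebra_simps)
        qed
        show ?thesis
          using *[of x y] *[of y x] by (cases "\<bar>y\<bar> \<le> \<bar>x\<bar>") (auto simp: abs_minus_commute)
      qed
      have "G m x - G m y = (\<Sum>k\<le>m. real (m choose k) *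
          (F k x * cutoff n (m - k) x - F k y * cutoff n (m - k) y))"
        unfolding G_def by (simp add: sum_subtractf right_diff_distrib)
      also have "\<dots> = (F m x * cutoff n 0 x - F m y * cutoff n 0 y) + (\<Sum>k<m. real (m choose k) *
          (F k x * cutoff n (m - k) x - F k y * cutoff n (m - k) y))"
        by (simp add: lessThan_Suc_atMost[symmetric])
      finally have "\<bar>G m x - G m y\<bar> \<le> \<bar>F m x * cutoff n 0 x - F m y * cutoff n 0 y\<bar> + (\<Sum>k<m. real (m choose k) *
          \<bar>F k x * cutoff n (m - k) x - F k y * cutoff n (m - k) y\<bar>)"
      proof -
        assume eq: "G m x - G m y = (F m x * cutoff n 0 x - F m y * cutoff n 0 y) + (\<Sum>k<m. real (m choose k) *
          (F k x * cutoff n (m - k) x - F k y * cutoff n (m - k) y))" (is "_ = ?a + ?b")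
        have "\<bar>?b\<bar> \<le> (\<Sum>k<m. \<bar>real (m choose k) * (F k x * cutoff n (m - k) x - F k y * cutoff n (m - k) y)\<bar>)"
          by (rule sum_abs)
        also have "\<dots> = (\<Sum>k<m. real (m choose k) * \<bar>F k x * cutoff n (m - k) x - F k y * cutoff n (m - k) y\<bar>)"
          by (simp only: abs_mult abs_of_nat)
        finally show ?thesis
          using abs_triangle_ineq[of ?a ?b] unfolding eq by linarith
      qed
      also have "\<dots> \<le> (1 + A m * B 1 / \<alpha> / real n) * \<bar>x - y\<bar> powr \<alpha> + (\<Sum>k<m. real (m choose k) *
          (2 * (D k / real n) / \<alpha> * \<bar>x - y\<bar> powr \<alpha>))"
        by (intro add_mono top sum_mono mult_left_mono low) auto
      also have "(\<Sum>k<m. real (m choose k) * (2 * (D k / real n) / \<alpha> * \<bar>x - y\<bar> powr \<alpha>)) =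
          (\<Sum>k<m. real (m choose k) * (2 * D k / \<alpha>)) / real n * \<bar>x - y\<bar> powr \<alpha>"
        by (simp add: sum_divide_distrib sum_distrib_right)
           (intro sum.cong, auto simp: field_simps)
      finally show ?thesis
        by (simp add: C_def add_divide_distrib distrib_right)
    qed
    ultimately show ?thesis unfolding holder_deriv_def by blast
  qed
  moreover have "\<exists>B. \<forall>x. \<bar>g n x\<bar> \<le> B" if n: "n \<ge> 1" for n
    unfolding g_def using A(1)[of 0] A(2)[of 0] F(1) by (intro cutoff_times_power_bounded[OF _ _ n]) auto
  moreover have "\<bar>g n x\<bar> \<le> \<bar>f x\<bar>" if "n \<ge> 1" for n x
    using cutoff_0_range[OF that, of x] by (auto simp: g_def abs_mult intro: mult_left_le)
  moreover have "(\<lambda>n. g n x) \<longlonglongrightarrow> f x" for x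
    using tendsto_mult_left[OF cutoff_0_tendsto, of "f x" x] by (simp add: g_def)
  ultimately show ?thesis using C0 by (intro that[of C g]) auto
qed

section \<open>Duhamel's formula for laws\<close>

lemma integrable_pair_dominated:
  fixes F :: "'a \<Rightarrow> 'b \<Rightarrow> 'c::{banach, second_countable_topology}"
  assumes "sigma_finite_measure M1" "finite_measure M2"
    and F: "case_prod F \<in> borel_measurable (M1 \<Otimes>\<^sub>M M2)"
    and h: "integrable M1 h" and le: "\<And>x y. x \<in> space M1 \<Longrightarrow> y \<in> space M2 \<Longrightarrow> norm (F x y) \<le> h x"
  shows "integrable (M1 \<Otimes>\<^sub>M M2) (case_prod F)"
proof -
  interpret M1: sigma_finite_measure M1 by fact
  interpret M2: finite_measure M2 by fact
  interpret pair_sigma_finite M1 M2 ..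
  note F[measurable]
  have i2: "integrable M2 (\<lambda>y. F x y)" if x: "x \<in> space M1" for x
  proof (rule M2.integrable_const_bound[of _ "h x"])
    show "AE y in M2. norm (F x y) \<le> h x" using le[OF x] by auto
    show "(\<lambda>y. F x y) \<in> borel_measurable M2"
      using measurable_compose[OF measurable_Pair1'[OF x] F] by simp
  qed
  show ?thesis
  proof (rule Fubini_integrable[OF F])
    have m: "(\<lambda>x. \<integral>y. norm (case_prod F (x, y)) \<partial>M2) \<in> borel_measurable M1"
      by measurable
    show "integrable M1 (\<lambda>x. \<integral>y. norm (case_prod F (x, y)) \<partial>M2)"
    proof (rule Bochner_Integration.integrable_bound[OF integrable_mult_left[OF h, of "measure M2 (space M2)"] m])
      show "AE x in M1. norm (\<integral>y. norm (case_prod F (x, y)) \<partial>M2) \<le> norm (h x * measure M2 (space M2))"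
      proof (rule AE_I2)
        fix x assume x: "x \<in> space M1"
        have "(\<integral>y. norm (F x y) \<partial>M2) \<le> (\<integral>y. h x \<partial>M2)"
          using i2[OF x] le[OF x] by (intro integral_mono) auto
        moreover have "0 \<le> (\<integral>y. norm (F x y) \<partial>M2)" by (intro integral_nonneg_AE) auto
        ultimately show "norm (\<integral>y. norm (case_prod F (x, y)) \<partial>M2) \<le> norm (h x * measure M2 (space M2))"
          by (simp add: mult.commute)
      qed
    qed
    show "AE x in M1. integrable M2 (\<lambda>y. case_prod F (x, y))" using i2 by auto
  qed
qed

lemma Fubini_dominated:
  fixes F :: "'a \<Rightarrow> 'b \<Rightarrow> 'c::{banach, second_countable_topology}"
  assumes "sigma_finite_measure M1" "finite_measure M2"
    and F: "case_prod F \<in> borel_measurable (M1 \<Otimes>\<^sub>M M2)"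
    and h: "integrable M1 h" and le: "\<And>x y. x \<in> space M1 \<Longrightarrow> y \<in> space M2 \<Longrightarrow> norm (F x y) \<le> h x"
  shows "(\<integral>x. (\<integral>y. F x y \<partial>M2) \<partial>M1) = (\<integral>y. (\<integral>x. F x y \<partial>M1) \<partial>M2)"
proof -
  interpret M1: sigma_finite_measure M1 by fact
  interpret M2: finite_measure M2 by fact
  interpret pair_sigma_finite M1 M2 ..
  show ?thesis
    by (rule Fubini_integral[OF integrable_pair_dominated[OF assms], symmetric])
qed

lemma (in prob_space) norm_integral_le:
  fixes f :: "'a \<Rightarrow> 'b::{banach, second_countable_topology}"
  assumes "\<And>x. x \<in> space M \<Longrightarrow> norm (f x) \<le> B"
  shows "norm (integral\<^sup>L M f) \<le> B"
proof (cases "integrable M f")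
  case True
  have "norm (integral\<^sup>L M f) \<le> (\<integral>x. norm (f x) \<partial>M)" by (rule integral_norm_bound)
  also have "\<dots> \<le> B"
    using True assms by (intro integral_le_const) auto
  finally show ?thesis .
next
  \<comment> \<open>Without integrability the integral has the default value 0, and B >= 0 because a
    probability space has a point.\<close>
  case False
  obtain x where "x \<in> space M" using not_empty by auto
  then have "0 \<le> B" using assms[of x] norm_ge_zero order_trans by blast
  then show ?thesis using False by (simp add: not_integrable_integral_eq)
qed

section \<open>Gaussian smoothing as a superposition of characters\<close>

lemma real_prob_iff_real_distribution: "real_prob P \<longleftrightarrow> real_distribution P"
  by (auto simp: real_prob_def real_distribution_def real_distribution_axioms_def)

text \<open>Damping f by a Gaussian of width s makes it integrable; averaging over a normal variable
  of variance 1 / s^2 gives a Fourier representation. Both effects vanish as s tends to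
  infinity.\<close>

definition gauss_smooth :: "(real \<Rightarrow> real) \<Rightarrow> real \<Rightarrow> real \<Rightarrow> real" where
  "gauss_smooth f s x = (\<integral>y. f (x + y / s) * exp (- ((x + y / s) / s)\<^sup>2 / 2) \<partial>std_normal_distribution)"

text \<open>The Fourier integral of the damped function at frequency \<open>s * z\<close>; the
  prefactor is that of the normal density after rescaling by s.\<close>

definition gauss_kernel :: "(real \<Rightarrow> real) \<Rightarrow> real \<Rightarrow> real \<Rightarrow> complex" where
  "gauss_kernel f s z = (\<integral>y. complex_of_real (s / sqrt (2 * pi) * (f y * exp (- (y / s)\<^sup>2 / 2))) * iexp (s * z * y) \<partial>lborel)"

context
  fixes f :: "real \<Rightarrow> real" and M :: real
  assumes cont: "continuous_on UNIV f" and bound: "\<And>x. \<bar>f x\<bar> \<le> M"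
begin

lemma cont_measurable [measurable]: "f \<in> borel_measurable borel"
  using cont by (rule borel_measurable_continuous_onI)

lemma bound_nonneg: "0 \<le> M"
  using bound[of 0] by linarith

lemma gauss_weight_bound: "\<bar>f x * exp (- (x / s)\<^sup>2 / 2)\<bar> \<le> M"
proof -
  have "\<bar>f x\<bar> * exp (- (x / s)\<^sup>2 / 2) \<le> M * 1"
    by (intro mult_mono bound bound_nonneg) auto
  then show ?thesis by (simp add: abs_mult)
qed

lemma gauss_smooth_bound: "\<bar>gauss_smooth f s x\<bar> \<le> M"
proof -
  interpret N: real_distribution std_normal_distribution by (rule real_dist_normal_dist)
  have "norm (gauss_smooth f s x) \<le> (\<integral>y. norm (f (x + y / s) * exp (- ((x + y / s) / s)\<^sup>2 / 2)) \<partial>std_normal_distribution)"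
    unfolding gauss_smooth_def by (rule integral_norm_bound)
  also have "\<dots> \<le> (\<integral>y. M \<partial>std_normal_distribution)"
  proof (rule integral_mono)
    have b: "norm (f (x + y / s) * exp (- ((x + y / s) / s)\<^sup>2 / 2)) \<le> M" for y
      using gauss_weight_bound[of "x + y / s" s] by (simp only: real_norm_def)
    show "integrable std_normal_distribution (\<lambda>y. norm (f (x + y / s) * exp (- ((x + y / s) / s)\<^sup>2 / 2)))"
      by (intro integrable_norm N.integrable_const_bound[of _ M] AE_I2 b) simp
    show "norm (f (x + y / s) * exp (- ((x + y / s) / s)\<^sup>2 / 2)) \<le> M" for y by (rule b)
  qed simp
  finally show ?thesis using N.prob_space by simp
qed

lemma gauss_smooth_tendsto: "(\<lambda>n. gauss_smooth f (real (Suc n)) x) \<longlonglongrightarrow> f x"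
proof -
  interpret N: real_distribution std_normal_distribution by (rule real_dist_normal_dist)
  have "(\<lambda>n. gauss_smooth f (real (Suc n)) x) \<longlonglongrightarrow> (\<integral>y. f x * exp (- 0\<^sup>2 / 2) \<partial>std_normal_distribution)"
    unfolding gauss_smooth_def
  proof (rule integral_dominated_convergence[where w = "\<lambda>_. M"])
    show "AE y in std_normal_distribution. (\<lambda>n. f (x + y / real (Suc n)) *
        exp (- ((x + y / real (Suc n)) / real (Suc n))\<^sup>2 / 2)) \<longlonglongrightarrow> f x * exp (- 0\<^sup>2 / 2)"
    proof (rule AE_I2)
      fix y :: real
      have d: "(\<lambda>n. a n / real (Suc n)) \<longlonglongrightarrow> 0" if "a \<longlonglongrightarrow> l" for a and l :: real
        using tendsto_mult[OF that LIMSEQ_inverse_real_of_nat] by (simp add: divide_inverse)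
      have 1: "(\<lambda>n. x + y / real (Suc n)) \<longlonglongrightarrow> x"
        using tendsto_add[OF tendsto_const[of x] d[OF tendsto_const[of y]]] by simp
      have 2: "(\<lambda>n. (x + y / real (Suc n)) / real (Suc n)) \<longlonglongrightarrow> 0"
        by (rule d[OF 1])
      have "(\<lambda>n. f (x + y / real (Suc n))) \<longlonglongrightarrow> f x"
        by (rule continuous_on_tendsto_compose[OF cont 1]) auto
      then show "(\<lambda>n. f (x + y / real (Suc n)) *
        exp (- ((x + y / real (Suc n)) / real (Suc n))\<^sup>2 / 2)) \<longlonglongrightarrow> f x * exp (- 0\<^sup>2 / 2)"
        by (intro tendsto_mult tendsto_exp tendsto_divide tendsto_minus tendsto_power 2 tendsto_const) auto
    qed
    show "AE y in std_normal_distribution. norm (f (x + y / real (Suc n)) *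
        exp (- ((x + y / real (Suc n)) / real (Suc n))\<^sup>2 / 2)) \<le> M" for n
      using gauss_weight_bound[of "x + _ / real (Suc n)" "real (Suc n)"] by auto
  qed auto
  then show ?thesis using N.prob_space by simp
qed

lemma gauss_kernel_measurable [measurable]: "gauss_kernel f s \<in> borel_measurable borel"
  unfolding gauss_kernel_def by measurable

lemma gauss_weight_integrable:
  assumes "s > 0"
  shows "integrable lborel (\<lambda>y. f y * exp (- (y / s)\<^sup>2 / 2))"
proof (rule Bochner_Integration.integrable_bound[where f = "\<lambda>y. M * (sqrt (2 * pi * s\<^sup>2) * normal_density 0 s y)"])
  show "AE x in lborel. norm (f x * exp (- (x / s)\<^sup>2 / 2)) \<le> norm (M * (sqrt (2 * pi * s\<^sup>2) * normal_density 0 s x))"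
  proof (rule AE_I2)
    fix x
    have "sqrt (2 * pi * s\<^sup>2) * normal_density 0 s x = exp (- (x / s)\<^sup>2 / 2)"
      using assms by (simp add: normal_density_def power_divide)
    then show "norm (f x * exp (- (x / s)\<^sup>2 / 2)) \<le> norm (M * (sqrt (2 * pi * s\<^sup>2) * normal_density 0 s x))"
      using bound[of x] bound_nonneg by (simp add: abs_mult mult_right_mono)
  qed
qed (use assms in auto)

lemma gauss_kernel_bound:
  assumes "s > 0"
  shows "norm (gauss_kernel f s z) \<le> (\<integral>y. \<bar>s / sqrt (2 * pi) * (f y * exp (- (y / s)\<^sup>2 / 2))\<bar> \<partial>lborel)"
proof -
  have "norm (gauss_kernel f s z) \<le>
      (\<integral>y. norm (complex_of_real (s / sqrt (2 * pi) * (f y * exp (- (y / s)\<^sup>2 / 2))) * iexp (s * z * y)) \<partial>lborel)"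
    unfolding gauss_kernel_def by (rule integral_norm_bound)
  also have "\<dots> = (\<integral>y. \<bar>s / sqrt (2 * pi) * (f y * exp (- (y / s)\<^sup>2 / 2))\<bar> \<partial>lborel)"
    by (simp only: norm_mult norm_of_real norm_exp_i_times mult_1_right)
  finally show ?thesis .
qed

text \<open>The Gaussian is, up to its normalisation, its own characteristic function: exp (- (s (u
  - x))^2 / 2) is written as a normal expectation of characters and the integrals are exchanged.
  This takes the place of Fourier inversion.\<close>

lemma gauss_smooth_fourier:
  assumes s: "s > 0"
  shows "complex_of_real (gauss_smooth f s x) = (\<integral>z. gauss_kernel f s z * iexp (- (s * z) * x) \<partial>std_normal_distribution)"
proof -
  interpret N: real_distribution std_normal_distribution by (rule real_dist_normal_dist)
  let ?g = "\<lambda>y. f y * exp (- (y / s)\<^sup>2 / 2)"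
  let ?h = "\<lambda>y. s / sqrt (2 * pi) * ?g y"
  have "gauss_smooth f s x = (\<integral>y. std_normal_density y * ?g (x + y / s) \<partial>lborel)"
    unfolding gauss_smooth_def by (subst integral_density) auto
  also have "\<dots> = s * (\<integral>u. std_normal_density (- s * x + s * u) * ?g (x + (- s * x + s * u) / s) \<partial>lborel)"
    using s by (subst lborel_integral_real_affine[of s _ "- s * x"]) auto
  also have "\<dots> = s * (\<integral>u. std_normal_density (s * (u - x)) * ?g u \<partial>lborel)"
    using s by (simp add: field_simps)
  also have "\<dots> = (\<integral>u. s * (std_normal_density (s * (u - x)) * ?g u) \<partial>lborel)"
    by simp
  finally have real: "gauss_smooth f s x = (\<integral>u. s * (std_normal_density (s * (u - x)) * ?g u) \<partial>lborel)" .
  have "complex_of_real (gauss_smooth f s x) = (\<integral>u. complex_of_real (s * (std_normal_density (s * (u - x)) * ?g u)) \<partial>lborel)"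
    unfolding real by (rule integral_complex_of_real[symmetric])
  also have "\<dots> = (\<integral>u. (\<integral>z. complex_of_real (?h u) * iexp (s * z * (u - x)) \<partial>std_normal_distribution) \<partial>lborel)"
  proof (rule Bochner_Integration.integral_cong[OF refl])
    fix u
    have "complex_of_real (exp (- (s * (u - x))\<^sup>2 / 2)) = char std_normal_distribution (s * (u - x))"
      by (simp add: char_std_normal_distribution)
    also have "\<dots> = (\<integral>z. iexp (s * z * (u - x)) \<partial>std_normal_distribution)"
      unfolding char_def by (intro Bochner_Integration.integral_cong refl) (simp add: mult.commute mult.left_commute)
    finally have "complex_of_real (?h u) * (\<integral>z. iexp (s * z * (u - x)) \<partial>std_normal_distribution) =
        complex_of_real (?h u * exp (- (s * (u - x))\<^sup>2 / 2))"
      by simp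
    also have "?h u * exp (- (s * (u - x))\<^sup>2 / 2) = s * (std_normal_density (s * (u - x)) * ?g u)"
      by (simp add: std_normal_density_def)
    finally show "complex_of_real (s * (std_normal_density (s * (u - x)) * ?g u)) =
        (\<integral>z. complex_of_real (?h u) * iexp (s * z * (u - x)) \<partial>std_normal_distribution)"
      by simp
  qed
  also have "\<dots> = (\<integral>z. (\<integral>u. complex_of_real (?h u) * iexp (s * z * (u - x)) \<partial>lborel) \<partial>std_normal_distribution)"
  proof (rule Fubini_dominated[where h = "\<lambda>u. \<bar>?h u\<bar>"])
    show "integrable lborel (\<lambda>u. \<bar>?h u\<bar>)"
      by (intro integrable_abs integrable_mult_right gauss_weight_integrable s)
    show "norm (complex_of_real (?h u) * iexp (s * z * (u - x))) \<le> \<bar>?h u\<bar>" for u z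
      by (simp only: norm_mult norm_of_real norm_exp_i_times mult_1_right order_refl)
  qed (auto simp: norm_mult lborel.sigma_finite_measure_axioms N.finite_measure_axioms simp del: of_real_mult)
  also have "\<dots> = (\<integral>z. gauss_kernel f s z * iexp (- (s * z) * x) \<partial>std_normal_distribution)"
  proof (rule Bochner_Integration.integral_cong[OF refl])
    fix z
    have "(\<integral>u. complex_of_real (?h u) * iexp (s * z * (u - x)) \<partial>lborel) =
        (\<integral>u. (complex_of_real (?h u) * iexp (s * z * u)) * iexp (- (s * z) * x) \<partial>lborel)"
      by (intro Bochner_Integration.integral_cong refl)
         (simp add: mult.assoc exp_add[symmetric] algebra_simps del: of_real_mult)
    then show "(\<integral>u. complex_of_real (?h u) * iexp (s * z * (u - x)) \<partial>lborel) =
        gauss_kernel f s z * iexp (- (s * z) * x)"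
      unfolding gauss_kernel_def by simp
  qed
  finally show ?thesis .
qed

lemma gauss_smooth_measurable [measurable]: "gauss_smooth f s \<in> borel_measurable borel"
proof -
  interpret N: real_distribution std_normal_distribution by (rule real_dist_normal_dist)
  show ?thesis unfolding gauss_smooth_def by measurable
qed

text \<open>The kernel does not depend on P, so expectations of smoothed tests are linear in
  \<open>char P\<close>, and a linear identity between characteristic functions carries over to
  them.\<close>

lemma integral_gauss_smooth:
  assumes s: "s > 0" and P: "real_distribution P"
  shows "complex_of_real (\<integral>x. gauss_smooth f s x \<partial>P) =
    (\<integral>z. gauss_kernel f s z * char P (- (s * z)) \<partial>std_normal_distribution)"
proof -
  interpret N: real_distribution std_normal_distribution by (rule real_dist_normal_dist)
  interpret P: real_distribution P by fact
  have "complex_of_real (\<integral>x. gauss_smooth f s x \<partial>P) = (\<integral>x. complex_of_real (gauss_smooth f s x) \<partial>P)"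
    by simp
  also have "\<dots> = (\<integral>x. (\<integral>z. gauss_kernel f s z * iexp (- (s * z) * x) \<partial>std_normal_distribution) \<partial>P)"
    by (simp only: gauss_smooth_fourier[OF s])
  also have "\<dots> = (\<integral>z. (\<integral>x. gauss_kernel f s z * iexp (- (s * z) * x) \<partial>P) \<partial>std_normal_distribution)"
  proof (rule Fubini_dominated)
    show "norm (gauss_kernel f s z * iexp (- (s * z) * x)) \<le>
        (\<integral>y. \<bar>s / sqrt (2 * pi) * (f y * exp (- (y / s)\<^sup>2 / 2))\<bar> \<partial>lborel)" for x z
      using gauss_kernel_bound[OF s, of z] by (simp only: norm_mult norm_exp_i_times mult_1_right)
  qed (auto simp: P.sigma_finite_measure_axioms N.finite_measure_axioms simp del: of_real_mult)
  also have "\<dots> = (\<integral>z. gauss_kernel f s z * char P (- (s * z)) \<partial>std_normal_distribution)"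
    by (simp add: char_def)
  finally show ?thesis .
qed

end

declare cont_measurable [measurable del] gauss_smooth_measurable [measurable del]
  gauss_kernel_measurable [measurable del]

text \<open>The Lipschitz bound in time is uniform in the frequency, so separate continuity becomes
  joint continuity; this is what Fubini over time and frequency requires. \<open>max 0 s\<close>
  freezes the family at negative times, where S is unconstrained.\<close>

lemma char_jointly_measurable:
  assumes S: "\<And>t. t \<ge> 0 \<Longrightarrow> real_distribution (S t)"
    and lip: "\<And>s t \<xi>. 0 \<le> s \<Longrightarrow> 0 \<le> t \<Longrightarrow> norm (char (S s) \<xi> - char (S t) \<xi>) \<le> C * \<bar>s - t\<bar>"
  shows "(\<lambda>(s, \<xi>). char (S (max 0 s)) \<xi>) \<in> borel_measurable (borel \<Otimes>\<^sub>M borel)"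
proof -
  have "continuous_on UNIV (\<lambda>p. char (S (max 0 (fst p))) (snd p))"
  proof (rule continuous_at_imp_continuous_on, safe)
    fix s0 \<xi>0 :: real
    let ?s0 = "max 0 s0"
    interpret S0: real_distribution "S ?s0" by (rule S) simp
    have 1: "((\<lambda>p. char (S (max 0 (fst p))) (snd p) - char (S ?s0) (snd p)) \<longlongrightarrow> 0) (at (s0, \<xi>0))"
    proof (rule Lim_null_comparison[OF always_eventually])
      show "\<forall>p. norm (char (S (max 0 (fst p))) (snd p) - char (S ?s0) (snd p)) \<le> C * \<bar>max 0 (fst p) - ?s0\<bar>"
        using lip by simp
      have "((\<lambda>p. C * \<bar>max 0 (fst p) - ?s0\<bar>) \<longlongrightarrow> C * \<bar>max 0 (fst (s0, \<xi>0)) - ?s0\<bar>) (at (s0, \<xi>0))"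
        by (intro tendsto_intros)
      then show "((\<lambda>p. C * \<bar>max 0 (fst p) - ?s0\<bar>) \<longlongrightarrow> 0) (at (s0, \<xi>0))" by simp
    qed
    have "((\<lambda>p. snd p) \<longlongrightarrow> \<xi>0) (at (s0, \<xi>0))"
      by (rule tendsto_eq_intros | simp)+
    then have 2: "((\<lambda>p. char (S ?s0) (snd p)) \<longlongrightarrow> char (S ?s0) \<xi>0) (at (s0, \<xi>0))"
      by (rule isCont_tendsto_compose[OF S0.isCont_char])
    show "isCont (\<lambda>p. char (S (max 0 (fst p))) (snd p)) (s0, \<xi>0)"
      using tendsto_add[OF 1 2] by (simp add: isCont_def)
  qed
  then show ?thesis
    by (simp add: borel_prod borel_measurable_continuous_onI split_beta')
qed

text \<open>Gaussian smoothing turns a test function into a superposition of characters, for which the identity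
  is the integrated differential equation.\<close>
lemma duhamel:
  assumes P: "\<And>t. t \<ge> 0 \<Longrightarrow> real_distribution (P t)" and S: "\<And>t. t \<ge> 0 \<Longrightarrow> real_distribution (S t)"
    and ode: "\<And>t \<xi>. t \<ge> 0 \<Longrightarrow>
        ((\<lambda>s. char (P s) \<xi>) has_vector_derivative (char (S t) \<xi> - char (P t) \<xi>)) (at t within {0..})"
    and lip: "\<And>s t \<xi>. 0 \<le> s \<Longrightarrow> 0 \<le> t \<Longrightarrow> norm (char (S s) \<xi> - char (S t) \<xi>) \<le> C * \<bar>s - t\<bar>"
    and cont: "continuous_on UNIV f" and bound: "\<And>x. \<bar>f x\<bar> \<le> M" and t: "0 \<le> t"
  shows "has_bochner_integral lborel (\<lambda>s. indicator {0..t} s * (exp s * (\<integral>x. f x \<partial>S s)))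
           (exp t * (\<integral>x. f x \<partial>P t) - (\<integral>x. f x \<partial>P 0))"
proof -
  interpret N: real_distribution std_normal_distribution by (rule real_dist_normal_dist)
  have fm [measurable]: "f \<in> borel_measurable borel" by (rule cont_measurable[OF cont bound])
  have M0: "0 \<le> M" using bound[of 0] by linarith
  have expect_bound: "\<bar>\<integral>x. g x \<partial>Q\<bar> \<le> M"
    if "real_distribution Q" "\<And>x. \<bar>g x\<bar> \<le> M" for Q g
  proof -
    interpret Q: real_distribution Q by fact
    show ?thesis using Q.norm_integral_le[of g M] that(2) by simp
  qed
  let ?g = "\<lambda>n. gauss_smooth f (real (Suc n))"
  have lim: "(\<lambda>n. \<integral>x. ?g n x \<partial>Q) \<longlonglongrightarrow> (\<integral>x. f x \<partial>Q)" if "real_distribution Q" for Q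
  proof -
    interpret Q: real_distribution Q by fact
    show ?thesis
    proof (rule integral_dominated_convergence[where w = "\<lambda>_. M"])
      show "AE x in Q. (\<lambda>n. ?g n x) \<longlonglongrightarrow> f x"
        by (intro AE_I2 gauss_smooth_tendsto[OF cont bound])
      show "AE x in Q. norm (?g n x) \<le> M" for n
        using gauss_smooth_bound[OF cont bound] by simp
      show "?g n \<in> borel_measurable Q" for n
        using gauss_smooth_measurable[OF cont bound] by simp
    qed auto
  qed
  note chm = char_jointly_measurable[OF S lip]
  have main: "has_bochner_integral lborel (\<lambda>s. indicator {0..t} s * (exp s * (\<integral>x. gauss_smooth f \<sigma> x \<partial>S s)))
      (exp t * (\<integral>x. gauss_smooth f \<sigma> x \<partial>P t) - (\<integral>x. gauss_smooth f \<sigma> x \<partial>P 0))" if \<sigma>: "\<sigma> > 0" for \<sigma>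
  proof -
    let ?K = "gauss_kernel f \<sigma>"
    let ?G = "\<lambda>s z. complex_of_real (indicator {0..t} s * exp s) * (?K z * char (S (max 0 s)) (- (\<sigma> * z)))"
    let ?B = "\<integral>y. \<bar>\<sigma> / sqrt (2 * pi) * (f y * exp (- (y / \<sigma>)\<^sup>2 / 2))\<bar> \<partial>lborel"
    have B0: "0 \<le> ?B" by (intro integral_nonneg_AE) auto
    have [measurable]: "?K \<in> borel_measurable borel" by (rule gauss_kernel_measurable[OF cont bound])
    have [measurable]: "(\<lambda>p. char (S (max 0 (fst p))) (- (\<sigma> * snd p))) \<in> borel_measurable (lborel \<Otimes>\<^sub>M std_normal_distribution)"
    proof -
      have "(\<lambda>p. (fst p, - (\<sigma> * snd p))) \<in> lborel \<Otimes>\<^sub>M std_normal_distribution \<rightarrow>\<^sub>M borel \<Otimes>\<^sub>M borel"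
        by measurable
      from measurable_compose[OF this chm] show ?thesis by simp
    qed
    have Gm: "case_prod ?G \<in> borel_measurable (lborel \<Otimes>\<^sub>M std_normal_distribution)"
      unfolding split_beta' by measurable
    have expi: "integrable lborel (\<lambda>s. indicator {0..t} s * exp s :: real)"
      using borel_integrable_compact[OF compact_Icc continuous_on_exp[OF continuous_on_id], of 0 t] by simp
    have Gb: "norm (?G s z) \<le> ?B * (indicator {0..t} s * exp s)" for s z
    proof -
      interpret Q: real_distribution "S (max 0 s)" by (rule S) simp
      have "norm (?K z * char (S (max 0 s)) (- (\<sigma> * z))) \<le> ?B * 1"
        unfolding norm_mult
        by (intro mult_mono gauss_kernel_bound[OF cont bound \<sigma>] Q.cmod_char_le_1 B0) auto
      then have "(indicator {0..t} s * exp s) * norm (?K z * char (S (max 0 s)) (- (\<sigma> * z))) \<le>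
          (indicator {0..t} s * exp s) * ?B"
        by (intro mult_left_mono) auto
      then show ?thesis
        by (simp only: norm_mult norm_of_real abs_mult abs_indicator abs_exp_cancel) (simp only: mult.commute)
    qed
    have int: "integrable (lborel \<Otimes>\<^sub>M std_normal_distribution) (case_prod ?G)"
      by (rule integrable_pair_dominated[OF lborel.sigma_finite_measure_axioms N.finite_measure_axioms Gm
            integrable_mult_right[OF expi] Gb])
    interpret pr: pair_sigma_finite lborel std_normal_distribution ..
    have inner: "(\<integral>z. ?G s z \<partial>std_normal_distribution) =
        complex_of_real (indicator {0..t} s * (exp s * (\<integral>x. gauss_smooth f \<sigma> x \<partial>S s)))" for s
    proof (cases "s \<in> {0..t}")
      case True
      then have "(\<integral>z. ?G s z \<partial>std_normal_distribution) =
          complex_of_real (exp s) * (\<integral>z. ?K z * char (S s) (- (\<sigma> * z)) \<partial>std_normal_distribution)"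
        by (simp add: max_def)
      also have "\<dots> = complex_of_real (exp s) * complex_of_real (\<integral>x. gauss_smooth f \<sigma> x \<partial>S s)"
        using True by (subst integral_gauss_smooth[OF cont bound \<sigma> S]) auto
      finally show ?thesis using True by simp
    qed simp
    \<comment> \<open>With the integrating factor exp s, the function
      \<open>exp s * char (P s)\<close> has derivative \<open>exp s * char (S s)\<close>, so the
      time integral is evaluated by the fundamental theorem.\<close>
    have outer: "(\<integral>s. ?G s z \<partial>lborel) = ?K z * (exp t * char (P t) (- (\<sigma> * z)) - char (P 0) (- (\<sigma> * z)))" for z
    proof -
      let ?\<xi> = "- (\<sigma> * z)"
      have "(\<integral>s. indicator {0..t} s *\<^sub>R (exp s *\<^sub>R char (S s) ?\<xi>) \<partial>lborel) =
          exp t *\<^sub>R char (P t) ?\<xi> - exp 0 *\<^sub>R char (P 0) ?\<xi>"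
      proof (rule integral_FTC_atLeastAtMost[OF t])
        fix s assume s: "0 \<le> s" "s \<le> t"
        have "((\<lambda>s. exp s *\<^sub>R char (P s) ?\<xi>) has_vector_derivative
            (exp s *\<^sub>R (char (S s) ?\<xi> - char (P s) ?\<xi>) + exp s *\<^sub>R char (P s) ?\<xi>)) (at s within {0..})"
          using s by (intro has_vector_derivative_scaleR ode) (auto intro!: derivative_eq_intros)
        then have "((\<lambda>s. exp s *\<^sub>R char (P s) ?\<xi>) has_vector_derivative exp s *\<^sub>R char (S s) ?\<xi>) (at s within {0..})"
          by (simp add: algebra_simps)
        then show "((\<lambda>s. exp s *\<^sub>R char (P s) ?\<xi>) has_vector_derivative exp s *\<^sub>R char (S s) ?\<xi>) (at s within {0..t})"
          by (rule has_vector_derivative_within_subset) auto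
      next
        have "continuous_on {0..t} (\<lambda>s. char (S s) ?\<xi>)"
        proof (rule continuous_on_subset)
          show "continuous_on {0..} (\<lambda>s. char (S s) ?\<xi>)"
            unfolding continuous_on_def
          proof (intro ballI)
            fix s :: real assume s: "s \<in> {0..}"
            have "((\<lambda>u. char (S u) ?\<xi> - char (S s) ?\<xi>) \<longlongrightarrow> 0) (at s within {0..})"
            proof (rule Lim_null_comparison)
              show "\<forall>\<^sub>F u in at s within {0..}. norm (char (S u) ?\<xi> - char (S s) ?\<xi>) \<le> C * \<bar>u - s\<bar>"
                using s lip by (auto simp: eventually_at_filter)
              have "((\<lambda>u. C * \<bar>u - s\<bar>) \<longlongrightarrow> C * \<bar>s - s\<bar>) (at s within {0..})"
                by (intro tendsto_intros)
              then show "((\<lambda>u. C * \<bar>u - s\<bar>) \<longlongrightarrow> 0) (at s within {0..})" by simp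
            qed
            then show "((\<lambda>s. char (S s) ?\<xi>) \<longlongrightarrow> char (S s) ?\<xi>) (at s within {0..})"
              by (simp add: LIM_zero_iff)
          qed
        qed auto
        then show "continuous_on {0..t} (\<lambda>s. exp s *\<^sub>R char (S s) ?\<xi>)"
          by (intro continuous_intros)
      qed
      moreover have "(\<integral>s. ?G s z \<partial>lborel) = (\<integral>s. ?K z * (indicator {0..t} s *\<^sub>R (exp s *\<^sub>R char (S s) ?\<xi>)) \<partial>lborel)"
        by (intro Bochner_Integration.integral_cong refl)
           (auto simp: scaleR_conv_of_real max_def indicator_def)
      ultimately show ?thesis by (simp add: scaleR_conv_of_real)
    qed
    have "(\<integral>s. (\<integral>z. ?G s z \<partial>std_normal_distribution) \<partial>lborel) = (\<integral>z. (\<integral>s. ?G s z \<partial>lborel) \<partial>std_normal_distribution)"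
      by (rule pr.Fubini_integral[OF int, symmetric])
    also have "\<dots> = (\<integral>z. exp t * (?K z * char (P t) (- (\<sigma> * z))) - ?K z * char (P 0) (- (\<sigma> * z)) \<partial>std_normal_distribution)"
      unfolding outer by (simp add: algebra_simps)
    also have "\<dots> = exp t * (\<integral>z. ?K z * char (P t) (- (\<sigma> * z)) \<partial>std_normal_distribution) -
        (\<integral>z. ?K z * char (P 0) (- (\<sigma> * z)) \<partial>std_normal_distribution)"
    proof -
      have i: "integrable std_normal_distribution (\<lambda>z. ?K z * char Q (- (\<sigma> * z)))" if "real_distribution Q" for Q
      proof -
        interpret Q: real_distribution Q by fact
        show ?thesis
        proof (rule N.integrable_const_bound[of _ "?B * 1"])
          show "AE z in std_normal_distribution. norm (?K z * char Q (- (\<sigma> * z))) \<le> ?B * 1"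
            unfolding norm_mult
            by (intro AE_I2 mult_mono gauss_kernel_bound[OF cont bound \<sigma>] Q.cmod_char_le_1 B0) auto
          have "(\<lambda>z. char Q (- (\<sigma> * z))) \<in> borel_measurable borel"
            using measurable_compose[OF _ Q.char_measurable, of "\<lambda>z. - (\<sigma> * z)" borel] by simp
          then show "(\<lambda>z. ?K z * char Q (- (\<sigma> * z))) \<in> borel_measurable std_normal_distribution"
            using gauss_kernel_measurable[OF cont bound, of \<sigma>] by simp
        qed
      qed
      show ?thesis
        using i[OF P[OF t]] i[OF P[OF order_refl]] by (subst Bochner_Integration.integral_diff) auto
    qed
    also have "\<dots> = complex_of_real (exp t * (\<integral>x. gauss_smooth f \<sigma> x \<partial>P t) - (\<integral>x. gauss_smooth f \<sigma> x \<partial>P 0))"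
      using integral_gauss_smooth[OF cont bound \<sigma> P[OF t]] integral_gauss_smooth[OF cont bound \<sigma> P[OF order_refl]]
      by simp
    finally have "(\<integral>s. complex_of_real (indicator {0..t} s * (exp s * (\<integral>x. gauss_smooth f \<sigma> x \<partial>S s))) \<partial>lborel) =
        complex_of_real (exp t * (\<integral>x. gauss_smooth f \<sigma> x \<partial>P t) - (\<integral>x. gauss_smooth f \<sigma> x \<partial>P 0))"
      unfolding inner .
    then have eq: "(\<integral>s. indicator {0..t} s * (exp s * (\<integral>x. gauss_smooth f \<sigma> x \<partial>S s)) \<partial>lborel) =
        exp t * (\<integral>x. gauss_smooth f \<sigma> x \<partial>P t) - (\<integral>x. gauss_smooth f \<sigma> x \<partial>P 0)"
      unfolding integral_complex_of_real of_real_eq_iff .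
    have "integrable lborel (\<lambda>s. \<integral>z. ?G s z \<partial>std_normal_distribution)"
      using pr.integrable_fst'[OF int] by simp
    then have "integrable lborel (\<lambda>s. indicator {0..t} s * (exp s * (\<integral>x. gauss_smooth f \<sigma> x \<partial>S s)))"
      unfolding inner complex_of_real_integrable_eq .
    then show ?thesis using eq by (simp add: has_bochner_integral_iff)
  qed
  let ?F = "\<lambda>s. indicator {0..t} s * (exp s * (\<integral>x. f x \<partial>S s))"
  let ?Fn = "\<lambda>n s. indicator {0..t} s * (exp s * (\<integral>x. ?g n x \<partial>S s))"
  have Fn: "integrable lborel (?Fn n)" for n
    using main[of "real (Suc n)"] by (simp add: has_bochner_integral_iff)
  have conv: "(\<lambda>n. ?Fn n s) \<longlonglongrightarrow> ?F s" for s
  proof (cases "s \<in> {0..t}")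
    case True
    then show ?thesis using lim[OF S, of s] by (auto intro!: tendsto_intros)
  qed simp
  \<comment> \<open>Measurability in s of the expectation of f is inherited from the smoothed tests,
    as a pointwise limit.\<close>
  have Fm: "?F \<in> borel_measurable lborel"
    by (rule borel_measurable_LIMSEQ_metric[OF borel_measurable_integrable[OF Fn] conv])
  have w: "integrable lborel (\<lambda>s. indicator {0..t} s * (exp s * M))"
  proof -
    have "continuous_on {0..t} (\<lambda>s. exp s * M)" by (intro continuous_intros)
    from borel_integrable_compact[OF compact_Icc this] show ?thesis by simp
  qed
  have wb: "norm (?Fn n s) \<le> indicator {0..t} s * (exp s * M)" for n s
  proof (cases "s \<in> {0..t}")
    case True
    have "\<bar>\<integral>x. ?g n x \<partial>S s\<bar> \<le> M"
      using True by (intro expect_bound S gauss_smooth_bound[OF cont bound]) auto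
    then show ?thesis using True by (simp add: abs_mult)
  qed simp
  note dct = Fm borel_measurable_integrable[OF Fn] w AE_I2[OF conv] AE_I2[OF wb]
  have Fn_eq: "integral\<^sup>L lborel (?Fn n) = exp t * (\<integral>x. ?g n x \<partial>P t) - (\<integral>x. ?g n x \<partial>P 0)" for n
    using main[of "real (Suc n)"] by (simp add: has_bochner_integral_iff)
  have "(\<lambda>n. exp t * (\<integral>x. ?g n x \<partial>P t) - (\<integral>x. ?g n x \<partial>P 0)) \<longlonglongrightarrow>
      exp t * (\<integral>x. f x \<partial>P t) - (\<integral>x. f x \<partial>P 0)"
    by (intro tendsto_intros lim P t) auto
  from LIMSEQ_unique[OF integral_dominated_convergence[OF dct, unfolded Fn_eq] this]
  show ?thesis
    using integrable_dominated_convergence[OF dct] by (simp add: has_bochner_integral_iff)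
qed

section \<open>The smoothing transform and its contraction\<close>

lemma (in prob_space) integral_diff_le_const:
  fixes g h :: "'a \<Rightarrow> real"
  assumes [measurable]: "g \<in> borel_measurable M" "h \<in> borel_measurable M"
    and b: "\<And>x. x \<in> space M \<Longrightarrow> \<bar>g x\<bar> \<le> B" "\<And>x. x \<in> space M \<Longrightarrow> \<bar>h x\<bar> \<le> B"
    and le: "\<And>x. x \<in> space M \<Longrightarrow> g x - h x \<le> C"
  shows "(\<integral>x. g x \<partial>M) - (\<integral>x. h x \<partial>M) \<le> C"
proof -
  have "integrable M g" by (rule integrable_const_bound[of _ B]) (use b(1) in auto)
  moreover have "integrable M h" by (rule integrable_const_bound[of _ B]) (use b(2) in auto)
  ultimately have "(\<integral>x. g x \<partial>M) - (\<integral>x. h x \<partial>M) = (\<integral>x. g x - h x \<partial>M)" "integrable M (\<lambda>x. g x - h x)"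
    by auto
  then show ?thesis using integral_le_const[of "\<lambda>x. g x - h x" C] le by auto
qed

lemma component_measurable:
  assumes "real_distribution Q" "j \<in> J"
  shows "(\<lambda>x. x j) \<in> borel_measurable (PiM J (\<lambda>_. Q))"
proof -
  interpret Q: real_distribution Q by fact
  show ?thesis
    using measurable_component_singleton[OF assms(2), of "\<lambda>_. Q"]
    by (simp add: measurable_cong_sets[OF refl Q.events_eq_borel])
qed

text \<open>Lindeberg replacement: with the other coordinates frozen, f of the weighted sum is an
  affine substitution of f with slope \<open>a i\<close>. The bound M survives every such
  substitution. The slack w per summand carries the remainder of the iteration in
  \<open>smoothing_flow_contraction\<close>.\<close>

lemma product_weighted_sum_le:
  fixes P R :: "real measure" and a :: "'i \<Rightarrow> real"
  assumes P: "real_distribution P" and R: "real_distribution R" and \<alpha>: "0 < \<alpha>"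
    and hyp: "\<And>f c. 0 \<le> c \<Longrightarrow> holder_deriv m \<alpha> c f \<Longrightarrow> (\<And>x. \<bar>f x\<bar> \<le> M) \<Longrightarrow>
        (\<integral>x. f x \<partial>P) - (\<integral>x. f x \<partial>R) \<le> c * k + w"
    and a: "\<And>i. 0 \<le> a i" and I: "finite I"
    and f: "0 \<le> c" "holder_deriv m \<alpha> c f" "\<And>x. \<bar>f x\<bar> \<le> M"
  shows "(\<integral>x. f (\<Sum>i\<in>I. a i * x i) \<partial>PiM I (\<lambda>_. P)) - (\<integral>x. f (\<Sum>i\<in>I. a i * x i) \<partial>PiM I (\<lambda>_. R))
    \<le> (\<Sum>i\<in>I. c * a i powr (real m + \<alpha>) * k + w)"
  using I f(2,3)
proof (induction I arbitrary: f rule: finite_induct)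
  case empty
  have *: "(\<integral>x. f 0 \<partial>PiM {} (\<lambda>_::'i. Q)) = f 0" if "real_distribution Q" for Q
  proof -
    interpret prob_space "PiM {} (\<lambda>_::'i. Q)"
      by (intro prob_space_PiM) auto
    show ?thesis by (simp add: prob_space)
  qed
  show ?case by (simp only: sum.empty *[OF P] *[OF R] diff_self order_refl)
next
  case (insert i I)
  have fm [measurable]: "f \<in> borel_measurable borel"
    using holder_deriv_continuous[OF insert.prems(1) \<alpha>] by (rule borel_measurable_continuous_onI)
  interpret P: real_distribution P by fact
  interpret R: real_distribution R by fact
  interpret PP: product_sigma_finite "\<lambda>_::'i. P" by standard
  interpret RR: product_sigma_finite "\<lambda>_::'i. R" by standard
  interpret PI: prob_space "PiM I (\<lambda>_. P)" by (intro prob_space_PiM) (rule P.prob_space_axioms)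
  interpret RI: prob_space "PiM I (\<lambda>_. R)" by (intro prob_space_PiM) (rule R.prob_space_axioms)
  define S where "S x = (\<Sum>j\<in>I. a j * x j)" for x
  have Sm: "S \<in> borel_measurable (PiM I (\<lambda>_. Q))" if "real_distribution Q" for Q
    unfolding S_def using component_measurable[OF that] by (intro borel_measurable_sum borel_measurable_times) auto
  note [measurable] = Sm[OF P] Sm[OF R]
  have unfold: "(\<integral>x. f (\<Sum>j\<in>insert i I. a j * x j) \<partial>PiM (insert i I) (\<lambda>_. Q)) =
      (\<integral>x. (\<integral>y. f (a i * y + S x) \<partial>Q) \<partial>PiM I (\<lambda>_. Q))" if "real_distribution Q" for Q
  proof -
    interpret Q: real_distribution Q by fact
    interpret QQ: product_sigma_finite "\<lambda>_::'i. Q" by standard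
    interpret QI: prob_space "PiM (insert i I) (\<lambda>_. Q)" by (intro prob_space_PiM) (rule Q.prob_space_axioms)
    have "integrable (PiM (insert i I) (\<lambda>_. Q)) (\<lambda>x. f (\<Sum>j\<in>insert i I. a j * x j))"
    proof (rule QI.integrable_const_bound[of _ M])
      show "(\<lambda>x. f (\<Sum>j\<in>insert i I. a j * x j)) \<in> borel_measurable (PiM (insert i I) (\<lambda>_. Q))"
        by (intro measurable_compose[OF _ fm] borel_measurable_sum borel_measurable_times component_measurable[OF that]) auto
    qed (use insert.prems in auto)
    note 1 = QQ.product_integral_insert[OF insert.hyps(1,2) this]
    have "(\<Sum>j\<in>insert i I. a j * (x(i := y)) j) = a i * y + S x" for x y
      using insert.hyps unfolding S_def by (auto intro!: sum.cong)
    then show ?thesis unfolding 1 by simp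
  qed
  have m1: "(\<lambda>x. \<integral>y. f (a i * y + S x) \<partial>P) \<in> borel_measurable (PiM I (\<lambda>_. P))"
    and m2: "(\<lambda>x. \<integral>y. f (a i * y + S x) \<partial>R) \<in> borel_measurable (PiM I (\<lambda>_. P))"
    and m3: "(\<lambda>y. \<integral>x. f (a i * y + S x) \<partial>PiM I (\<lambda>_. P)) \<in> borel_measurable R"
    and m4: "(\<lambda>y. \<integral>x. f (a i * y + S x) \<partial>PiM I (\<lambda>_. R)) \<in> borel_measurable R"
    by measurable
  have aff: "holder_deriv m \<alpha> (c * a i powr (real m + \<alpha>)) (\<lambda>y. f (a i * y + r))" for r
    using holder_deriv_affine[OF insert.prems(1) a \<alpha> zero_le_one, of i r] by simp
  have shift: "holder_deriv m \<alpha> c (\<lambda>u. f (a i * y + u))" for y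
    using holder_deriv_affine[OF insert.prems(1) zero_le_one \<alpha> zero_le_one, of "a i * y"] by (simp add: add.commute)
  have 1: "(\<integral>x. (\<integral>y. f (a i * y + S x) \<partial>P) \<partial>PiM I (\<lambda>_. P)) - (\<integral>x. (\<integral>y. f (a i * y + S x) \<partial>R) \<partial>PiM I (\<lambda>_. P))
      \<le> c * a i powr (real m + \<alpha>) * k + w"
  proof (rule PI.integral_diff_le_const[OF m1 m2, of M])
    fix x
    show "\<bar>\<integral>y. f (a i * y + S x) \<partial>P\<bar> \<le> M" "\<bar>\<integral>y. f (a i * y + S x) \<partial>R\<bar> \<le> M"
      using P.norm_integral_le[of "\<lambda>y. f (a i * y + S x)" M] R.norm_integral_le[of "\<lambda>y. f (a i * y + S x)" M]
        insert.prems(2) by auto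
    show "(\<integral>y. f (a i * y + S x) \<partial>P) - (\<integral>y. f (a i * y + S x) \<partial>R) \<le> c * a i powr (real m + \<alpha>) * k + w"
      using f(1) by (intro hyp aff insert.prems(2)) auto
  qed
  have swap: "(\<integral>x. (\<integral>y. f (a i * y + S x) \<partial>R) \<partial>PiM I (\<lambda>_. Q)) = (\<integral>y. (\<integral>x. f (a i * y + S x) \<partial>PiM I (\<lambda>_. Q)) \<partial>R)"
    if "real_distribution Q" for Q
  proof -
    interpret Q: real_distribution Q by fact
    interpret QI: prob_space "PiM I (\<lambda>_. Q)" by (intro prob_space_PiM) (rule Q.prob_space_axioms)
    note [measurable] = Sm[OF that]
    show ?thesis
      by (rule Fubini_dominated[where h = "\<lambda>_. M"])
         (use insert.prems(2) in \<open>auto simp: QI.sigma_finite_measure_axioms R.finite_measure_axioms\<close>)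
  qed
  \<comment> \<open>Coordinate i already has law R and is frozen at y; the shifted test has the same
    constants, so the induction hypothesis replaces the rest.\<close>
  have 2: "(\<integral>y. (\<integral>x. f (a i * y + S x) \<partial>PiM I (\<lambda>_. P)) \<partial>R) - (\<integral>y. (\<integral>x. f (a i * y + S x) \<partial>PiM I (\<lambda>_. R)) \<partial>R)
      \<le> (\<Sum>i\<in>I. c * a i powr (real m + \<alpha>) * k + w)"
  proof (rule R.integral_diff_le_const[OF m3 m4, of M])
    fix y
    show "\<bar>\<integral>x. f (a i * y + S x) \<partial>PiM I (\<lambda>_. P)\<bar> \<le> M" "\<bar>\<integral>x. f (a i * y + S x) \<partial>PiM I (\<lambda>_. R)\<bar> \<le> M"
      using PI.norm_integral_le[of "\<lambda>x. f (a i * y + S x)" M] RI.norm_integral_le[of "\<lambda>x. f (a i * y + S x)" M]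
        insert.prems(2) by auto
    show "(\<integral>x. f (a i * y + S x) \<partial>PiM I (\<lambda>_. P)) - (\<integral>x. f (a i * y + S x) \<partial>PiM I (\<lambda>_. R))
        \<le> (\<Sum>i\<in>I. c * a i powr (real m + \<alpha>) * k + w)"
      unfolding S_def by (rule insert.IH[OF shift insert.prems(2)])
  qed
  show ?case
    unfolding unfold[OF P] unfold[OF R] swap[OF R]
    using 1 2 unfolding swap[OF P] using insert.hyps by simp
qed

section \<open>The smoothing transform on laws and its flow\<close>

definition smoothing_law :: "(real ^ 'n::finite) measure \<Rightarrow> real measure \<Rightarrow> real measure" where
  "smoothing_law L P = distr (L \<Otimes>\<^sub>M PiM UNIV (\<lambda>_::'n. P)) borel (\<lambda>(a, x). \<Sum>i\<in>UNIV. a $ i * x i)"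

definition smoothing_flow :: "(real ^ 'n::finite) measure \<Rightarrow> (real \<Rightarrow> real measure) \<Rightarrow> bool" where
  "smoothing_flow L P \<longleftrightarrow> (\<forall>t\<ge>0. real_distribution (P t)) \<and>
     (\<forall>t\<ge>0. \<forall>\<xi>. ((\<lambda>s. char (P s) \<xi>) has_vector_derivative
        (char (smoothing_law L (P t)) \<xi> - char (P t) \<xi>)) (at t within {0..}))"

lemma vec_nth_measurable: "(\<lambda>a. a $ i) \<in> borel_measurable (borel :: (real ^ 'n::finite) measure)"
  by (intro borel_measurable_continuous_onI continuous_intros)

context
  fixes L :: "(real ^ 'n::finite) measure"
  assumes L: "prob_space L" and setsL: "sets L = sets borel"
begin

lemma vec_nth_measurable_L [measurable]: "(\<lambda>a. a $ i) \<in> borel_measurable L"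
  using vec_nth_measurable by (simp add: measurable_cong_sets[OF setsL refl])

lemma weighted_sum_measurable:
  assumes "real_distribution P"
  shows "(\<lambda>(a, x). \<Sum>i\<in>UNIV. a $ i * x i) \<in> borel_measurable (L \<Otimes>\<^sub>M PiM UNIV (\<lambda>_::'n. P))"
proof -
  interpret P: real_distribution P by fact
  have [measurable]: "(\<lambda>x. x i) \<in> borel_measurable (PiM UNIV (\<lambda>_::'n. P))" for i
    using component_measurable[OF assms, of i UNIV] by simp
  show ?thesis unfolding split_beta' by measurable
qed

lemma real_distribution_smoothing_law:
  assumes "real_distribution P"
  shows "real_distribution (smoothing_law L P)"
proof -
  interpret P: real_distribution P by fact
  interpret L: prob_space L by (rule L)
  interpret PI: prob_space "PiM UNIV (\<lambda>_::'n. P)" by (intro prob_space_PiM) (rule P.prob_space_axioms)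
  interpret LP: pair_prob_space L "PiM UNIV (\<lambda>_::'n. P)" ..
  interpret prob_space "smoothing_law L P"
    unfolding smoothing_law_def by (rule LP.P.prob_space_distr[OF weighted_sum_measurable[OF assms]])
  show ?thesis by unfold_locales (simp add: smoothing_law_def)
qed

lemma integral_smoothing_law:
  fixes g :: "real \<Rightarrow> 'c::{banach, second_countable_topology}"
  assumes P: "real_distribution P" and g [measurable]: "g \<in> borel_measurable borel" and b: "\<And>x. norm (g x) \<le> B"
  shows "(\<integral>x. g x \<partial>smoothing_law L P) = (\<integral>a. (\<integral>x. g (\<Sum>i\<in>UNIV. a $ i * x i) \<partial>PiM UNIV (\<lambda>_::'n. P)) \<partial>L)"
    and "integrable L (\<lambda>a. (\<integral>x. g (\<Sum>i\<in>UNIV. a $ i * x i) \<partial>PiM UNIV (\<lambda>_::'n. P)))"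
proof -
  interpret P: real_distribution P by fact
  interpret L: prob_space L by (rule L)
  interpret PI: prob_space "PiM UNIV (\<lambda>_::'n. P)" by (intro prob_space_PiM) (rule P.prob_space_axioms)
  interpret LP: pair_prob_space L "PiM UNIV (\<lambda>_::'n. P)" ..
  note wm = weighted_sum_measurable[OF P]
  have gm: "(\<lambda>(a, x). g (\<Sum>i\<in>UNIV. a $ i * x i)) \<in> borel_measurable (L \<Otimes>\<^sub>M PiM UNIV (\<lambda>_::'n. P))"
    using measurable_compose[OF wm g] by (simp add: split_beta')
  have int: "integrable (L \<Otimes>\<^sub>M PiM UNIV (\<lambda>_::'n. P)) (\<lambda>(a, x). g (\<Sum>i\<in>UNIV. a $ i * x i))"
    by (rule LP.P.integrable_const_bound[of _ B]) (use b gm in auto)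
  have "(\<integral>x. g x \<partial>smoothing_law L P) = (\<integral>p. (\<lambda>(a, x). g (\<Sum>i\<in>UNIV. a $ i * x i)) p \<partial>(L \<Otimes>\<^sub>M PiM UNIV (\<lambda>_::'n. P)))"
    unfolding smoothing_law_def by (subst integral_distr[OF wm g]) (simp add: split_beta')
  also have "\<dots> = (\<integral>a. (\<integral>x. g (\<Sum>i\<in>UNIV. a $ i * x i) \<partial>PiM UNIV (\<lambda>_::'n. P)) \<partial>L)"
    using LP.integral_fst'[OF int] by simp
  finally show "(\<integral>x. g x \<partial>smoothing_law L P) = (\<integral>a. (\<integral>x. g (\<Sum>i\<in>UNIV. a $ i * x i) \<partial>PiM UNIV (\<lambda>_::'n. P)) \<partial>L)" .
  show "integrable L (\<lambda>a. (\<integral>x. g (\<Sum>i\<in>UNIV. a $ i * x i) \<partial>PiM UNIV (\<lambda>_::'n. P)))"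
    using LP.integrable_fst'[OF int] by simp
qed

text \<open>Serves both Fourier and Laplace transforms. Multiplicativity is asked for almost
  everywhere because \<open>exp (- \<kappa> * max 0 z)\<close> turns sums into products only for
  nonnegative summands.\<close>

lemma integral_smoothing_law_multiplicative:
  fixes e :: "real \<Rightarrow> complex"
  assumes P: "real_distribution P" and e [measurable]: "e \<in> borel_measurable borel" and b: "\<And>x. norm (e x) \<le> 1"
    and mult: "AE a in L. AE x in PiM UNIV (\<lambda>_::'n. P). e (\<Sum>i\<in>UNIV. a $ i * x i) = (\<Prod>i\<in>UNIV. e (a $ i * x i))"
  shows "(\<integral>x. e x \<partial>smoothing_law L P) = (\<integral>a. (\<Prod>i\<in>UNIV. (\<integral>x. e (a $ i * x) \<partial>P)) \<partial>L)"
proof -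
  interpret P: real_distribution P by fact
  interpret PP: product_sigma_finite "\<lambda>_::'n. P" by standard
  have [measurable]: "(\<lambda>x. x i) \<in> borel_measurable (PiM UNIV (\<lambda>_::'n. P))" for i
    using component_measurable[OF P, of i UNIV] by simp
  have pm: "(\<lambda>a. \<integral>x. e (a $ i * x) \<partial>P) \<in> borel_measurable L" for i
    by measurable
  have "(\<integral>x. e x \<partial>smoothing_law L P) = (\<integral>a. (\<integral>x. e (\<Sum>i\<in>UNIV. a $ i * x i) \<partial>PiM UNIV (\<lambda>_::'n. P)) \<partial>L)"
    by (rule integral_smoothing_law[OF P e b])
  also have "\<dots> = (\<integral>a. (\<Prod>i\<in>UNIV. (\<integral>x. e (a $ i * x) \<partial>P)) \<partial>L)"
  proof (rule integral_cong_AE)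
    show "(\<lambda>a. \<integral>x. e (\<Sum>i\<in>UNIV. a $ i * x i) \<partial>PiM UNIV (\<lambda>_::'n. P)) \<in> borel_measurable L"
      using integral_smoothing_law(2)[OF P e b] by (rule borel_measurable_integrable)
    show "(\<lambda>a. \<Prod>i\<in>UNIV. (\<integral>x. e (a $ i * x) \<partial>P)) \<in> borel_measurable L"
      by (intro borel_measurable_prod pm)
    show "AE a in L. (\<integral>x. e (\<Sum>i\<in>UNIV. a $ i * x i) \<partial>PiM UNIV (\<lambda>_::'n. P)) = (\<Prod>i\<in>UNIV. (\<integral>x. e (a $ i * x) \<partial>P))"
      using mult
    proof eventually_elim
      case (elim a)
      have "(\<integral>x. e (\<Sum>i\<in>UNIV. a $ i * x i) \<partial>PiM UNIV (\<lambda>_::'n. P)) =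
          (\<integral>x. (\<Prod>i\<in>UNIV. e (a $ i * x i)) \<partial>PiM UNIV (\<lambda>_::'n. P))"
        by (rule integral_cong_AE) (use elim in auto)
      also have "\<dots> = (\<Prod>i\<in>UNIV. (\<integral>x. e (a $ i * x) \<partial>P))"
      proof (rule PP.product_integral_prod)
        show "integrable P (\<lambda>x. e (a $ i * x))" for i
          by (rule P.integrable_const_bound[of _ 1]) (use b in auto)
      qed simp
      finally show ?case .
    qed
  qed
  finally show ?thesis .
qed

lemma char_smoothing_law:
  assumes P: "real_distribution P"
  shows "char (smoothing_law L P) \<xi> = (\<integral>a. (\<Prod>i\<in>UNIV. char P (a $ i * \<xi>)) \<partial>L)"
proof -
  have "char (smoothing_law L P) \<xi> = (\<integral>a. (\<Prod>i\<in>UNIV. (\<integral>x. iexp (\<xi> * (a $ i * x)) \<partial>P)) \<partial>L)"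
    unfolding char_def
    by (rule integral_smoothing_law_multiplicative[OF P])
       (auto simp: sum_distrib_left exp_sum simp flip: of_real_mult)
  then show ?thesis by (simp add: char_def mult_ac)
qed

text \<open>Averaging the coordinatewise replacement over the coefficients: the main constant is
  multiplied by the mean of the sum of the powers, the slack w by the number of summands.\<close>

lemma smoothing_law_contraction:
  assumes P: "real_distribution P" and R: "real_distribution R" and \<alpha>: "0 < \<alpha>"
    and hyp: "\<And>f c. 0 \<le> c \<Longrightarrow> holder_deriv m \<alpha> c f \<Longrightarrow> (\<And>x. \<bar>f x\<bar> \<le> M) \<Longrightarrow>
        (\<integral>x. f x \<partial>P) - (\<integral>x. f x \<partial>R) \<le> c * k + w"
    and nonneg: "AE a in L. \<forall>i. 0 \<le> a $ i"
    and int: "integrable L (\<lambda>a. \<Sum>i\<in>UNIV. (a $ i) powr (real m + \<alpha>))"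
    and f: "0 \<le> c" "holder_deriv m \<alpha> c f" "\<And>x. \<bar>f x\<bar> \<le> M"
  shows "(\<integral>x. f x \<partial>smoothing_law L P) - (\<integral>x. f x \<partial>smoothing_law L R)
    \<le> c * (\<integral>a. (\<Sum>i\<in>UNIV. (a $ i) powr (real m + \<alpha>)) \<partial>L) * k + real CARD('n) * w"
proof -
  interpret L: prob_space L by (rule L)
  have fm: "f \<in> borel_measurable borel"
    using holder_deriv_continuous[OF f(2) \<alpha>] by (rule borel_measurable_continuous_onI)
  have fb: "norm (f x) \<le> M" for x using f(3) by simp
  note iP = integral_smoothing_law[OF P fm fb] and iR = integral_smoothing_law[OF R fm fb]
  have "(\<integral>x. f x \<partial>smoothing_law L P) - (\<integral>x. f x \<partial>smoothing_law L R) =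
    (\<integral>a. (\<integral>x. f (\<Sum>i\<in>UNIV. a $ i * x i) \<partial>PiM UNIV (\<lambda>_::'n. P)) - (\<integral>x. f (\<Sum>i\<in>UNIV. a $ i * x i) \<partial>PiM UNIV (\<lambda>_::'n. R)) \<partial>L)"
    unfolding iP(1) iR(1) using iP(2) iR(2) by (rule Bochner_Integration.integral_diff[symmetric])
  also have "\<dots> \<le> (\<integral>a. c * (\<Sum>i\<in>UNIV. (a $ i) powr (real m + \<alpha>)) * k + real CARD('n) * w \<partial>L)"
  proof (rule integral_mono_AE)
    show "AE a in L. (\<integral>x. f (\<Sum>i\<in>UNIV. a $ i * x i) \<partial>PiM UNIV (\<lambda>_::'n. P)) - (\<integral>x. f (\<Sum>i\<in>UNIV. a $ i * x i) \<partial>PiM UNIV (\<lambda>_::'n. R))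
        \<le> c * (\<Sum>i\<in>UNIV. (a $ i) powr (real m + \<alpha>)) * k + real CARD('n) * w"
      using nonneg
    proof eventually_elim
      case (elim a)
      have "(\<integral>x. f (\<Sum>i\<in>UNIV. a $ i * x i) \<partial>PiM UNIV (\<lambda>_::'n. P)) - (\<integral>x. f (\<Sum>i\<in>UNIV. a $ i * x i) \<partial>PiM UNIV (\<lambda>_::'n. R))
          \<le> (\<Sum>i\<in>UNIV. c * (a $ i) powr (real m + \<alpha>) * k + w)"
        using elim by (intro product_weighted_sum_le[OF P R \<alpha> hyp _ _ f]) auto
      then show ?case by (simp add: sum.distrib sum_distrib_left sum_distrib_right)
    qed
  qed (use iP(2) iR(2) int in auto)
  also have "\<dots> = c * (\<integral>a. (\<Sum>i\<in>UNIV. (a $ i) powr (real m + \<alpha>)) \<partial>L) * k + real CARD('n) * w"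
  proof -
    have "integrable L (\<lambda>a. c * (\<Sum>i\<in>UNIV. (a $ i) powr (real m + \<alpha>)) * k)"
      using int by auto
    then show ?thesis using L.prob_space by (subst Bochner_Integration.integral_add) auto
  qed
  finally show ?thesis .
qed

lemma smoothing_flow_char_lipschitz:
  assumes flow: "smoothing_flow L P" and st: "0 \<le> s" "0 \<le> t"
  shows "norm (char (P s) \<xi> - char (P t) \<xi>) \<le> 2 * \<bar>s - t\<bar>"
proof -
  have "norm (char (P s) \<xi> - char (P t) \<xi>) \<le> 2 * norm (s - t)"
  proof (rule differentiable_bound[of "{0..}"])
    fix u :: real assume u: "u \<in> {0..}"
    let ?d = "char (smoothing_law L (P u)) \<xi> - char (P u) \<xi>"
    interpret P: real_distribution "P u" using flow u by (simp add: smoothing_flow_def)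
    interpret S: real_distribution "smoothing_law L (P u)"
      by (rule real_distribution_smoothing_law) (rule P.real_distribution_axioms)
    show "((\<lambda>s. char (P s) \<xi>) has_derivative (\<lambda>h. h *\<^sub>R ?d)) (at u within {0..})"
      using flow u unfolding smoothing_flow_def has_vector_derivative_def by blast
    have "norm ?d \<le> 1 + 1"
      by (rule order_trans[OF norm_triangle_ineq4]) (intro add_mono S.cmod_char_le_1 P.cmod_char_le_1)
    then have "norm (h *\<^sub>R ?d) \<le> 2 * norm h" for h
      using mult_left_mono[of "norm ?d" 2 "\<bar>h\<bar>"] by (simp add: mult.commute)
    then show "onorm (\<lambda>h. h *\<^sub>R ?d) \<le> 2" by (intro onorm_le) auto
  qed (use st in auto)
  then show ?thesis by simp
qed

lemma smoothing_flow_duhamel: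
  assumes flow: "smoothing_flow L P" and "continuous_on UNIV f" "\<And>x. \<bar>f x\<bar> \<le> M" "0 \<le> t"
  shows "has_bochner_integral lborel (\<lambda>s. indicator {0..t} s * (exp s * (\<integral>x. f x \<partial>smoothing_law L (P s))))
           (exp t * (\<integral>x. f x \<partial>P t) - (\<integral>x. f x \<partial>P 0))"
proof (rule duhamel[of P "\<lambda>s. smoothing_law L (P s)" "real CARD('n) * 2"])
  interpret L: prob_space L by (rule L)
  show P: "real_distribution (P t)" if "t \<ge> 0" for t
    using flow that by (simp add: smoothing_flow_def)
  show "real_distribution (smoothing_law L (P t))" if "t \<ge> 0" for t
    by (rule real_distribution_smoothing_law[OF P[OF that]])
  show "((\<lambda>s. char (P s) \<xi>) has_vector_derivative char (smoothing_law L (P t)) \<xi> - char (P t) \<xi>) (at t within {0..})"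
    if "t \<ge> 0" for t \<xi>
    using flow that by (simp add: smoothing_flow_def)
  show "norm (char (smoothing_law L (P s)) \<xi> - char (smoothing_law L (P t)) \<xi>) \<le> real CARD('n) * 2 * \<bar>s - t\<bar>"
    if st: "0 \<le> s" "0 \<le> t" for s t \<xi>
  proof -
    interpret Ps: real_distribution "P s" by (rule P[OF st(1)])
    interpret Pt: real_distribution "P t" by (rule P[OF st(2)])
    have i: "integrable L (\<lambda>a. \<Prod>i\<in>UNIV. char Q (a $ i * \<xi>))" if "real_distribution Q" for Q
    proof -
      interpret Q: real_distribution Q by fact
      show ?thesis
      proof (rule L.integrable_const_bound[of _ 1])
        show "AE a in L. norm (\<Prod>i\<in>UNIV. char Q (a $ i * \<xi>)) \<le> 1"
          unfolding prod_norm[symmetric] by (intro AE_I2 prod_le_1) (auto intro: Q.cmod_char_le_1)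
      qed measurable
    qed
    have "char (smoothing_law L (P s)) \<xi> - char (smoothing_law L (P t)) \<xi> =
        (\<integral>a. (\<Prod>i\<in>UNIV. char (P s) (a $ i * \<xi>)) - (\<Prod>i\<in>UNIV. char (P t) (a $ i * \<xi>)) \<partial>L)"
      unfolding char_smoothing_law[OF P[OF st(1)]] char_smoothing_law[OF P[OF st(2)]]
      by (rule Bochner_Integration.integral_diff[symmetric]) (intro i P st)+
    also have "norm \<dots> \<le> real CARD('n) * 2 * \<bar>s - t\<bar>"
    proof (rule L.norm_integral_le)
      fix a
      \<comment> \<open>A product of N factors from the unit disc is 1-Lipschitz in each factor, so
        the constant 2 of the flow becomes 2 N, uniformly in a.\<close>
      have "norm ((\<Prod>i\<in>UNIV. char (P s) (a $ i * \<xi>)) - (\<Prod>i\<in>UNIV. char (P t) (a $ i * \<xi>)))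
          \<le> (\<Sum>i\<in>(UNIV::'n set). norm (char (P s) (a $ i * \<xi>) - char (P t) (a $ i * \<xi>)))"
        by (rule norm_prod_diff) (intro Ps.cmod_char_le_1 Pt.cmod_char_le_1)+
      also have "\<dots> \<le> (\<Sum>i\<in>(UNIV::'n set). 2 * \<bar>s - t\<bar>)"
        by (intro sum_mono smoothing_flow_char_lipschitz[OF flow st])
      finally show "norm ((\<Prod>i\<in>UNIV. char (P s) (a $ i * \<xi>)) - (\<Prod>i\<in>UNIV. char (P t) (a $ i * \<xi>)))
          \<le> real CARD('n) * 2 * \<bar>s - t\<bar>" by simp
    qed
    finally show ?thesis .
  qed
qed fact+

text \<open>Gronwall's lemma does not apply directly, because the distance at a positive time is not known to be
  finite. Iterating Duhamel's formula \<open>n\<close> times leaves the explicit remainder \<open>(N t)\<^sup>n / n!\<close>.\<close>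
lemma smoothing_flow_contraction:
  assumes P: "smoothing_flow L P" and R: "smoothing_flow L R" and \<alpha>: "0 < \<alpha>" and K: "0 \<le> K"
    and init: "\<And>f c M. 0 \<le> c \<Longrightarrow> holder_deriv m \<alpha> c f \<Longrightarrow> (\<And>x. \<bar>f x\<bar> \<le> M) \<Longrightarrow>
        (\<integral>x. f x \<partial>P 0) - (\<integral>x. f x \<partial>R 0) \<le> c * K"
    and nonneg: "AE a in L. \<forall>i. 0 \<le> a $ i"
    and int: "integrable L (\<lambda>a. \<Sum>i\<in>UNIV. (a $ i) powr (real m + \<alpha>))"
    and f: "0 \<le> c" "holder_deriv m \<alpha> c f" "\<And>x. \<bar>f x\<bar> \<le> M" and t: "0 \<le> t"
  shows "(\<integral>x. f x \<partial>P t) - (\<integral>x. f x \<partial>R t) \<le> c * K * exp (QQ L (real m + \<alpha>) * t)"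
proof -
  let ?N = "real CARD('n)"
  define q where "q = (\<integral>a. (\<Sum>i\<in>UNIV. (a $ i) powr (real m + \<alpha>)) \<partial>L)"
  \<comment> \<open>The recursion behind the remainder: \<open>v (Suc n)\<close> vanishes at 0 and
    has derivative N \<open>v n\<close>. The start 2 exp t makes exp (- s) \<open>v 0 s\<close> at
    least 2 for s <= t, which covers the trivial bound 2 M.\<close>
  define v where "v n s = 2 * exp t * (?N * s) ^ n / fact n" for n s
  have v_deriv: "((\<lambda>s. v (Suc n) s) has_real_derivative ?N * v n s) (at s within A)" for n s A
  proof -
    have "((\<lambda>s. 2 * exp t * (?N * s) ^ Suc n / fact (Suc n)) has_real_derivative
        2 * exp t * (real (Suc n) * (?N * s) ^ n * ?N) / fact (Suc n)) (at s within A)"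
      by (auto intro!: derivative_eq_intros simp del: fact_Suc power_Suc)
    also have "2 * exp t * (real (Suc n) * (?N * s) ^ n * ?N) / fact (Suc n) = ?N * v n s"
      unfolding v_def fact_Suc by (simp add: divide_simps del: of_nat_Suc)
    finally show ?thesis unfolding v_def .
  qed
  \<comment> \<open>f and c vary in the induction, since the transform tests with rescaled
    functions, while M stays fixed.\<close>
  have claim: "(\<integral>x. f x \<partial>P s) - (\<integral>x. f x \<partial>R s) \<le> c * (K * exp ((q - 1) * s)) + M * (exp (- s) * v n s)"
    if "0 \<le> s" "s \<le> t" "0 \<le> c" "holder_deriv m \<alpha> c f" "\<And>x. \<bar>f x\<bar> \<le> M" for n s f c
    using that
  proof (induction n arbitrary: s f c)
    case 0
    have M0: "0 \<le> M" using "0.prems"(5)[of 0] by linarith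
    interpret Ps: real_distribution "P s" using P 0 by (simp add: smoothing_flow_def)
    interpret Rs: real_distribution "R s" using R 0 by (simp add: smoothing_flow_def)
    have "\<bar>\<integral>x. f x \<partial>P s\<bar> \<le> M" "\<bar>\<integral>x. f x \<partial>R s\<bar> \<le> M"
      using Ps.norm_integral_le[of f M] Rs.norm_integral_le[of f M] 0 by auto
    then have "(\<integral>x. f x \<partial>P s) - (\<integral>x. f x \<partial>R s) \<le> M * 2" by linarith
    also have "M * 2 \<le> M * (exp (- s) * v 0 s)"
    proof (rule mult_left_mono[OF _ M0])
      have "1 \<le> exp (t - s)" using 0 by simp
      then show "2 \<le> exp (- s) * v 0 s" by (simp add: v_def exp_diff exp_minus field_simps)
    qed
    also have "\<dots> \<le> c * (K * exp ((q - 1) * s)) + M * (exp (- s) * v 0 s)"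
      using 0 K by simp
    finally show ?case .
  next
    case (Suc n)
    note s = Suc.prems(1,2) and f = Suc.prems(3-5)
    have cont: "continuous_on UNIV f" by (rule holder_deriv_continuous[OF f(2) \<alpha>])
    note dP = smoothing_flow_duhamel[OF P cont f(3) s(1)] and dR = smoothing_flow_duhamel[OF R cont f(3) s(1)]
    \<comment> \<open>\<open>?h\<close> is exp u times the bound that the induction hypothesis gives
      after one application of the transform, and \<open>?H\<close> is its primitive.\<close>
    let ?H = "\<lambda>u. c * K * exp (q * u) + M * v (Suc n) u"
    let ?h = "\<lambda>u. c * K * (q * exp (q * u)) + M * (?N * v n u)"
    have h_cont: "continuous_on {0..s} ?h"
      unfolding v_def by (intro continuous_intros) auto
    have "exp s * ((\<integral>x. f x \<partial>P s) - (\<integral>x. f x \<partial>R s)) - ((\<integral>x. f x \<partial>P 0) - (\<integral>x. f x \<partial>R 0)) =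
        (\<integral>u. indicator {0..s} u * (exp u * (\<integral>x. f x \<partial>smoothing_law L (P u))) -
             indicator {0..s} u * (exp u * (\<integral>x. f x \<partial>smoothing_law L (R u))) \<partial>lborel)"
      using has_bochner_integral_diff[OF dP dR] by (simp add: has_bochner_integral_iff algebra_simps)
    also have "\<dots> \<le> (\<integral>u. indicator {0..s} u *\<^sub>R ?h u \<partial>lborel)"
    proof (rule integral_mono)
      show "integrable lborel (\<lambda>u. indicator {0..s} u * (exp u * (\<integral>x. f x \<partial>smoothing_law L (P u))) -
             indicator {0..s} u * (exp u * (\<integral>x. f x \<partial>smoothing_law L (R u))))"
        using has_bochner_integral_diff[OF dP dR] by (simp add: has_bochner_integral_iff)
      show "integrable lborel (\<lambda>u. indicator {0..s} u *\<^sub>R ?h u)"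
        by (rule borel_integrable_compact[OF compact_Icc h_cont])
      fix u
      show "indicator {0..s} u * (exp u * (\<integral>x. f x \<partial>smoothing_law L (P u))) -
             indicator {0..s} u * (exp u * (\<integral>x. f x \<partial>smoothing_law L (R u))) \<le> indicator {0..s} u *\<^sub>R ?h u"
      proof (cases "u \<in> {0..s}")
        case True
        then have u: "0 \<le> u" "u \<le> t" using s by auto
        have Pu: "real_distribution (P u)" "real_distribution (R u)"
          using P R u by (auto simp: smoothing_flow_def)
        have "(\<integral>x. f x \<partial>smoothing_law L (P u)) - (\<integral>x. f x \<partial>smoothing_law L (R u)) \<le>
            c * q * (K * exp ((q - 1) * u)) + ?N * (M * (exp (- u) * v n u))"
          unfolding q_def
          by (rule smoothing_law_contraction[OF Pu \<alpha> _ nonneg int f])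
             (use Suc.IH[OF u] in \<open>auto simp: q_def\<close>)
        then have "exp u * ((\<integral>x. f x \<partial>smoothing_law L (P u)) - (\<integral>x. f x \<partial>smoothing_law L (R u))) \<le>
            exp u * (c * q * (K * exp ((q - 1) * u)) + ?N * (M * (exp (- u) * v n u)))"
          by (intro mult_left_mono) auto
        also have "\<dots> = c * q * K * (exp u * exp ((q - 1) * u)) + ?N * M * v n u * (exp u * exp (- u))"
          by (simp only: distrib_left) (simp only: mult_ac)
        also have "\<dots> = ?h u"
          by (simp add: exp_add[symmetric] algebra_simps)
        finally show ?thesis using True by (simp add: algebra_simps)
      qed simp
    qed
    also have "(\<integral>u. indicator {0..s} u *\<^sub>R ?h u \<partial>lborel) = ?H s - ?H 0"
    proof (rule integral_FTC_atLeastAtMost[OF s(1) _ h_cont])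
      show "(?H has_vector_derivative ?h u) (at u within {0..s})" for u
        unfolding has_real_derivative_iff_has_vector_derivative[symmetric]
        by (auto intro!: derivative_eq_intros v_deriv)
    qed
    also have "?H s - ?H 0 = c * K * exp (q * s) + M * v (Suc n) s - c * K"
      by (simp add: v_def)
    finally have "exp s * ((\<integral>x. f x \<partial>P s) - (\<integral>x. f x \<partial>R s)) \<le> c * K * exp (q * s) + M * v (Suc n) s"
      using init[OF f] by linarith
    then have "exp (- s) * (exp s * ((\<integral>x. f x \<partial>P s) - (\<integral>x. f x \<partial>R s))) \<le>
        exp (- s) * (c * K * exp (q * s) + M * v (Suc n) s)"
      by (intro mult_left_mono) auto
    moreover have "exp (- s) * (exp s * d) = d" for d :: real
      by (simp add: exp_minus)
    moreover have "exp (- s) * (c * K * exp (q * s) + M * v (Suc n) s) =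
        c * (K * exp ((q - 1) * s)) + M * (exp (- s) * v (Suc n) s)"
    proof -
      have "exp ((q - 1) * s) = exp (- s) * exp (q * s)"
        by (simp add: exp_add[symmetric] algebra_simps)
      then show ?thesis by (simp add: algebra_simps)
    qed
    ultimately show ?case by simp
  qed
  have "(\<lambda>n. (?N * t) ^ n / fact n) \<longlonglongrightarrow> 0"
    by (rule summable_LIMSEQ_zero) (use summable_exp[of "?N * t"] in \<open>simp add: divide_inverse mult.commute\<close>)
  then have "(\<lambda>n. 2 * exp t * ((?N * t) ^ n / fact n)) \<longlonglongrightarrow> 2 * exp t * 0"
    by (rule tendsto_mult_left)
  then have "(\<lambda>n. v n t) \<longlonglongrightarrow> 0" by (simp add: v_def)
  then have "(\<lambda>n. c * (K * exp ((q - 1) * t)) + M * (exp (- t) * v n t)) \<longlonglongrightarrow>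
      c * (K * exp ((q - 1) * t)) + M * (exp (- t) * 0)"
    by (intro tendsto_intros)
  then have "(\<integral>x. f x \<partial>P t) - (\<integral>x. f x \<partial>R t) \<le> c * (K * exp ((q - 1) * t)) + M * (exp (- t) * 0)"
    by (rule LIMSEQ_le_const) (use claim[OF t order_refl f] in auto)
  then show ?thesis by (simp add: QQ_def q_def)
qed

end

section \<open>Self-similarity of the limit law\<close>

definition unit_uniform :: "real measure" where
  "unit_uniform = density lborel (indicator {0..1})"

lemma prob_space_unit_uniform: "prob_space unit_uniform"
  by (rule prob_spaceI) (simp add: unit_uniform_def emeasure_density)

lemma sets_unit_uniform [measurable_cong, simp]: "sets unit_uniform = sets borel"
  by (simp add: unit_uniform_def)

lemma integral_unit_uniform:
  fixes f :: "real \<Rightarrow> 'a::{banach, second_countable_topology}"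
  assumes "f \<in> borel_measurable borel"
  shows "(\<integral>\<tau>. f \<tau> \<partial>unit_uniform) = (\<integral>\<tau>. indicator {0..1} \<tau> *\<^sub>R f \<tau> \<partial>lborel)"
proof -
  have "unit_uniform = density lborel (\<lambda>x. ennreal (indicator {0..1} x))"
    unfolding unit_uniform_def by (intro arg_cong2[where f = density] refl ext) (simp add: indicator_def)
  then have "(\<integral>\<tau>. f \<tau> \<partial>unit_uniform) = (\<integral>\<tau>. f \<tau> \<partial>density lborel (\<lambda>x. ennreal (indicator {0..1} x)))"
    by simp
  also have "\<dots> = (\<integral>\<tau>. indicator {0..1} \<tau> *\<^sub>R f \<tau> \<partial>lborel)"
    using assms by (intro integral_density) auto
  finally show ?thesis .
qed

text \<open>With the time variable \<tau> absorbed into random coefficients, the equation for zeta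
  becomes invariance under an ordinary \<open>smoothing_law\<close>, and everything proved for that
  transform applies.\<close>

definition coeff_law :: "(real ^ 'n::finite) measure \<Rightarrow> real \<Rightarrow> real \<Rightarrow> (real ^ 'n) measure" where
  "coeff_law L \<gamma> Q = distr (unit_uniform \<Otimes>\<^sub>M L) borel (\<lambda>(\<tau>, a). \<chi> i. (a $ i) powr \<gamma> * \<tau> powr Q)"

context
  fixes L :: "(real ^ 'n::finite) measure"
  assumes L: "prob_space L" and setsL: "sets L = sets borel"
begin

lemma vec_nth_measurable_L' [measurable]: "(\<lambda>a. a $ i) \<in> borel_measurable L"
  by (rule vec_nth_measurable_L[OF L setsL])

lemma coeff_measurable:
  "(\<lambda>(\<tau>, a). \<chi> i. (a $ i) powr \<gamma> * \<tau> powr Q) \<in> unit_uniform \<Otimes>\<^sub>M L \<rightarrow>\<^sub>M (borel :: (real ^ 'n) measure)"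
proof (subst borel_measurable_euclidean_space, intro ballI)
  fix b :: "real ^ 'n" assume "b \<in> Basis"
  then obtain i where b: "b = axis i 1" by (auto simp: Basis_vec_def)
  have "(\<lambda>p. (snd p $ i) powr \<gamma> * fst p powr Q) \<in> borel_measurable (unit_uniform \<Otimes>\<^sub>M L)"
    by measurable
  then show "(\<lambda>x. (case x of (\<tau>, a) \<Rightarrow> \<chi> i. (a $ i) powr \<gamma> * \<tau> powr Q) \<bullet> b) \<in> borel_measurable (unit_uniform \<Otimes>\<^sub>M L)"
    by (simp add: b inner_axis split_beta')
qed

lemma prob_space_coeff_law: "prob_space (coeff_law L \<gamma> Q)"
proof -
  interpret U: prob_space unit_uniform by (rule prob_space_unit_uniform)
  interpret L: prob_space L by (rule L)
  interpret UL: pair_prob_space unit_uniform L ..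
  show ?thesis unfolding coeff_law_def by (rule UL.P.prob_space_distr[OF coeff_measurable])
qed

lemma sets_coeff_law: "sets (coeff_law L \<gamma> Q) = sets borel"
  by (simp add: coeff_law_def)

lemma coeff_law_nonneg: "AE b in coeff_law L \<gamma> Q. \<forall>i. 0 \<le> b $ i"
proof -
  have [measurable]: "(\<lambda>a. a $ i) \<in> borel_measurable (borel :: (real ^ 'n) measure)" for i
    by (rule vec_nth_measurable)
  show ?thesis unfolding coeff_law_def
    by (subst AE_distr_iff[OF coeff_measurable]) auto
qed

lemma integral_coeff_law:
  fixes g :: "real ^ 'n \<Rightarrow> 'c::{banach, second_countable_topology}"
  assumes g: "g \<in> borel_measurable borel" and b: "\<And>x. norm (g x) \<le> B"
  shows "(\<integral>b. g b \<partial>coeff_law L \<gamma> Q) = (\<integral>\<tau>. indicator {0..1} \<tau> *\<^sub>R (\<integral>a. g (\<chi> i. (a $ i) powr \<gamma> * \<tau> powr Q) \<partial>L) \<partial>lborel)"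
proof -
  interpret U: prob_space unit_uniform by (rule prob_space_unit_uniform)
  interpret L: prob_space L by (rule L)
  interpret UL: pair_prob_space unit_uniform L ..
  have gm: "(\<lambda>(\<tau>, a). g (\<chi> i. (a $ i) powr \<gamma> * \<tau> powr Q)) \<in> borel_measurable (unit_uniform \<Otimes>\<^sub>M L)"
    using measurable_compose[OF coeff_measurable g] by (simp add: split_beta')
  have int: "integrable (unit_uniform \<Otimes>\<^sub>M L) (\<lambda>(\<tau>, a). g (\<chi> i. (a $ i) powr \<gamma> * \<tau> powr Q))"
    by (rule UL.P.integrable_const_bound[of _ B]) (use b gm in auto)
  have "(\<integral>b. g b \<partial>coeff_law L \<gamma> Q) = (\<integral>p. (\<lambda>(\<tau>, a). g (\<chi> i. (a $ i) powr \<gamma> * \<tau> powr Q)) p \<partial>(unit_uniform \<Otimes>\<^sub>M L))"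
    unfolding coeff_law_def by (subst integral_distr[OF coeff_measurable g]) (simp add: split_beta')
  also have "\<dots> = (\<integral>\<tau>. (\<integral>a. g (\<chi> i. (a $ i) powr \<gamma> * \<tau> powr Q) \<partial>L) \<partial>unit_uniform)"
    using UL.integral_fst'[OF int] by simp
  also have "\<dots> = (\<integral>\<tau>. indicator {0..1} \<tau> *\<^sub>R (\<integral>a. g (\<chi> i. (a $ i) powr \<gamma> * \<tau> powr Q) \<partial>L) \<partial>lborel)"
    using borel_measurable_integrable[OF UL.integrable_fst'[OF int]]
    by (intro integral_unit_uniform) simp
  finally show ?thesis .
qed

text \<open>The Fourier equation for \<open>\<zeta>\<close> is an identity of laws, so it may be tested against the exponentials
  \<open>exp (- \<kappa> z)\<close> of any \<open>\<kappa>\<close> in the right half plane.\<close>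
lemma zeta_infty_fixed_point:
  assumes Z: "zeta_infty L \<gamma> Z"
  shows "smoothing_law (coeff_law L \<gamma> (QQ L \<gamma>)) Z = Z"
proof (rule Levy_uniqueness)
  let ?Q = "QQ L \<gamma>"
  show Zd: "real_distribution Z"
    using Z by (simp add: zeta_infty_def real_prob_iff_real_distribution)
  interpret Z: real_distribution Z by fact
  show "real_distribution (smoothing_law (coeff_law L \<gamma> ?Q) Z)"
    by (rule real_distribution_smoothing_law[OF prob_space_coeff_law sets_coeff_law Zd])
  show "char (smoothing_law (coeff_law L \<gamma> ?Q) Z) = char Z"
  proof
    fix \<xi>
    have [measurable]: "(\<lambda>a. a $ i) \<in> borel_measurable (borel :: (real ^ 'n) measure)" for i
      by (rule vec_nth_measurable)
    have "char (smoothing_law (coeff_law L \<gamma> ?Q) Z) \<xi> =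
        (\<integral>b. (\<Prod>i\<in>UNIV. char Z (b $ i * \<xi>)) \<partial>coeff_law L \<gamma> ?Q)"
      by (rule char_smoothing_law[OF prob_space_coeff_law sets_coeff_law Zd])
    also have "\<dots> = (\<integral>\<tau>. indicator {0..1} \<tau> *\<^sub>R (\<integral>a. (\<Prod>i\<in>UNIV. char Z (((\<chi> i. (a $ i) powr \<gamma> * \<tau> powr ?Q) $ i) * \<xi>)) \<partial>L) \<partial>lborel)"
    proof (rule integral_coeff_law[where g = "\<lambda>b. \<Prod>i\<in>UNIV. char Z (b $ i * \<xi>)" and B = 1])
      show "(\<lambda>b. \<Prod>i\<in>UNIV. char Z (b $ i * \<xi>)) \<in> borel_measurable (borel :: (real ^ 'n) measure)"
        by measurable
      show "norm (\<Prod>i\<in>(UNIV::'n set). char Z (b $ i * \<xi>)) \<le> 1" for b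
        unfolding prod_norm[symmetric] by (intro prod_le_1) (auto intro: Z.cmod_char_le_1)
    qed
    also have "\<dots> = char Z \<xi>"
    proof -
      have "char Z \<xi> = (CLBINT \<tau>:{0..1}. (CLINT a|L. (\<Prod>i\<in>UNIV. char Z (\<xi> * (a $ i) powr \<gamma> * \<tau> powr ?Q))))"
        using Z unfolding zeta_infty_def by blast
      moreover have "(a $ i) powr \<gamma> * \<tau> powr ?Q * \<xi> = \<xi> * (a $ i) powr \<gamma> * \<tau> powr ?Q" for a :: "real ^ 'n" and i \<tau>
        by (simp add: mult.commute mult.left_commute)
      ultimately show ?thesis by (simp only: vec_lambda_beta set_lebesgue_integral_def)
    qed
    finally show "char (smoothing_law (coeff_law L \<gamma> ?Q) Z) \<xi> = char Z \<xi>" .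
  qed
qed

end

section \<open>Laplace transform of zeta at complex arguments\<close>

definition laplace :: "real measure \<Rightarrow> complex \<Rightarrow> complex" where
  "laplace Z \<kappa> = (\<integral>z. exp (- \<kappa> * complex_of_real (max 0 z)) \<partial>Z)"

text \<open>At \<kappa> = k(\<xi>) and u = exp t this is the characteristic function of the
  smoothing transform of the dilated limit law; \<tau> in the fixed point equation plays the role of
  u.\<close>

definition flow_rate :: "(real ^ 'n::finite) measure \<Rightarrow> real \<Rightarrow> real measure \<Rightarrow> complex \<Rightarrow> real \<Rightarrow> complex" where
  "flow_rate L \<gamma> Z \<kappa> u = (\<integral>a. (\<Prod>i\<in>UNIV. laplace Z (\<kappa> * ((a $ i) powr \<gamma> * u powr QQ L \<gamma>))) \<partial>L)"

text \<open>This is the reason for \<open>max 0\<close> in \<open>laplace\<close>: the integrand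
  stays bounded also on the null set of negative z.\<close>

lemma laplace_integrand_bound:
  "0 \<le> Re \<kappa> \<Longrightarrow> norm (exp (- \<kappa> * complex_of_real (max 0 z))) \<le> 1"
  by (simp add: norm_exp_eq_Re)

lemma laplace_measurable: "real_distribution Z \<Longrightarrow> laplace Z \<in> borel_measurable borel"
proof -
  assume "real_distribution Z"
  then interpret Z: real_distribution Z .
  show ?thesis unfolding laplace_def by measurable
qed

lemma laplace_bound: "real_distribution Z \<Longrightarrow> 0 \<le> Re \<kappa> \<Longrightarrow> norm (laplace Z \<kappa>) \<le> 1"
proof -
  assume "real_distribution Z" and k: "0 \<le> Re \<kappa>"
  then interpret Z: real_distribution Z by simp
  show ?thesis unfolding laplace_def by (rule Z.norm_integral_le) (rule laplace_integrand_bound[OF k])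
qed

lemma laplace_tendsto:
  assumes "real_distribution Z" and "k \<longlonglongrightarrow> \<kappa>" "\<And>n. 0 \<le> Re (k n)"
  shows "(\<lambda>n. laplace Z (k n)) \<longlonglongrightarrow> laplace Z \<kappa>"
proof -
  interpret Z: real_distribution Z by fact
  show ?thesis unfolding laplace_def
  proof (rule integral_dominated_convergence[where w = "\<lambda>_. 1"])
    show "AE z in Z. (\<lambda>n. exp (- k n * complex_of_real (max 0 z))) \<longlonglongrightarrow> exp (- \<kappa> * complex_of_real (max 0 z))"
      by (intro AE_I2 tendsto_intros assms)
    show "AE z in Z. norm (exp (- k n * complex_of_real (max 0 z))) \<le> 1" for n
      by (intro AE_I2 laplace_integrand_bound assms)
  qed auto
qed

context
  fixes L :: "(real ^ 'n::finite) measure" and \<gamma> :: real and Z :: "real measure"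
  assumes L: "prob_space L" and setsL: "sets L = sets borel" and Z: "zeta_infty L \<gamma> Z"
begin

lemma Z_real_distribution: "real_distribution Z"
  using Z by (simp add: zeta_infty_def real_prob_iff_real_distribution)

lemma Z_nonneg: "AE z in Z. 0 \<le> z"
proof -
  interpret Z: real_distribution Z by (rule Z_real_distribution)
  have "AE z in Z. z \<in> {0..}"
    using Z by (intro Z.AE_in_set_eq_1[THEN iffD2]) (auto simp: zeta_infty_def)
  then show ?thesis by simp
qed

lemma laplace_smoothing:
  fixes \<nu> :: "(real ^ 'n) measure" and \<kappa> :: complex
  assumes \<nu>: "prob_space \<nu>" "sets \<nu> = sets borel" "AE b in \<nu>. \<forall>i. 0 \<le> b $ i" and \<kappa>: "0 \<le> Re \<kappa>"
  shows "laplace (smoothing_law \<nu> Z) \<kappa> = (\<integral>b. (\<Prod>i\<in>UNIV. laplace Z (\<kappa> * (b $ i))) \<partial>\<nu>)"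
proof -
  interpret Z: real_distribution Z by (rule Z_real_distribution)
  interpret \<nu>: prob_space \<nu> by fact
  let ?e = "\<lambda>z. exp (- \<kappa> * complex_of_real (max 0 z))"
  have AEZ: "AE x in PiM UNIV (\<lambda>_::'n. Z). \<forall>i\<in>UNIV. 0 \<le> x i"
    by (intro AE_finite_allI AE_PiM_component Z.prob_space_axioms Z_nonneg) auto
  have "laplace (smoothing_law \<nu> Z) \<kappa> = (\<integral>b. (\<Prod>i\<in>UNIV. (\<integral>z. ?e (b $ i * z) \<partial>Z)) \<partial>\<nu>)"
    unfolding laplace_def
  proof (rule integral_smoothing_law_multiplicative[OF \<nu>(1,2) Z_real_distribution])
    show "norm (?e z) \<le> 1" for z by (rule laplace_integrand_bound[OF \<kappa>])
    show "AE b in \<nu>. AE x in PiM UNIV (\<lambda>_::'n. Z). ?e (\<Sum>i\<in>UNIV. b $ i * x i) = (\<Prod>i\<in>UNIV. ?e (b $ i * x i))"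
      using \<nu>(3)
    proof eventually_elim
      case (elim b)
      show ?case using AEZ
      proof eventually_elim
        case (elim x)
        have nn: "0 \<le> b $ i * x i" for i
          using elim \<open>\<forall>i. 0 \<le> b $ i\<close> by simp
        then have "max 0 (\<Sum>i\<in>UNIV. b $ i * x i) = (\<Sum>i\<in>UNIV. max 0 (b $ i * x i))"
          by (simp add: max_def sum_nonneg)
        then show ?case by (simp add: exp_sum sum_distrib_left flip: sum_negf)
      qed
    qed
  qed auto
  also have "\<dots> = (\<integral>b. (\<Prod>i\<in>UNIV. laplace Z (\<kappa> * (b $ i))) \<partial>\<nu>)"
  proof (rule integral_cong_AE)
    have [measurable]: "(\<lambda>b. b $ i) \<in> borel_measurable \<nu>" for i
      by (rule vec_nth_measurable_L[OF \<nu>(1,2)])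
    note [measurable] = laplace_measurable[OF Z_real_distribution]
    show "(\<lambda>b. \<Prod>i\<in>UNIV. (\<integral>z. ?e (b $ i * z) \<partial>Z)) \<in> borel_measurable \<nu>" by measurable
    show "(\<lambda>b. \<Prod>i\<in>UNIV. laplace Z (\<kappa> * (b $ i))) \<in> borel_measurable \<nu>" by measurable
    show "AE b in \<nu>. (\<Prod>i\<in>UNIV. (\<integral>z. ?e (b $ i * z) \<partial>Z)) = (\<Prod>i\<in>UNIV. laplace Z (\<kappa> * (b $ i)))"
      using \<nu>(3)
    proof eventually_elim
      case (elim b)
      have "max 0 (b $ i * z) = b $ i * max 0 z" for i z
        using elim by (simp add: max_mult_distrib_left)
      then show ?case unfolding laplace_def by (simp add: mult_ac)
    qed
  qed
  finally show ?thesis .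
qed

lemma flow_rate_measurable [measurable]: "flow_rate L \<gamma> Z \<kappa> \<in> borel_measurable borel"
proof -
  interpret L: prob_space L by (rule L)
  have [measurable]: "(\<lambda>a. a $ i) \<in> borel_measurable L" for i
    by (rule vec_nth_measurable_L[OF L setsL])
  note [measurable] = laplace_measurable[OF Z_real_distribution]
  show ?thesis unfolding flow_rate_def by measurable
qed

lemma prod_laplace_bound:
  fixes \<kappa> :: complex
  shows "0 \<le> Re \<kappa> \<Longrightarrow> (\<And>i. 0 \<le> b i) \<Longrightarrow> norm (\<Prod>i\<in>(UNIV::'n set). laplace Z (\<kappa> * complex_of_real (b i))) \<le> 1"
  unfolding prod_norm[symmetric]
  by (intro prod_le_1) (auto intro!: laplace_bound[OF Z_real_distribution])

lemma flow_rate_bound: "0 \<le> Re \<kappa> \<Longrightarrow> norm (flow_rate L \<gamma> Z \<kappa> u) \<le> 1"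
proof -
  interpret L: prob_space L by (rule L)
  assume "0 \<le> Re \<kappa>"
  then show ?thesis unfolding flow_rate_def
    using prod_laplace_bound[of \<kappa> "\<lambda>i. (_ $ i) powr \<gamma> * u powr QQ L \<gamma>"]
    by (intro L.norm_integral_le) simp
qed

text \<open>The point u = 0 is excluded because \<open>u powr QQ L \<gamma>\<close> is discontinuous
  there when the exponent is not positive.\<close>

lemma flow_rate_continuous:
  assumes \<kappa>: "0 \<le> Re \<kappa>" and u: "0 < u"
  shows "isCont (flow_rate L \<gamma> Z \<kappa>) u"
  unfolding continuous_at_sequentially
proof safe
  fix X assume X: "X \<longlonglongrightarrow> u"
  interpret L: prob_space L by (rule L)
  have [measurable]: "(\<lambda>a. a $ i) \<in> borel_measurable L" for i
    by (rule vec_nth_measurable_L[OF L setsL])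
  note [measurable] = laplace_measurable[OF Z_real_distribution]
  show "(flow_rate L \<gamma> Z \<kappa> \<circ> X) \<longlonglongrightarrow> flow_rate L \<gamma> Z \<kappa> u"
    unfolding comp_def flow_rate_def
  proof (rule integral_dominated_convergence[where w = "\<lambda>_. 1"])
    show "AE a in L. (\<lambda>n. \<Prod>i\<in>UNIV. laplace Z (\<kappa> * ((a $ i) powr \<gamma> * X n powr QQ L \<gamma>))) \<longlonglongrightarrow>
        (\<Prod>i\<in>UNIV. laplace Z (\<kappa> * ((a $ i) powr \<gamma> * u powr QQ L \<gamma>)))"
      using u \<kappa> by (intro AE_I2 tendsto_prod laplace_tendsto[OF Z_real_distribution] tendsto_intros tendsto_powr X) auto
    show "AE a in L. norm (\<Prod>i\<in>UNIV. laplace Z (\<kappa> * ((a $ i) powr \<gamma> * X n powr QQ L \<gamma>))) \<le> 1" for n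
      using prod_laplace_bound[OF \<kappa>, of "\<lambda>i. (_ $ i) powr \<gamma> * X n powr QQ L \<gamma>"] by (intro AE_I2) simp
  qed auto
qed

lemma laplace_fixed_point:
  fixes \<kappa> :: complex
  assumes \<kappa>: "0 \<le> Re \<kappa>"
  shows "laplace Z \<kappa> = (\<integral>\<tau>. indicator {0..1} \<tau> *\<^sub>R flow_rate L \<gamma> Z \<kappa> \<tau> \<partial>lborel)"
proof -
  \<comment> \<open>\<open>max 0\<close> makes the test bounded for every b, as
    \<open>integral_coeff_law\<close> demands, and changes it only on a null set.\<close>
  let ?g = "\<lambda>b::real ^ 'n. \<Prod>i\<in>UNIV. laplace Z (\<kappa> * (max 0 (b $ i)))"
  have [measurable]: "(\<lambda>b. b $ i) \<in> borel_measurable (borel :: (real ^ 'n) measure)" for i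
    by (rule vec_nth_measurable)
  note [measurable] = laplace_measurable[OF Z_real_distribution]
  have "laplace Z \<kappa> = laplace (smoothing_law (coeff_law L \<gamma> (QQ L \<gamma>)) Z) \<kappa>"
    by (simp only: zeta_infty_fixed_point[OF L setsL Z])
  also have "\<dots> = (\<integral>b. (\<Prod>i\<in>UNIV. laplace Z (\<kappa> * (b $ i))) \<partial>coeff_law L \<gamma> (QQ L \<gamma>))"
    by (rule laplace_smoothing[OF prob_space_coeff_law[OF L setsL] sets_coeff_law[OF L setsL] coeff_law_nonneg[OF L setsL] \<kappa>])
  also have "\<dots> = (\<integral>b. ?g b \<partial>coeff_law L \<gamma> (QQ L \<gamma>))"
  proof (rule integral_cong_AE)
    have m: "sets (coeff_law L \<gamma> (QQ L \<gamma>)) = sets borel" by (rule sets_coeff_law[OF L setsL])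
    have "(\<lambda>b. \<Prod>i\<in>UNIV. laplace Z (\<kappa> * (b $ i))) \<in> borel_measurable (borel :: (real ^ 'n) measure)" by measurable
    then show "(\<lambda>b. \<Prod>i\<in>UNIV. laplace Z (\<kappa> * (b $ i))) \<in> borel_measurable (coeff_law L \<gamma> (QQ L \<gamma>))"
      by (simp add: measurable_cong_sets[OF m refl])
    have "?g \<in> borel_measurable (borel :: (real ^ 'n) measure)" by measurable
    then show "?g \<in> borel_measurable (coeff_law L \<gamma> (QQ L \<gamma>))"
      by (simp add: measurable_cong_sets[OF m refl])
    show "AE b in coeff_law L \<gamma> (QQ L \<gamma>). (\<Prod>i\<in>UNIV. laplace Z (\<kappa> * (b $ i))) = ?g b"
      using coeff_law_nonneg[OF L setsL] by eventually_elim (simp add: max_absorb2)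
  qed
  also have "\<dots> = (\<integral>\<tau>. indicator {0..1} \<tau> *\<^sub>R (\<integral>a. ?g (\<chi> i. (a $ i) powr \<gamma> * \<tau> powr QQ L \<gamma>) \<partial>L) \<partial>lborel)"
  proof (rule integral_coeff_law[OF L setsL])
    show "?g \<in> borel_measurable borel" by measurable
    show "norm (?g b) \<le> 1" for b by (rule prod_laplace_bound[OF \<kappa>]) simp
  qed
  finally show ?thesis by (simp add: flow_rate_def)
qed

text \<open>Substituting u = exp t \<tau> in the fixed point equation writes the left side as exp (-
  t) times the integral of \<open>flow_rate\<close> over [0, exp t], which can be differentiated in
  t.\<close>

lemma laplace_flow_derivative:
  fixes \<kappa> :: complex
  assumes \<kappa>: "0 \<le> Re \<kappa>"
  shows "((\<lambda>t. laplace Z (\<kappa> * exp (QQ L \<gamma> * t))) has_vector_derivative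
     flow_rate L \<gamma> Z \<kappa> (exp t) - laplace Z (\<kappa> * exp (QQ L \<gamma> * t))) (at t)"
proof -
  define J where "J v = integral {0..v} (flow_rate L \<gamma> Z \<kappa>)" for v
  have int: "set_integrable lborel {0..v} (flow_rate L \<gamma> Z \<kappa>)" for v
    unfolding set_integrable_def
  proof (rule Bochner_Integration.integrable_bound[where f = "indicator {0..v} :: real \<Rightarrow> real"])
    show "AE x in lborel. norm (indicator {0..v} x *\<^sub>R flow_rate L \<gamma> Z \<kappa> x) \<le> norm (indicator {0..v} x :: real)"
      using flow_rate_bound[OF \<kappa>] by (intro AE_I2) (auto simp: indicator_def)
    show "integrable lborel (indicator {0..v} :: real \<Rightarrow> real)"
      using borel_integrable_compact[OF compact_Icc continuous_on_const, of 0 v "1::real"] by simp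
  qed auto
  have rep: "laplace Z (\<kappa> * exp (QQ L \<gamma> * t)) = exp (- t) *\<^sub>R J (exp t)" for t
  proof -
    have "J (exp t) = (\<integral>u. indicator {0..exp t} u *\<^sub>R flow_rate L \<gamma> Z \<kappa> u \<partial>lborel)"
      unfolding J_def using set_borel_integral_eq_integral(2)[OF int] by (simp add: set_lebesgue_integral_def)
    also have "\<dots> = exp t *\<^sub>R (\<integral>\<tau>. indicator {0..exp t} (0 + exp t * \<tau>) *\<^sub>R flow_rate L \<gamma> Z \<kappa> (0 + exp t * \<tau>) \<partial>lborel)"
      by (subst lborel_integral_real_affine[of "exp t" _ 0]) auto
    also have "(\<integral>\<tau>. indicator {0..exp t} (0 + exp t * \<tau>) *\<^sub>R flow_rate L \<gamma> Z \<kappa> (0 + exp t * \<tau>) \<partial>lborel) =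
        (\<integral>\<tau>. indicator {0..1} \<tau> *\<^sub>R flow_rate L \<gamma> Z (\<kappa> * exp (QQ L \<gamma> * t)) \<tau> \<partial>lborel)"
    proof (intro Bochner_Integration.integral_cong refl)
      fix \<tau> :: real
      show "indicator {0..exp t} (0 + exp t * \<tau>) *\<^sub>R flow_rate L \<gamma> Z \<kappa> (0 + exp t * \<tau>) =
          indicator {0..1} \<tau> *\<^sub>R flow_rate L \<gamma> Z (\<kappa> * exp (QQ L \<gamma> * t)) \<tau>"
      proof (cases "\<tau> \<in> {0..1}")
        case True
        have "(exp t * \<tau>) powr QQ L \<gamma> = exp (QQ L \<gamma> * t) * \<tau> powr QQ L \<gamma>"
          using True by (simp add: powr_mult exp_powr_real mult.commute)
        then have "flow_rate L \<gamma> Z \<kappa> (exp t * \<tau>) = flow_rate L \<gamma> Z (\<kappa> * exp (QQ L \<gamma> * t)) \<tau>"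
          unfolding flow_rate_def by (simp add: mult_ac exp_of_real)
        then show ?thesis using True by (simp add: indicator_def)
      next
        case False
        then have "exp t * \<tau> \<notin> {0..exp t}" by (auto simp: zero_le_mult_iff)
        then show ?thesis using False by simp
      qed
    qed
    also have "\<dots> = laplace Z (\<kappa> * exp (QQ L \<gamma> * t))"
      using \<kappa> by (intro laplace_fixed_point[symmetric]) simp
    finally show ?thesis by (simp add: exp_minus)
  qed
  have J': "(J has_vector_derivative flow_rate L \<gamma> Z \<kappa> v) (at v)" if v: "0 < v" for v
  proof -
    have i: "flow_rate L \<gamma> Z \<kappa> integrable_on {0..v + 1}"
      by (rule set_borel_integral_eq_integral(1)[OF int])
    have "((\<lambda>u. integral {0..u} (flow_rate L \<gamma> Z \<kappa>)) has_vector_derivative flow_rate L \<gamma> Z \<kappa> v) (at v within {0..v + 1} - {})"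
      using v by (intro integral_has_vector_derivative_continuous_at[OF i])
        (auto intro: continuous_at_imp_continuous_at_within flow_rate_continuous[OF \<kappa>])
    then have "((\<lambda>u. integral {0..u} (flow_rate L \<gamma> Z \<kappa>)) has_vector_derivative flow_rate L \<gamma> Z \<kappa> v) (at v within {0<..<v + 1})"
      by (rule has_vector_derivative_within_subset) auto
    then show ?thesis using v unfolding J_def by (subst (asm) at_within_open) auto
  qed
  have "((J \<circ> exp) has_vector_derivative exp t *\<^sub>R flow_rate L \<gamma> Z \<kappa> (exp t)) (at t)"
    by (rule vector_diff_chain_at[OF _ J']) (auto intro!: derivative_eq_intros simp flip: has_real_derivative_iff_has_vector_derivative)
  then have "((\<lambda>t. exp (- t) *\<^sub>R (J \<circ> exp) t) has_vector_derivative
      (exp (- t) *\<^sub>R (exp t *\<^sub>R flow_rate L \<gamma> Z \<kappa> (exp t)) + (- exp (- t)) *\<^sub>R (J \<circ> exp) t)) (at t)"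
    unfolding comp_def by (intro has_vector_derivative_scaleR) (auto intro!: derivative_eq_intros)
  moreover have "exp (- t) *\<^sub>R (exp t *\<^sub>R flow_rate L \<gamma> Z \<kappa> (exp t)) + (- exp (- t)) *\<^sub>R (J \<circ> exp) t =
      flow_rate L \<gamma> Z \<kappa> (exp t) - laplace Z (\<kappa> * exp (QQ L \<gamma> * t))"
    by (simp only: rep) (simp add: exp_minus)
  ultimately show ?thesis by (simp only: rep comp_def)
qed

text \<open>Since \<gamma> \<mu>(\<gamma>) = Q(\<gamma>), dilating V by exp (\<mu>(\<gamma>) t)
  multiplies k(\<xi>) by exp (Q(\<gamma>) t) by homogeneity; \<open>laplace_flow_derivative\<close>
  is then the evolution equation.\<close>

lemma stationary_smoothing_flow:
  fixes k :: "real \<Rightarrow> complex"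
  assumes V: "real_distribution V" and V_char: "\<And>\<xi>. char V \<xi> = laplace Z (k \<xi>)"
    and k: "\<And>\<xi>. 0 \<le> Re (k \<xi>)" "\<And>r \<xi>. 0 \<le> r \<Longrightarrow> k (r * \<xi>) = complex_of_real (r powr \<gamma>) * k \<xi>"
    and nonneg: "AE a in L. \<forall>i. 0 \<le> a $ i" and \<gamma>: "0 < \<gamma>"
  shows "smoothing_flow L (\<lambda>t. distr V borel (\<lambda>x. exp (mu L \<gamma> * t) * x))"
proof -
  interpret V: real_distribution V by fact
  interpret L: prob_space L by (rule L)
  let ?R = "\<lambda>t. distr V borel (\<lambda>x. exp (mu L \<gamma> * t) * x)"
  have R: "real_distribution (?R t)" for t
    by (rule V.real_distribution_distr) simp
  have R_char: "char (?R t) \<xi> = laplace Z (k \<xi> * exp (QQ L \<gamma> * t))" for t \<xi>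
  proof -
    have "char (?R t) \<xi> = char V (exp (mu L \<gamma> * t) * \<xi>)"
      unfolding char_def by (subst integral_distr) (auto simp: mult_ac)
    also have "\<dots> = laplace Z (complex_of_real (exp (mu L \<gamma> * t) powr \<gamma>) * k \<xi>)"
      by (simp add: V_char k(2))
    also have "exp (mu L \<gamma> * t) powr \<gamma> = exp (QQ L \<gamma> * t)"
      using \<gamma> by (simp add: exp_powr_real mu_def)
    finally show ?thesis by (simp add: mult.commute exp_of_real)
  qed
  have "char (smoothing_law L (?R t)) \<xi> = flow_rate L \<gamma> Z (k \<xi>) (exp t)" for t \<xi>
  proof -
    have [measurable]: "(\<lambda>a. a $ i) \<in> borel_measurable L" for i
      by (rule vec_nth_measurable_L[OF L setsL])
    note [measurable] = laplace_measurable[OF Z_real_distribution]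
    interpret R: real_distribution "?R t" by (rule R)
    have "char (smoothing_law L (?R t)) \<xi> = (\<integral>a. (\<Prod>i\<in>UNIV. char (?R t) (a $ i * \<xi>)) \<partial>L)"
      by (rule char_smoothing_law[OF L setsL R])
    also have "\<dots> = flow_rate L \<gamma> Z (k \<xi>) (exp t)"
      unfolding flow_rate_def
    proof (rule integral_cong_AE)
      show "AE a in L. (\<Prod>i\<in>UNIV. char (?R t) (a $ i * \<xi>)) =
          (\<Prod>i\<in>UNIV. laplace Z (k \<xi> * ((a $ i) powr \<gamma> * exp t powr QQ L \<gamma>)))"
        using nonneg
      proof eventually_elim
        case (elim a)
        have "char (?R t) (a $ i * \<xi>) = laplace Z (k \<xi> * ((a $ i) powr \<gamma> * exp t powr QQ L \<gamma>))" for i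
        proof -
          have "k (a $ i * \<xi>) * complex_of_real (exp (QQ L \<gamma> * t)) =
              k \<xi> * complex_of_real ((a $ i) powr \<gamma> * exp t powr QQ L \<gamma>)"
            using elim k(2)[of "a $ i" \<xi>] by (simp add: exp_powr_real mult.commute)
          then show ?thesis by (simp add: R_char)
        qed
        then show ?case by simp
      qed
    qed measurable
    finally show ?thesis .
  qed
  then show ?thesis
    unfolding smoothing_flow_def
    using R laplace_flow_derivative[OF k(1)] by (auto simp: R_char intro: has_vector_derivative_at_within)
qed

end

section \<open>Contraction of the Zolotarev distance\<close>

text \<open>Homogeneity of degree \<gamma> cancels the root in \<open>z powr (1 / \<gamma>)\<close>,
  leaving an exponent linear in z. \<open>H_gamma\<close> supplies the signs of the constants, hence
  Re k >= 0.\<close>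

lemma g_hat_exponent:
  assumes \<gamma>: "0 < \<gamma>" "\<gamma> \<le> 2" and H: "H_gamma \<gamma> F"
  obtains k :: "real \<Rightarrow> complex" where "\<And>\<xi>. 0 \<le> Re (k \<xi>)"
    "\<And>r \<xi>. 0 \<le> r \<Longrightarrow> k (r * \<xi>) = complex_of_real (r powr \<gamma>) * k \<xi>"
    "\<And>\<xi> z. 0 \<le> z \<Longrightarrow> g_hat \<gamma> F (\<xi> * z powr (1 / \<gamma>)) = exp (- k \<xi> * complex_of_real z)"
proof -
  consider "\<gamma> = 1" "integrable F (\<lambda>v. v)" | "\<gamma> = 1" "\<not> integrable F (\<lambda>v. v)" | "\<gamma> = 2" | "\<gamma> \<noteq> 1" "\<gamma> \<noteq> 2"
    by blast
  then show ?thesis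
  proof cases
    case 1
    show ?thesis
    proof (rule that[of "\<lambda>\<xi>. - \<i> * complex_of_real (m0 F * \<xi>)"])
      show "g_hat \<gamma> F (\<xi> * z powr (1 / \<gamma>)) = exp (- (- \<i> * complex_of_real (m0 F * \<xi>)) * complex_of_real z)"
        if "0 \<le> z" for \<xi> z
        using 1 that by (simp add: g_hat_def mult_ac)
    qed (use 1 in auto)
  next
    case 2
    obtain c where c: "0 < c" "((\<lambda>x. x * (1 - distfun F x)) \<longlongrightarrow> c) at_top"
      using H 2 unfolding H_gamma_def by auto
    \<comment> \<open>\<open>c0p\<close> is defined with x powr 1, the hypothesis with x; they agree
      for x >= 0, which suffices for the limit at infinity.\<close>
    have "((\<lambda>x. x powr 1 * (1 - distfun F x)) \<longlongrightarrow> c) at_top"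
      using c(2) by (rule Lim_transform_eventually) (auto intro: eventually_mono[OF eventually_ge_at_top[of 0]])
    then have c0p: "c0p 1 F = c"
      unfolding c0p_def by (intro tendsto_Lim) auto
    show ?thesis
    proof (rule that[of "\<lambda>\<xi>. complex_of_real (pi * c0p 1 F * \<bar>\<xi>\<bar>)"])
      show "g_hat \<gamma> F (\<xi> * z powr (1 / \<gamma>)) = exp (- complex_of_real (pi * c0p 1 F * \<bar>\<xi>\<bar>) * complex_of_real z)"
        if "0 \<le> z" for \<xi> z
        using 2 that by (simp add: g_hat_def abs_mult mult_ac exp_of_real[symmetric])
    qed (use 2 c c0p in \<open>auto simp: abs_mult\<close>)
  next
    case 3
    show ?thesis
    proof (rule that[of "\<lambda>\<xi>. complex_of_real (sigma0sq F * \<xi>\<^sup>2 / 2)"])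
      show "0 \<le> Re (complex_of_real (sigma0sq F * \<xi>\<^sup>2 / 2))" for \<xi>
        using H 3 by (simp add: H_gamma_def sigma0sq_def)
      show "complex_of_real (sigma0sq F * (r * \<xi>)\<^sup>2 / 2) = complex_of_real (r powr \<gamma>) * complex_of_real (sigma0sq F * \<xi>\<^sup>2 / 2)"
        if "0 \<le> r" for r \<xi>
        using that 3 by (cases "r = 0") (auto simp: power_mult_distrib powr_numeral)
      show "g_hat \<gamma> F (\<xi> * z powr (1 / \<gamma>)) = exp (- complex_of_real (sigma0sq F * \<xi>\<^sup>2 / 2) * complex_of_real z)"
        if z: "0 \<le> z" for \<xi> z
      proof -
        have "(\<xi> * z powr (1 / 2))\<^sup>2 = \<xi>\<^sup>2 * z"
          using z by (simp add: power_mult_distrib powr_half_sqrt)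
        then have "g_hat \<gamma> F (\<xi> * z powr (1 / \<gamma>)) = complex_of_real (exp (- (sigma0sq F * \<xi>\<^sup>2 / 2) * z))"
          using 3 by (simp add: g_hat_def mult_ac)
        then show ?thesis by (simp add: exp_of_real[symmetric])
      qed
    qed
  next
    case 4
    then have g2: "\<gamma> < 2" using \<gamma> by simp
    obtain cp cm where c: "((\<lambda>x. x powr \<gamma> * (1 - distfun F x)) \<longlongrightarrow> cp) at_top"
        "((\<lambda>x. \<bar>x\<bar> powr \<gamma> * distfun F x) \<longlongrightarrow> cm) at_bot" "0 < cp + cm"
      using H 4 unfolding H_gamma_def by auto
    have "c0p \<gamma> F = cp" "c0m \<gamma> F = cm"
      unfolding c0p_def c0m_def using c(1,2) by (auto intro!: tendsto_Lim)
    moreover have "0 < sin (pi * \<gamma> / 2)"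
      using \<gamma> g2 by (intro sin_gt_zero) auto
    ultimately have k0: "0 \<le> k0 \<gamma> F"
      unfolding k0_def using c(3) Gamma_real_pos[OF \<gamma>(1)] by (intro mult_nonneg_nonneg divide_nonneg_pos mult_pos_pos) auto
    define w where "w \<xi> = 1 - \<i> * complex_of_real (eta0 \<gamma> F * tan (pi * \<gamma> / 2) * sgn \<xi>)" for \<xi> :: real
    have g: "g_hat \<gamma> F \<xi> = exp (- complex_of_real (k0 \<gamma> F * \<bar>\<xi>\<bar> powr \<gamma>) * w \<xi>)" for \<xi>
      using 4 by (simp add: g_hat_def w_def)
    have wr: "w (r * \<xi>) = w \<xi>" "w (\<xi> * r) = w \<xi>" if "0 < r" for r \<xi>
      using that by (simp_all add: w_def sgn_mult)
    show ?thesis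
    proof (rule that[of "\<lambda>\<xi>. complex_of_real (k0 \<gamma> F * \<bar>\<xi>\<bar> powr \<gamma>) * w \<xi>"])
      show "0 \<le> Re (complex_of_real (k0 \<gamma> F * \<bar>\<xi>\<bar> powr \<gamma>) * w \<xi>)" for \<xi>
        using k0 by (simp add: w_def)
      show "complex_of_real (k0 \<gamma> F * \<bar>r * \<xi>\<bar> powr \<gamma>) * w (r * \<xi>) =
          complex_of_real (r powr \<gamma>) * (complex_of_real (k0 \<gamma> F * \<bar>\<xi>\<bar> powr \<gamma>) * w \<xi>)" if r: "0 \<le> r" for r \<xi>
        using r wr(1)[of r \<xi>] by (cases "r = 0") (auto simp: abs_mult powr_mult)
      show "g_hat \<gamma> F (\<xi> * z powr (1 / \<gamma>)) =
          exp (- (complex_of_real (k0 \<gamma> F * \<bar>\<xi>\<bar> powr \<gamma>) * w \<xi>) * complex_of_real z)" if z: "0 \<le> z" for \<xi> z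
        using z \<gamma> wr(2)[of "z powr (1 / \<gamma>)" \<xi>]
        by (cases "z = 0") (auto simp: g abs_mult powr_mult powr_powr mult_ac)
    qed
  qed
qed

section \<open>Testing the Zolotarev distance with bounded functions\<close>

lemma zolotarev_upper:
  assumes "zolotarev \<delta> P Q \<le> ereal k" and "f \<in> zol_class \<delta>" "integrable P f" "integrable Q f"
  shows "(\<integral>x. f x \<partial>P) - (\<integral>x. f x \<partial>Q) \<le> k"
proof -
  have "ereal ((\<integral>x. f x \<partial>P) - (\<integral>x. f x \<partial>Q)) \<le> zolotarev \<delta> P Q"
    unfolding zolotarev_def using assms(2-4) by (intro SUP_upper) auto
  then show ?thesis using assms(1) by (metis ereal_less_eq(3) order_trans)
qed

lemma zolotarev_nonneg: "0 \<le> zolotarev \<delta> P Q"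
proof -
  have "deriv_chain m (\<lambda>_ _. 0)" for m by (simp add: deriv_chain_def)
  then have "holder_deriv m \<alpha> 1 (\<lambda>_. 0)" for m \<alpha>
    unfolding holder_deriv_def by (intro exI[of _ "\<lambda>_ _. 0"]) auto
  then have "(\<lambda>_. 0) \<in> zol_class \<delta>" using zol_class_iff by blast
  then have "ereal ((\<integral>x. 0 \<partial>P) - (\<integral>x. 0 \<partial>Q)) \<le> zolotarev \<delta> P Q"
    unfolding zolotarev_def by (intro SUP_upper) auto
  then show ?thesis by (simp add: zero_ereal_def)
qed

lemma zolotarev_bounded_test:
  assumes m: "m = nat (\<lceil>\<delta>\<rceil> - 1)" "\<alpha> = \<delta> - real m" and \<alpha>: "0 < \<alpha>"
    and P: "real_distribution P" and Q: "real_distribution Q" and k: "zolotarev \<delta> P Q \<le> ereal k"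
    and f: "0 \<le> c" "holder_deriv m \<alpha> c f" "\<And>x. \<bar>f x\<bar> \<le> M"
  shows "(\<integral>x. f x \<partial>P) - (\<integral>x. f x \<partial>Q) \<le> c * k"
proof -
  interpret P: real_distribution P by fact
  interpret Q: real_distribution Q by fact
  have [measurable]: "f \<in> borel_measurable borel"
    using holder_deriv_continuous[OF f(2) \<alpha>] by (rule borel_measurable_continuous_onI)
  have int: "integrable P f" "integrable Q f"
    using f(3) by (auto intro!: P.integrable_const_bound[of _ M] Q.integrable_const_bound[of _ M])
  \<comment> \<open>For c = 0 normalisation by c is impossible, so every positive d >= c is used and
    then d tends to c.\<close>
  have pos: "(\<integral>x. f x \<partial>P) - (\<integral>x. f x \<partial>Q) \<le> d * k" if d: "0 < d" "c \<le> d" for d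
  proof -
    have "holder_deriv m \<alpha> 1 (\<lambda>x. 1 / d * f x)"
      using holder_deriv_affine[OF holder_deriv_mono[OF f(2) d(2)] zero_le_one \<alpha>, of "1 / d" 0] d by simp
    then have "(\<lambda>x. 1 / d * f x) \<in> zol_class \<delta>" by (simp only: zol_class_iff[OF m])
    from zolotarev_upper[OF k this] have "1 / d * (\<integral>x. f x \<partial>P) - 1 / d * (\<integral>x. f x \<partial>Q) \<le> k"
      using int by simp
    then have "((\<integral>x. f x \<partial>P) - (\<integral>x. f x \<partial>Q)) / d \<le> k" by (simp add: diff_divide_distrib)
    then show ?thesis using d by (simp add: divide_le_eq mult.commute)
  qed
  have "(\<lambda>n. (c + inverse (real (Suc n))) * k) \<longlonglongrightarrow> (c + 0) * k"
    by (intro tendsto_intros LIMSEQ_inverse_real_of_nat)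
  then have "(\<integral>x. f x \<partial>P) - (\<integral>x. f x \<partial>Q) \<le> (c + 0) * k"
    by (rule LIMSEQ_le_const) (intro exI allI impI pos, use f(1) in \<open>auto intro: add_nonneg_pos\<close>)
  then show ?thesis by simp
qed

lemma zolotarev_contraction:
  fixes L :: "(real ^ 'n::finite) measure"
  assumes L: "prob_space L" and setsL: "sets L = sets borel" and nonneg: "AE a in L. \<forall>i. 0 \<le> a $ i"
    and F0_prob: "real_prob F0" and gam: "0 < \<gamma>" "\<gamma> \<le> 2" and H: "H_gamma \<gamma> F0" and del: "\<gamma> < \<delta>"
    and Q_fin: "integrable L (\<lambda>a. \<Sum>i\<in>UNIV. (a $ i) powr \<delta>)"
    and phi_sol: "cauchy_solution L (char F0) phi"
    and V_prob: "\<And>t. t \<ge> 0 \<Longrightarrow> real_prob (V t)" and V_char: "\<And>t. t \<ge> 0 \<Longrightarrow> char (V t) = phi t"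
    and Z: "zeta_infty L \<gamma> Z" and Vinf_prob: "real_prob Vinf"
    and Vinf_char: "\<And>\<xi>. char Vinf \<xi> = (CLINT z|Z. g_hat \<gamma> F0 (\<xi> * z powr (1 / \<gamma>)))"
    and t: "0 \<le> t"
  shows "zolotarev \<delta> (distr (V t) borel (\<lambda>x. exp (- mu L \<gamma> * t) * x)) Vinf
    \<le> zolotarev \<delta> F0 Vinf * ereal (exp (- t * \<delta> * (mu L \<gamma> - mu L \<delta>)))"
proof (cases "zolotarev \<delta> F0 Vinf = \<infinity>")
  \<comment> \<open>An infinite initial distance times a positive factor is infinite, so nothing
    remains to be shown.\<close>
  case True
  then show ?thesis by simp
next
  case False
  then obtain k where k: "zolotarev \<delta> F0 Vinf = ereal k" "0 \<le> k"
    using zolotarev_nonneg[of \<delta> F0 Vinf] by (cases "zolotarev \<delta> F0 Vinf") auto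
  define m where "m = nat (\<lceil>\<delta>\<rceil> - 1)"
  define \<alpha> where "\<alpha> = \<delta> - real m"
  have \<delta>: "0 < \<delta>" using gam del by simp
  have \<alpha>: "0 < \<alpha>" "\<alpha> \<le> 1" unfolding \<alpha>_def m_def using \<delta> by linarith+
  have m\<alpha>: "real m + \<alpha> = \<delta>" by (simp add: \<alpha>_def)
  have Fd: "real_distribution F0" and Vd: "real_distribution Vinf"
    using F0_prob Vinf_prob by (simp_all add: real_prob_iff_real_distribution)
  have Vt: "real_distribution (V t)" if "0 \<le> t" for t
    using V_prob[OF that] by (simp add: real_prob_iff_real_distribution)
  have V0: "V 0 = F0"
    using phi_sol V_char[of 0] by (intro Levy_uniqueness[OF Vt Fd]) (auto simp: cauchy_solution_def)
  have flowV: "smoothing_flow L V"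
    unfolding smoothing_flow_def
  proof (intro conjI allI impI)
    fix t \<xi> :: real assume t: "0 \<le> t"
    have "((\<lambda>s. phi s \<xi>) has_vector_derivative
        ((CLINT a|L. (\<Prod>i\<in>UNIV. phi t (a $ i * \<xi>))) - phi t \<xi>)) (at t within {0..})"
      using phi_sol t by (simp add: cauchy_solution_def)
    also have "(CLINT a|L. (\<Prod>i\<in>UNIV. phi t (a $ i * \<xi>))) - phi t \<xi> =
        char (smoothing_law L (V t)) \<xi> - char (V t) \<xi>"
      by (simp add: char_smoothing_law[OF L setsL Vt[OF t]] V_char[OF t])
    finally show "((\<lambda>s. char (V s) \<xi>) has_vector_derivative
        char (smoothing_law L (V t)) \<xi> - char (V t) \<xi>) (at t within {0..})"
      by (rule has_vector_derivative_transform[rotated 2]) (use t V_char in auto)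
  qed (rule Vt)
  obtain \<kappa> :: "real \<Rightarrow> complex" where \<kappa>: "\<And>\<xi>. 0 \<le> Re (\<kappa> \<xi>)"
    "\<And>r \<xi>. 0 \<le> r \<Longrightarrow> \<kappa> (r * \<xi>) = complex_of_real (r powr \<gamma>) * \<kappa> \<xi>"
    "\<And>\<xi> z. 0 \<le> z \<Longrightarrow> g_hat \<gamma> F0 (\<xi> * z powr (1 / \<gamma>)) = exp (- \<kappa> \<xi> * complex_of_real z)"
    using g_hat_exponent[OF gam H] by blast
  interpret Z: real_distribution Z by (rule Z_real_distribution[OF L setsL Z])
  note Z0 = Z_nonneg[OF L setsL Z]
  have chi: "char Vinf \<xi> = laplace Z (\<kappa> \<xi>)" for \<xi>
  proof -
    have eq: "AE z in Z. g_hat \<gamma> F0 (\<xi> * z powr (1 / \<gamma>)) = exp (- \<kappa> \<xi> * complex_of_real (max 0 z))"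
      using Z0 by eventually_elim (simp add: \<kappa>(3) max_absorb2)
    have [measurable]: "g_hat \<gamma> F0 \<in> borel_measurable borel"
      unfolding g_hat_def by measurable
    show ?thesis
      unfolding Vinf_char laplace_def by (rule integral_cong_AE[OF _ _ eq]) measurable
  qed
  let ?R = "\<lambda>t. distr Vinf borel (\<lambda>x. exp (mu L \<gamma> * t) * x)"
  have flowR: "smoothing_flow L ?R"
    by (rule stationary_smoothing_flow[OF L setsL Z Vd chi \<kappa>(1,2) nonneg gam(1)])
  interpret Vinf: real_distribution Vinf by fact
  interpret Vt: real_distribution "V t" by (rule Vt[OF t])
  have R0: "?R 0 = Vinf" by (simp add: distr_id2)
  define s where "s = exp (- mu L \<gamma> * t)"
  let ?e = "exp (- t * \<delta> * (mu L \<gamma> - mu L \<delta>))"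
  \<comment> \<open>The substitution x -> s x costs s^\<delta> and returns the dilated limit law to
    V_infinity; s^\<delta> exp (Q(\<delta>) t) is exactly the claimed factor because Q(\<delta>) =
    \<delta> \<mu>(\<delta>).\<close>
  have contraction: "(\<integral>x. g x \<partial>distr (V t) borel (\<lambda>x. s * x)) - (\<integral>x. g x \<partial>Vinf) \<le> c * (k * ?e)"
    if g: "0 \<le> c" "holder_deriv m \<alpha> c g" "\<And>x. \<bar>g x\<bar> \<le> M" for g c M
  proof -
    have s0: "0 \<le> s" by (simp add: s_def)
    have gm [measurable]: "g \<in> borel_measurable borel"
      using holder_deriv_continuous[OF g(2) \<alpha>(1)] by (rule borel_measurable_continuous_onI)
    have h: "holder_deriv m \<alpha> (c * s powr \<delta>) (\<lambda>x. g (s * x))"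
      using holder_deriv_affine[OF g(2) s0 \<alpha>(1) zero_le_one, of 0] by (simp add: m\<alpha>)
    have "(\<integral>x. g (s * x) \<partial>V t) - (\<integral>x. g (s * x) \<partial>?R t) \<le> c * s powr \<delta> * k * exp (QQ L (real m + \<alpha>) * t)"
    proof (rule smoothing_flow_contraction[OF L setsL flowV flowR \<alpha>(1) k(2) _ nonneg _ _ h _ t])
      show "(\<integral>x. f x \<partial>V 0) - (\<integral>x. f x \<partial>?R 0) \<le> c * k"
        if "0 \<le> c" "holder_deriv m \<alpha> c f" "\<And>x. \<bar>f x\<bar> \<le> M" for f c M
        unfolding V0 R0
        by (rule zolotarev_bounded_test[OF m_def \<alpha>_def \<alpha>(1) Fd Vd _ that]) (simp add: k(1))
      show "integrable L (\<lambda>a. \<Sum>i\<in>UNIV. (a $ i) powr (real m + \<alpha>))"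
        using Q_fin by (simp add: m\<alpha>)
      show "\<bar>g (s * x)\<bar> \<le> M" for x by (rule g(3))
    qed (use g(1) in simp)
    also have "(\<integral>x. g (s * x) \<partial>?R t) = (\<integral>x. g x \<partial>Vinf)"
    proof -
      have "s * exp (mu L \<gamma> * t) = 1"
        by (simp add: s_def exp_add[symmetric])
      then have "g (s * (exp (mu L \<gamma> * t) * x)) = g x" for x
        by (simp only: mult.assoc[symmetric] mult_1)
      then show ?thesis by (subst integral_distr) simp_all
    qed
    also have "(\<integral>x. g (s * x) \<partial>V t) = (\<integral>x. g x \<partial>distr (V t) borel (\<lambda>x. s * x))"
      by (subst integral_distr) auto
    also have "c * s powr \<delta> * k * exp (QQ L (real m + \<alpha>) * t) = c * (k * ?e)"
    proof -
      have "QQ L \<delta> = \<delta> * mu L \<delta>" using \<delta> by (simp add: mu_def)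
      then have "s powr \<delta> * exp (QQ L \<delta> * t) = ?e"
        by (simp add: s_def exp_powr_real exp_add[symmetric] algebra_simps)
      then show ?thesis by (simp add: m\<alpha>)
    qed
    finally show ?thesis .
  qed
  \<comment> \<open>Removal of boundedness: the truncations are dominated by |f|, which is
    integrable under the two laws compared here, and their Hoelder constants tend to 1.\<close>
  have "(\<integral>x. f x \<partial>distr (V t) borel (\<lambda>x. s * x)) - (\<integral>x. f x \<partial>Vinf) \<le> k * ?e"
    if f: "f \<in> zol_class \<delta>" "integrable (distr (V t) borel (\<lambda>x. s * x)) f" "integrable Vinf f" for f
  proof -
    have hf: "holder_deriv m \<alpha> 1 f"
      using f(1) by (simp only: zol_class_iff[OF m_def \<alpha>_def])
    obtain C g where g: "\<And>n. n \<ge> 1 \<Longrightarrow> holder_deriv m \<alpha> (1 + C / real n) (g n)"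
      "\<And>n. n \<ge> 1 \<Longrightarrow> \<exists>B. \<forall>x. \<bar>g n x\<bar> \<le> B"
      "\<And>n x. n \<ge> 1 \<Longrightarrow> \<bar>g n x\<bar> \<le> \<bar>f x\<bar>" "\<And>x. (\<lambda>n. g n x) \<longlonglongrightarrow> f x" "0 \<le> C"
      using holder_deriv_truncation[OF \<alpha> hf] by blast
    have fm [measurable]: "f \<in> borel_measurable borel"
      using holder_deriv_continuous[OF hf \<alpha>(1)] by (rule borel_measurable_continuous_onI)
    have gm: "g (Suc n) \<in> borel_measurable borel" for n
      using holder_deriv_continuous[OF g(1)[of "Suc n"] \<alpha>(1)] by (intro borel_measurable_continuous_onI) simp
    have lim: "(\<lambda>n. \<integral>x. g (Suc n) x \<partial>Q) \<longlonglongrightarrow> (\<integral>x. f x \<partial>Q)"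
      if "sets Q = sets borel" "integrable Q f" for Q
    proof (rule integral_dominated_convergence[where w = "\<lambda>x. \<bar>f x\<bar>"])
      show "AE x in Q. (\<lambda>n. g (Suc n) x) \<longlonglongrightarrow> f x"
        using LIMSEQ_Suc[OF g(4)] by simp
      show "AE x in Q. norm (g (Suc n) x) \<le> \<bar>f x\<bar>" for n
        using g(3)[of "Suc n"] by simp
      show "g (Suc n) \<in> borel_measurable Q" "f \<in> borel_measurable Q" for n
        using gm fm by (simp_all add: measurable_cong_sets[OF that(1) refl])
    qed (use that(2) in simp)
    have "(\<lambda>n. (1 + C * inverse (real (Suc n))) * (k * ?e)) \<longlonglongrightarrow> (1 + C * 0) * (k * ?e)"
      by (intro tendsto_intros LIMSEQ_inverse_real_of_nat)
    moreover have "(\<lambda>n. (\<integral>x. g (Suc n) x \<partial>distr (V t) borel (\<lambda>x. s * x)) - (\<integral>x. g (Suc n) x \<partial>Vinf))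
        \<longlonglongrightarrow> (\<integral>x. f x \<partial>distr (V t) borel (\<lambda>x. s * x)) - (\<integral>x. f x \<partial>Vinf)"
      using f by (intro tendsto_diff lim) auto
    moreover have "(\<integral>x. g (Suc n) x \<partial>distr (V t) borel (\<lambda>x. s * x)) - (\<integral>x. g (Suc n) x \<partial>Vinf)
        \<le> (1 + C * inverse (real (Suc n))) * (k * ?e)" for n
    proof -
      obtain B where "\<And>x. \<bar>g (Suc n) x\<bar> \<le> B" using g(2)[of "Suc n"] by auto
      then show ?thesis
        using g(1)[of "Suc n"] g(5) by (intro contraction) (auto simp: divide_inverse)
    qed
    ultimately have "(\<integral>x. f x \<partial>distr (V t) borel (\<lambda>x. s * x)) - (\<integral>x. f x \<partial>Vinf) \<le> (1 + C * 0) * (k * ?e)"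
      by (intro LIMSEQ_le) auto
    then show ?thesis by simp
  qed
  then show ?thesis
    unfolding zolotarev_def[of \<delta> "distr _ _ _"] k(1) s_def[symmetric]
    by (intro SUP_least) auto
qed

section \<open>Moments of fixed points of the smoothing transform\<close>

text \<open>A Mellin weight: dilating the argument by b multiplies the integral by
  \<open>b powr p\<close>, and exp (- u z) - 1 + u z integrates to a constant times z^p for z >=
  0.\<close>

definition moment_weight :: "real \<Rightarrow> real \<Rightarrow> ennreal" where
  "moment_weight p u = ennreal (u powr (- 1 - p)) * indicator {0<..} u"

lemma moment_weight_measurable [measurable]: "moment_weight p \<in> borel_measurable borel"
  unfolding moment_weight_def by measurable

lemma moment_weight_scaling:
  assumes [measurable]: "g \<in> borel_measurable borel" and g0: "g 0 = 0" and b: "0 \<le> b"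
  shows "(\<integral>\<^sup>+u. g (u * b) * moment_weight p u \<partial>lborel) = ennreal (b powr p) * (\<integral>\<^sup>+u. g u * moment_weight p u \<partial>lborel)"
proof (cases "b = 0")
  case True
  then show ?thesis using g0 by simp
next
  case False
  then have b: "0 < b" using b by simp
  have w: "moment_weight p (b * u) = ennreal (b powr (- 1 - p)) * moment_weight p u" for u
    using b by (auto simp: moment_weight_def powr_mult ennreal_mult indicator_def zero_less_mult_iff mult_ac)
  have "(\<integral>\<^sup>+u. g u * moment_weight p u \<partial>lborel) = ennreal b * (\<integral>\<^sup>+u. g (b * u) * moment_weight p (b * u) \<partial>lborel)"
    using b by (subst nn_integral_real_affine[where c = b and t = 0]) auto
  also have "(\<integral>\<^sup>+u. g (b * u) * moment_weight p (b * u) \<partial>lborel) =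
      (\<integral>\<^sup>+u. ennreal (b powr (- 1 - p)) * (g (u * b) * moment_weight p u) \<partial>lborel)"
    unfolding w by (simp only: mult.commute mult.left_commute)
  also have "\<dots> = ennreal (b powr (- 1 - p)) * (\<integral>\<^sup>+u. g (u * b) * moment_weight p u \<partial>lborel)"
    by (rule nn_integral_cmult) measurable
  finally have eq: "(\<integral>\<^sup>+u. g u * moment_weight p u \<partial>lborel) =
      ennreal b * (ennreal (b powr (- 1 - p)) * (\<integral>\<^sup>+u. g (u * b) * moment_weight p u \<partial>lborel))" .
  have "ennreal (b powr p) * (ennreal b * ennreal (b powr (- 1 - p))) = ennreal (b powr p * (b * b powr (- 1 - p)))"
    using b by (simp add: ennreal_mult)
  also have "b powr p * (b * b powr (- 1 - p)) = b powr p * (b powr 1 * b powr (- 1 - p))"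
    using b by simp
  also have "\<dots> = 1"
    using b by (simp add: powr_add[symmetric] del: powr_one powr_one')
  finally show ?thesis
    unfolding eq by (simp add: mult.assoc[symmetric])
qed

text \<open>Near 0 the integrand is u^(1 - p), integrable because p < 2; beyond 1 it is u^(-1 -
  p).\<close>

lemma moment_weight_min_finite:
  assumes p: "1 < p" "p < 2"
  shows "(\<integral>\<^sup>+u. ennreal ((min 1 u)\<^sup>2) * moment_weight p u \<partial>lborel) < \<infinity>"
proof -
  have "(\<integral>\<^sup>+u. ennreal ((min 1 u)\<^sup>2) * moment_weight p u \<partial>lborel) \<le>
      (\<integral>\<^sup>+u. ennreal (u powr (1 - p)) * indicator {0..1} u + ennreal (u powr (- 1 - p)) * indicator {1..} u \<partial>lborel)"
  proof (rule nn_integral_mono)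
    fix u :: real
    consider "u \<le> 0" | "0 < u" "u \<le> 1" | "1 < u" by linarith
    then show "ennreal ((min 1 u)\<^sup>2) * moment_weight p u \<le>
        ennreal (u powr (1 - p)) * indicator {0..1} u + ennreal (u powr (- 1 - p)) * indicator {1..} u"
    proof cases
      case 2
      have "u\<^sup>2 * u powr (- 1 - p) = u powr 2 * u powr (- 1 - p)" using 2 by (simp add: powr_numeral)
      also have "\<dots> = u powr (1 - p)" by (subst powr_add[symmetric]) simp
      finally have "ennreal (u\<^sup>2) * ennreal (u powr (- 1 - p)) = ennreal (u powr (1 - p))"
        by (simp add: ennreal_mult[symmetric])
      then show ?thesis using 2 by (simp add: moment_weight_def min_def)
    next
      case 3
      then show ?thesis by (simp add: moment_weight_def)
    qed (simp add: moment_weight_def)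
  qed
  also have "\<dots> = (\<integral>\<^sup>+u. ennreal (u powr (1 - p)) * indicator {0..1} u \<partial>lborel) +
      (\<integral>\<^sup>+u. ennreal (u powr (- 1 - p)) * indicator {1..} u \<partial>lborel)"
    by (rule nn_integral_add) auto
  also have "\<dots> < \<infinity>"
    using nn_integral_has_integral_lebesgue'[OF _ has_integral_powr_from_0[of "1 - p" 1]]
      nn_integral_has_integral_lebesgue'[OF _ has_integral_powr_to_inf[of "- 1 - p" 1]] p
    by simp
  finally show ?thesis .
qed

text \<open>The iterates of the linear inequality satisfied by \<open>laplace_defect\<close>, started at \<open>0\<close>.\<close>
primrec branching_sum :: "(real ^ 'n::finite) measure \<Rightarrow> nat \<Rightarrow> real \<Rightarrow> ennreal" where
  "branching_sum \<nu> 0 s = 0"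
| "branching_sum \<nu> (Suc n) s =
    (\<integral>\<^sup>+b. (\<Sum>i\<in>UNIV. branching_sum \<nu> n (s * b $ i) + ennreal (real CARD('n) * (min 1 (s * b $ i))\<^sup>2)) \<partial>\<nu>)"

text \<open>The second-order remainder of the Laplace transform when Z has mean 1, written as the
  mean of a nonnegative quantity.\<close>

definition laplace_defect :: "real measure \<Rightarrow> real \<Rightarrow> real" where
  "laplace_defect Z s = (\<integral>z. exp (- (s * max 0 z)) - 1 + s * max 0 z \<partial>Z)"

text \<open>Linearises the product in the fixed point equation up to a quadratic error.\<close>

lemma prod_one_minus_le:
  assumes "finite I" "\<And>i. i \<in> I \<Longrightarrow> 0 \<le> x i" "\<And>i. i \<in> I \<Longrightarrow> x i \<le> (1::real)"
  shows "(\<Prod>i\<in>I. 1 - x i) \<le> 1 - (\<Sum>i\<in>I. x i) + (\<Sum>i\<in>I. x i)\<^sup>2"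
  using assms
proof (induction I rule: finite_induct)
  case (insert i I)
  let ?S = "\<Sum>i\<in>I. x i"
  have S: "0 \<le> ?S" using insert.prems by (intro sum_nonneg) auto
  have xi: "0 \<le> x i" "x i \<le> 1" using insert.prems by auto
  have "(\<Prod>i\<in>insert i I. 1 - x i) = (1 - x i) * (\<Prod>i\<in>I. 1 - x i)"
    using insert.hyps by simp
  also have "\<dots> \<le> (1 - x i) * (1 - ?S + ?S\<^sup>2)"
    using insert xi by (intro mult_left_mono) auto
  also have "\<dots> = 1 - (x i + ?S) + (?S\<^sup>2 + x i * ?S) - x i * ?S\<^sup>2"
    by (simp add: algebra_simps)
  also have "\<dots> \<le> 1 - (x i + ?S) + (x i + ?S)\<^sup>2"
  proof -
    have "0 \<le> x i * ?S\<^sup>2" "0 \<le> x i * ?S" "0 \<le> (x i)\<^sup>2" using xi S by auto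
    then show ?thesis unfolding power2_sum by linarith
  qed
  finally show ?case using insert.hyps by simp
qed simp

text \<open>The power p interpolates between the quadratic behaviour at 0 and the linear growth at
  infinity.\<close>

lemma exp_remainder_bounds:
  fixes u :: real
  assumes "0 \<le> u"
  shows "0 \<le> exp (- u) - 1 + u" "exp (- u) - 1 + u \<le> u" "1 \<le> p \<Longrightarrow> p \<le> 2 \<Longrightarrow> exp (- u) - 1 + u \<le> u powr p"
proof -
  show "0 \<le> exp (- u) - 1 + u" using exp_ge_add_one_self[of "- u"] by simp
  show le: "exp (- u) - 1 + u \<le> u" using assms by simp
  assume p: "1 \<le> p" "p \<le> 2"
  show "exp (- u) - 1 + u \<le> u powr p"
  proof (cases "u \<le> 1")
    case False
    then have "u powr 1 \<le> u powr p" using p by (intro powr_mono) auto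
    then show ?thesis using le False by (smt (verit) powr_one)
  next
    case True
    have "exp (- u) \<le> 1 / (1 + u)"
      using exp_ge_add_one_self[of u] assms by (simp add: exp_minus inverse_eq_divide frac_le)
    also have "\<dots> \<le> 1 - u + u\<^sup>2"
    proof -
      have "1 \<le> (1 - u + u\<^sup>2) * (1 + u)"
        using assms by (simp add: algebra_simps power2_eq_square)
      then show ?thesis using assms by (simp add: divide_le_eq)
    qed
    finally have "exp (- u) - 1 + u \<le> u\<^sup>2" by simp
    also have "u\<^sup>2 \<le> u powr p"
    proof (cases "u = 0")
      case False
      then have "u\<^sup>2 = u powr 2" using assms by (simp add: powr_numeral)
      also have "\<dots> \<le> u powr p" using True False assms p by (intro powr_mono') auto
      finally show ?thesis .
    qed simp
    finally show ?thesis .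
  qed
qed

section \<open>Moments of a fixed point whose weights sum to 1 in mean\<close>

context
  fixes \<nu> :: "(real ^ 'n::finite) measure" and Z :: "real measure" and p \<rho> :: real
  assumes \<nu>: "prob_space \<nu>" "sets \<nu> = sets borel" and nonneg: "AE b in \<nu>. \<forall>i. 0 \<le> b $ i"
    and Z: "real_distribution Z" and Z0: "AE z in Z. 0 \<le> z"
    and Zint: "integrable Z (\<lambda>z. z)" and Zmean: "(\<integral>z. z \<partial>Z) = 1"
    and fixed: "\<And>s. 0 \<le> s \<Longrightarrow> (\<integral>z. exp (- (s * max 0 z)) \<partial>Z) = (\<integral>b. (\<Prod>i\<in>UNIV. (\<integral>z. exp (- (s * b $ i * max 0 z)) \<partial>Z)) \<partial>\<nu>)"
    and p: "1 < p" "p < 2" and \<rho>: "0 \<le> \<rho>" "\<rho> < 1"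
    and H1: "(\<integral>\<^sup>+b. (\<Sum>i\<in>UNIV. ennreal (b $ i)) \<partial>\<nu>) = 1"
    and Hp: "(\<integral>\<^sup>+b. (\<Sum>i\<in>UNIV. ennreal ((b $ i) powr p)) \<partial>\<nu>) = ennreal \<rho>"
begin

interpretation \<nu>: prob_space \<nu> by (rule \<nu>)
interpretation Z: real_distribution Z by (rule Z)

lemma nth_measurable: "(\<lambda>b. b $ i) \<in> borel_measurable \<nu>"
  by (rule vec_nth_measurable_L[OF \<nu>])

lemmas [measurable] = nth_measurable

lemma branching_sum_measurable: "branching_sum \<nu> n \<in> borel_measurable borel"
proof (induction n)
  case (Suc n)
  note [measurable] = Suc
  show ?case unfolding branching_sum.simps by measurable
qed simp

lemma branching_sum_0: "branching_sum \<nu> n 0 = 0"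
  by (induction n) simp_all

text \<open>By scaling, one iteration acts on the weighted integral x as x -> \<rho> (x + c), where
  c is the weighted integral of the quadratic error.\<close>

lemma branching_sum_weighted:
  obtains B :: real where "\<And>n. (\<integral>\<^sup>+u. branching_sum \<nu> n u * moment_weight p u \<partial>lborel) \<le> ennreal B"
proof -
  let ?N = "real CARD('n)"
  let ?q = "\<lambda>u::real. ennreal (?N * (min 1 u)\<^sup>2)"
  let ?W = "\<lambda>g. (\<integral>\<^sup>+u. g u * moment_weight p u \<partial>lborel)"
  have "?W ?q = (\<integral>\<^sup>+u. ennreal ?N * (ennreal ((min 1 u)\<^sup>2) * moment_weight p u) \<partial>lborel)"
    by (simp add: ennreal_mult mult.assoc)
  also have "\<dots> = ennreal ?N * (\<integral>\<^sup>+u. ennreal ((min 1 u)\<^sup>2) * moment_weight p u \<partial>lborel)"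
    by (rule nn_integral_cmult) measurable
  also have "\<dots> < \<infinity>"
    using moment_weight_min_finite[OF p] by (simp add: ennreal_mult_less_top)
  finally obtain c where c: "?W ?q = ennreal c" "0 \<le> c"
    by (cases "?W ?q" rule: ennreal_cases) auto
  have step: "?W (branching_sum \<nu> (Suc n)) \<le> ennreal \<rho> * (?W (branching_sum \<nu> n) + ennreal c)" for n
  proof -
    note [measurable] = branching_sum_measurable
    let ?g = "\<lambda>u. branching_sum \<nu> n u + ?q u"
    interpret pr: pair_sigma_finite lborel \<nu> ..
    have g0: "?g 0 = 0" by (simp add: branching_sum_0)
    have Wg: "?W ?g = ?W (branching_sum \<nu> n) + ennreal c"
      unfolding c(1)[symmetric] distrib_right by (rule nn_integral_add) measurable
    have "?W (branching_sum \<nu> (Suc n)) = (\<integral>\<^sup>+s. (\<integral>\<^sup>+b. (\<Sum>i\<in>UNIV. ?g (s * b $ i)) * moment_weight p s \<partial>\<nu>) \<partial>lborel)"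
      unfolding branching_sum.simps by (intro nn_integral_cong nn_integral_multc[symmetric]) measurable
    also have "\<dots> = (\<integral>\<^sup>+b. (\<integral>\<^sup>+s. (\<Sum>i\<in>UNIV. ?g (s * b $ i)) * moment_weight p s \<partial>lborel) \<partial>\<nu>)"
      by (rule pr.Fubini'[symmetric]) measurable
    also have "\<dots> \<le> (\<integral>\<^sup>+b. (\<Sum>i\<in>UNIV. ennreal ((b $ i) powr p)) * ?W ?g \<partial>\<nu>)"
    proof (rule nn_integral_mono_AE)
      show "AE b in \<nu>. (\<integral>\<^sup>+s. (\<Sum>i\<in>UNIV. ?g (s * b $ i)) * moment_weight p s \<partial>lborel)
          \<le> (\<Sum>i\<in>UNIV. ennreal ((b $ i) powr p)) * ?W ?g"
        using nonneg
      proof eventually_elim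
        case (elim b)
        have "(\<integral>\<^sup>+s. (\<Sum>i\<in>UNIV. ?g (s * b $ i)) * moment_weight p s \<partial>lborel) =
            (\<Sum>i\<in>UNIV. (\<integral>\<^sup>+s. ?g (s * b $ i) * moment_weight p s \<partial>lborel))"
          unfolding sum_distrib_right by (rule nn_integral_sum) measurable
        also have "\<dots> = (\<Sum>i\<in>UNIV. ennreal ((b $ i) powr p) * ?W ?g)"
          using elim by (intro sum.cong refl moment_weight_scaling g0) auto
        finally show ?case by (simp only: sum_distrib_right order_refl)
      qed
    qed
    also have "\<dots> = (\<integral>\<^sup>+b. (\<Sum>i\<in>UNIV. ennreal ((b $ i) powr p)) \<partial>\<nu>) * ?W ?g"
      by (rule nn_integral_multc) measurable
    finally show ?thesis unfolding Hp Wg .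
  qed
  \<comment> \<open>The fixed point of x -> \<rho> (x + c).\<close>
  define B where "B = \<rho> * c / (1 - \<rho>)"
  have B: "0 \<le> B" "\<rho> * (B + c) = B"
    using \<rho> c(2) by (simp_all add: B_def field_simps)
  have "?W (branching_sum \<nu> n) \<le> ennreal B" for n
  proof (induction n)
    case (Suc n)
    have "?W (branching_sum \<nu> (Suc n)) \<le> ennreal \<rho> * (?W (branching_sum \<nu> n) + ennreal c)" by (rule step)
    also have "\<dots> \<le> ennreal \<rho> * (ennreal B + ennreal c)" by (intro mult_left_mono add_right_mono Suc) auto
    also have "\<dots> = ennreal (\<rho> * (B + c))"
      using B(1) c(2) \<rho>(1) by (simp only: ennreal_plus ennreal_mult add_nonneg_nonneg)
    finally show ?case unfolding B(2) .
  qed simp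
  then show ?thesis by (rule that)
qed

lemma branching_sum_mono: "incseq (\<lambda>n. branching_sum \<nu> n)"
proof (rule incseq_SucI, rule le_funI)
  fix n s
  show "branching_sum \<nu> n s \<le> branching_sum \<nu> (Suc n) s"
  proof (induction n arbitrary: s)
    case (Suc n)
    show ?case
      by (subst branching_sum.simps(2), subst branching_sum.simps(2))
         (intro nn_integral_mono sum_mono add_right_mono Suc)
  qed simp
qed

lemma max_integrable: "integrable Z (\<lambda>z. max 0 z)" and max_mean: "(\<integral>z. max 0 z \<partial>Z) = 1"
proof -
  show "integrable Z (\<lambda>z. max 0 z)"
    by (rule Bochner_Integration.integrable_bound[OF Zint]) auto
  have "(\<integral>z. max 0 z \<partial>Z) = (\<integral>z. z \<partial>Z)"
    by (rule integral_cong_AE) (use Z0 in \<open>auto simp: max_absorb2\<close>)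
  then show "(\<integral>z. max 0 z \<partial>Z) = 1" using Zmean by simp
qed

lemma exp_integrable: "0 \<le> s \<Longrightarrow> integrable Z (\<lambda>z. exp (- (s * max 0 z)))"
  by (rule Z.integrable_const_bound[of _ 1]) auto

lemma defect_integrable: "0 \<le> s \<Longrightarrow> integrable Z (\<lambda>z. exp (- (s * max 0 z)) - 1 + s * max 0 z)"
  using exp_integrable max_integrable by (intro Bochner_Integration.integrable_add Bochner_Integration.integrable_diff) auto

lemma laplace_defect_eq: "0 \<le> s \<Longrightarrow> (\<integral>z. exp (- (s * max 0 z)) \<partial>Z) = 1 - s + laplace_defect Z s"
  unfolding laplace_defect_def
  using exp_integrable[of s] max_integrable max_mean Z.prob_space by simp

lemma laplace_defect_measurable: "laplace_defect Z \<in> borel_measurable borel"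
  unfolding laplace_defect_def by measurable

lemma laplace_defect_bounds:
  assumes s: "0 \<le> s"
  shows "0 \<le> laplace_defect Z s" "laplace_defect Z s \<le> s" "s - laplace_defect Z s \<le> 1"
proof -
  show "0 \<le> laplace_defect Z s"
    unfolding laplace_defect_def using s by (intro integral_nonneg_AE AE_I2 exp_remainder_bounds(1)) simp
  have "laplace_defect Z s \<le> (\<integral>z. s * max 0 z \<partial>Z)"
    unfolding laplace_defect_def
    using s defect_integrable[OF s] max_integrable by (intro integral_mono exp_remainder_bounds(2)) auto
  then show "laplace_defect Z s \<le> s" using max_mean by simp
  have "0 \<le> (\<integral>z. exp (- (s * max 0 z)) \<partial>Z)" by (intro integral_nonneg_AE) auto
  then show "s - laplace_defect Z s \<le> 1" using laplace_defect_eq[OF s] by simp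
qed

text \<open>Splitting at a high level n: above it the defect is at most s z, whose mean is a small
  tail; below it the power bound applies. This excludes a linear part of the defect, which the
  iteration would not damp.\<close>

lemma laplace_defect_small:
  assumes \<epsilon>: "0 < \<epsilon>"
  obtains C where "0 \<le> C" "\<And>s. 0 \<le> s \<Longrightarrow> laplace_defect Z s \<le> \<epsilon> * s + C * s powr p"
proof -
  have "(\<lambda>n. \<integral>z. max 0 z * indicator {real n<..} z \<partial>Z) \<longlonglongrightarrow> (\<integral>z. 0 \<partial>Z)"
  proof (rule integral_dominated_convergence[where w = "\<lambda>z. max 0 z"])
    show "AE z in Z. (\<lambda>n. max 0 z * indicator {real n<..} z) \<longlonglongrightarrow> 0"
    proof (rule AE_I2)
      fix z :: real
      obtain n0 where n0: "z \<le> real n0" using real_arch_simple by blast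
      have "\<forall>\<^sub>F n in sequentially. max 0 z * indicator {real n<..} z = 0"
        using n0 by (intro eventually_sequentiallyI[of n0]) (auto simp: indicator_def)
      then show "(\<lambda>n. max 0 z * indicator {real n<..} z) \<longlonglongrightarrow> 0" by (rule tendsto_eventually)
    qed
    show "AE z in Z. norm (max 0 z * indicator {real n<..} z) \<le> max 0 z" for n
      by (auto simp: indicator_def)
  qed (use max_integrable in auto)
  then have "\<forall>\<^sub>F n in sequentially. (\<integral>z. max 0 z * indicator {real n<..} z \<partial>Z) < \<epsilon>"
    using \<epsilon> by (intro order_tendstoD(2)) auto
  then obtain n where n: "(\<integral>z. max 0 z * indicator {real n<..} z \<partial>Z) < \<epsilon>"
    by (auto dest: eventually_happens)
  have "laplace_defect Z s \<le> \<epsilon> * s + real n powr p * s powr p" if s: "0 \<le> s" for s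
  proof -
    have i: "integrable Z (\<lambda>z. max 0 z * indicator {real n<..} z)"
      by (rule Bochner_Integration.integrable_bound[OF max_integrable]) (auto simp: indicator_def)
    have "laplace_defect Z s \<le> (\<integral>z. s * (max 0 z * indicator {real n<..} z) + real n powr p * s powr p \<partial>Z)"
      unfolding laplace_defect_def
    proof (rule integral_mono)
      fix z
      show "exp (- (s * max 0 z)) - 1 + s * max 0 z \<le> s * (max 0 z * indicator {real n<..} z) + real n powr p * s powr p"
      proof (cases "real n < z")
        case True
        have "0 \<le> real n powr p * s powr p" by simp
        moreover have "exp (- (s * max 0 z)) - 1 + s * max 0 z \<le> s * max 0 z"
          using s by (intro exp_remainder_bounds(2)) simp
        moreover have ind: "indicator {real n<..} z = (1 :: real)" using True by simp
        ultimately show ?thesis unfolding ind mult_1_right by linarith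
      next
        case False
        have "exp (- (s * max 0 z)) - 1 + s * max 0 z \<le> (s * max 0 z) powr p"
          using s p by (intro exp_remainder_bounds(3)) auto
        also have "\<dots> \<le> (s * real n) powr p"
          using s p False by (intro powr_mono2 mult_left_mono) auto
        also have "\<dots> = real n powr p * s powr p" using s by (simp add: powr_mult)
        finally show ?thesis using False by simp
      qed
    qed (use defect_integrable[OF s] i in auto)
    also have "\<dots> = s * (\<integral>z. max 0 z * indicator {real n<..} z \<partial>Z) + real n powr p * s powr p"
      using i Z.prob_space by simp
    also have "\<dots> \<le> s * \<epsilon> + real n powr p * s powr p"
      using n s by (intro add_right_mono mult_left_mono) auto
    finally show ?thesis by (simp add: mult.commute)
  qed
  then show ?thesis by (intro that[of "real n powr p"]) auto
qed

text \<open>The linear terms on both sides of the fixed point equation cancel, because the weights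
  sum to 1 in mean; the defects and the quadratic error of the product remain.\<close>

lemma laplace_defect_step:
  assumes s: "0 \<le> s"
  shows "ennreal (laplace_defect Z s) \<le>
    (\<integral>\<^sup>+b. (\<Sum>i\<in>UNIV. ennreal (laplace_defect Z (s * b $ i)) + ennreal (real CARD('n) * (min 1 (s * b $ i))\<^sup>2)) \<partial>\<nu>)"
proof -
  let ?N = "real CARD('n)"
  let ?d = "laplace_defect Z"
  note [measurable] = laplace_defect_measurable
  let ?G = "\<lambda>b::real ^ 'n. \<Sum>i\<in>UNIV. ?d (s * b $ i) + ?N * (min 1 (s * b $ i))\<^sup>2"
  have bint: "integrable \<nu> (\<lambda>b. \<Sum>i\<in>UNIV. b $ i)"
    and bmean: "(\<integral>b. (\<Sum>i\<in>UNIV. b $ i) \<partial>\<nu>) = 1"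
  proof -
    have e: "(\<integral>\<^sup>+b. ennreal (\<Sum>i\<in>UNIV. b $ i) \<partial>\<nu>) = ennreal 1"
    proof -
      have "(\<integral>\<^sup>+b. ennreal (\<Sum>i\<in>UNIV. b $ i) \<partial>\<nu>) = (\<integral>\<^sup>+b. (\<Sum>i\<in>UNIV. ennreal (b $ i)) \<partial>\<nu>)"
        by (rule nn_integral_cong_AE) (use nonneg in \<open>auto elim!: eventually_mono simp: sum_ennreal\<close>)
      then show ?thesis using H1 by simp
    qed
    have nn: "AE b in \<nu>. 0 \<le> (\<Sum>i\<in>UNIV. b $ i)"
      using nonneg by eventually_elim (auto intro: sum_nonneg)
    show "integrable \<nu> (\<lambda>b. \<Sum>i\<in>UNIV. b $ i)"
      by (rule integrableI_nn_integral_finite[OF _ nn e]) measurable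
    show "(\<integral>b. (\<Sum>i\<in>UNIV. b $ i) \<partial>\<nu>) = 1"
      using integral_eq_nn_integral[OF _ nn] e by simp
  qed
  have G0: "AE b in \<nu>. 0 \<le> ?G b"
    using nonneg by eventually_elim (use s in \<open>auto intro!: sum_nonneg add_nonneg_nonneg laplace_defect_bounds\<close>)
  have Gint: "integrable \<nu> ?G"
  proof (rule Bochner_Integration.integrable_bound[where f = "\<lambda>b. s * (\<Sum>i\<in>UNIV. b $ i) + ?N * ?N"])
    show "AE b in \<nu>. norm (?G b) \<le> norm (s * (\<Sum>i\<in>UNIV. b $ i) + ?N * ?N)"
      using nonneg G0
    proof eventually_elim
      case (elim b)
      have "?G b \<le> (\<Sum>i\<in>(UNIV::'n set). s * b $ i + ?N * 1)"
      proof (intro sum_mono add_mono mult_left_mono)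
        fix i :: 'n
        have nn: "0 \<le> s * b $ i" using elim s by simp
        show "?d (s * b $ i) \<le> s * b $ i" by (rule laplace_defect_bounds(2)[OF nn])
        show "(min 1 (s * b $ i))\<^sup>2 \<le> 1" using nn by (intro power_le_one) auto
      qed simp
      also have "\<dots> = s * (\<Sum>i\<in>UNIV. b $ i) + ?N * ?N"
        by (simp add: sum.distrib sum_distrib_left)
      finally show ?case using elim by simp
    qed
  qed (use bint in auto)
  have "1 - s + ?d s = (\<integral>b. (\<Prod>i\<in>UNIV. (\<integral>z. exp (- (s * b $ i * max 0 z)) \<partial>Z)) \<partial>\<nu>)"
    using laplace_defect_eq[OF s] fixed[OF s] by simp
  also have "\<dots> \<le> (\<integral>b. 1 - s * (\<Sum>i\<in>UNIV. b $ i) + ?G b \<partial>\<nu>)"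
  proof (rule integral_mono_AE)
    show "integrable \<nu> (\<lambda>b. \<Prod>i\<in>UNIV. (\<integral>z. exp (- (s * b $ i * max 0 z)) \<partial>Z))"
    proof (rule \<nu>.integrable_const_bound[of _ 1])
      show "AE b in \<nu>. norm (\<Prod>i\<in>UNIV. (\<integral>z. exp (- (s * b $ i * max 0 z)) \<partial>Z)) \<le> 1"
        using nonneg
      proof eventually_elim
        case (elim b)
        show ?case unfolding prod_norm[symmetric]
          using elim s by (intro prod_le_1 conjI norm_ge_zero Z.norm_integral_le) auto
      qed
    qed measurable
    show "AE b in \<nu>. (\<Prod>i\<in>UNIV. (\<integral>z. exp (- (s * b $ i * max 0 z)) \<partial>Z)) \<le> 1 - s * (\<Sum>i\<in>UNIV. b $ i) + ?G b"
      using nonneg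
    proof eventually_elim
      case (elim b)
      \<comment> \<open>\<open>x i\<close> is 1 minus the Laplace transform at
        \<open>s * b $ i\<close>, hence lies between 0 and min 1 of that argument.\<close>
      define x where "x i = s * b $ i - ?d (s * b $ i)" for i
      have nn: "0 \<le> s * b $ i" for i using elim s by simp
      have x: "0 \<le> x i" "x i \<le> min 1 (s * b $ i)" for i
        using laplace_defect_bounds[OF nn[of i]] by (auto simp: x_def)
      have "(\<Prod>i\<in>UNIV. (\<integral>z. exp (- (s * b $ i * max 0 z)) \<partial>Z)) = (\<Prod>i\<in>UNIV. 1 - x i)"
        by (intro prod.cong refl) (simp add: x_def laplace_defect_eq[OF nn])
      also have "\<dots> \<le> 1 - (\<Sum>i\<in>UNIV. x i) + (\<Sum>i\<in>UNIV. x i)\<^sup>2"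
        using x by (intro prod_one_minus_le) (auto intro: order_trans)
      \<comment> \<open>Cauchy-Schwarz; this is the origin of the factor CARD('n) in
        \<open>branching_sum\<close>.\<close>
      also have "(\<Sum>i\<in>UNIV. x i)\<^sup>2 \<le> (\<Sum>i\<in>UNIV. (x i)\<^sup>2) * ?N"
        by (rule sum_squared_le_sum_of_squares)
      also have "(\<Sum>i\<in>UNIV. (x i)\<^sup>2) * ?N \<le> (\<Sum>i\<in>UNIV. (min 1 (s * b $ i))\<^sup>2) * ?N"
        using x by (intro mult_right_mono sum_mono power_mono) auto
      finally show ?case
        by (simp add: x_def sum.distrib sum_subtractf sum_distrib_left sum_distrib_right mult.commute)
    qed
  qed (use bint Gint in auto)
  also have "\<dots> = 1 - s + (\<integral>b. ?G b \<partial>\<nu>)"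
    using bint Gint bmean \<nu>.prob_space by (simp del: sum.distrib)
  finally have "?d s \<le> (\<integral>b. ?G b \<partial>\<nu>)" by simp
  then have "ennreal (?d s) \<le> ennreal (\<integral>b. ?G b \<partial>\<nu>)" by (rule ennreal_leI)
  also have "\<dots> = (\<integral>\<^sup>+b. ennreal (?G b) \<partial>\<nu>)"
    by (rule nn_integral_eq_integral[symmetric, OF Gint G0])
  also have "\<dots> = (\<integral>\<^sup>+b. (\<Sum>i\<in>UNIV. ennreal (?d (s * b $ i)) + ennreal (?N * (min 1 (s * b $ i))\<^sup>2)) \<partial>\<nu>)"
  proof (rule nn_integral_cong_AE)
    show "AE b in \<nu>. ennreal (?G b) = (\<Sum>i\<in>UNIV. ennreal (?d (s * b $ i)) + ennreal (?N * (min 1 (s * b $ i))\<^sup>2))"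
      using nonneg
    proof eventually_elim
      case (elim b)
      have nn: "0 \<le> ?d (s * b $ i)" for i using elim s by (intro laplace_defect_bounds) simp
      have "ennreal (?G b) = (\<Sum>i\<in>UNIV. ennreal (?d (s * b $ i) + ?N * (min 1 (s * b $ i))\<^sup>2))"
        using nn by (intro sum_ennreal[symmetric]) auto
      then show ?case using nn by simp
    qed
  qed
  finally show ?thesis .
qed

text \<open>Iteration starts from \<epsilon> s + C s^p: the linear part is reproduced unchanged, the
  power part shrinks by \<rho> in each step. Then n tends to infinity, and \<epsilon> to 0
  afterwards.\<close>

lemma laplace_defect_le_branching_sum:
  assumes s: "0 \<le> s"
  shows "ennreal (laplace_defect Z s) \<le> (SUP n. branching_sum \<nu> n s)"
proof -
  note [measurable] = branching_sum_measurable
  have claim: "ennreal (laplace_defect Z s) \<le> branching_sum \<nu> n s + ennreal (\<epsilon> * s + C * \<rho> ^ n * s powr p)"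
    if "0 \<le> s" and \<epsilon>: "0 < \<epsilon>" and C: "0 \<le> C" "\<And>s. 0 \<le> s \<Longrightarrow> laplace_defect Z s \<le> \<epsilon> * s + C * s powr p" for n s \<epsilon> C
    using that(1)
  proof (induction n arbitrary: s)
    case 0
    then show ?case using C(2)[of s] by (simp add: ennreal_leI)
  next
    case (Suc n)
    let ?q = "\<lambda>u::real. ennreal (real CARD('n) * (min 1 u)\<^sup>2)"
    let ?C = "C * \<rho> ^ n * s powr p"
    have C': "0 \<le> ?C" using C \<rho> by simp
    have "ennreal (laplace_defect Z s) \<le> (\<integral>\<^sup>+b. (\<Sum>i\<in>UNIV. ennreal (laplace_defect Z (s * b $ i)) + ?q (s * b $ i)) \<partial>\<nu>)"
      by (rule laplace_defect_step[OF Suc.prems])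
    also have "\<dots> \<le> (\<integral>\<^sup>+b. (\<Sum>i\<in>UNIV. branching_sum \<nu> n (s * b $ i) + ?q (s * b $ i)) +
        (ennreal (\<epsilon> * s) * (\<Sum>i\<in>UNIV. ennreal (b $ i)) + ennreal ?C * (\<Sum>i\<in>UNIV. ennreal ((b $ i) powr p))) \<partial>\<nu>)"
    proof (rule nn_integral_mono_AE)
      show "AE b in \<nu>. (\<Sum>i\<in>UNIV. ennreal (laplace_defect Z (s * b $ i)) + ?q (s * b $ i)) \<le>
        (\<Sum>i\<in>UNIV. branching_sum \<nu> n (s * b $ i) + ?q (s * b $ i)) +
        (ennreal (\<epsilon> * s) * (\<Sum>i\<in>UNIV. ennreal (b $ i)) + ennreal ?C * (\<Sum>i\<in>UNIV. ennreal ((b $ i) powr p)))"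
        using nonneg
      proof eventually_elim
        case (elim b)
        have "(\<Sum>i\<in>UNIV. ennreal (laplace_defect Z (s * b $ i)) + ?q (s * b $ i)) \<le>
          (\<Sum>i\<in>UNIV. (branching_sum \<nu> n (s * b $ i) + ?q (s * b $ i)) +
            (ennreal (\<epsilon> * s) * ennreal (b $ i) + ennreal ?C * ennreal ((b $ i) powr p)))"
        proof (rule sum_mono)
          fix i :: 'n
          have nn: "0 \<le> b $ i" "0 \<le> s * b $ i" using elim Suc.prems by auto
          have "ennreal (\<epsilon> * (s * b $ i) + C * \<rho> ^ n * (s * b $ i) powr p) =
              ennreal (\<epsilon> * s * b $ i + ?C * (b $ i) powr p)"
            using nn Suc.prems by (simp add: powr_mult mult_ac)
          also have "\<dots> = ennreal (\<epsilon> * s) * ennreal (b $ i) + ennreal ?C * ennreal ((b $ i) powr p)"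
            using nn Suc.prems \<epsilon> C' by (simp add: ennreal_mult[symmetric] ennreal_plus[symmetric] del: ennreal_plus)
          finally have eq: "ennreal (\<epsilon> * (s * b $ i) + C * \<rho> ^ n * (s * b $ i) powr p) =
              ennreal (\<epsilon> * s) * ennreal (b $ i) + ennreal ?C * ennreal ((b $ i) powr p)" .
          have "ennreal (laplace_defect Z (s * b $ i)) + ?q (s * b $ i) \<le>
              (branching_sum \<nu> n (s * b $ i) + (ennreal (\<epsilon> * s) * ennreal (b $ i) + ennreal ?C * ennreal ((b $ i) powr p))) + ?q (s * b $ i)"
            unfolding eq[symmetric] by (intro add_right_mono Suc.IH nn)
          then show "ennreal (laplace_defect Z (s * b $ i)) + ?q (s * b $ i) \<le>
              (branching_sum \<nu> n (s * b $ i) + ?q (s * b $ i)) + (ennreal (\<epsilon> * s) * ennreal (b $ i) + ennreal ?C * ennreal ((b $ i) powr p))"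
            by (simp only: add_ac)
        qed
        also have "\<dots> = (\<Sum>i\<in>UNIV. branching_sum \<nu> n (s * b $ i) + ?q (s * b $ i)) +
          (ennreal (\<epsilon> * s) * (\<Sum>i\<in>UNIV. ennreal (b $ i)) + ennreal ?C * (\<Sum>i\<in>UNIV. ennreal ((b $ i) powr p)))"
          by (simp only: sum.distrib sum_distrib_left)
        finally show ?case .
      qed
    qed
    also have "\<dots> = branching_sum \<nu> (Suc n) s + (\<integral>\<^sup>+b. ennreal (\<epsilon> * s) * (\<Sum>i\<in>UNIV. ennreal (b $ i)) +
        ennreal ?C * (\<Sum>i\<in>UNIV. ennreal ((b $ i) powr p)) \<partial>\<nu>)"
      unfolding branching_sum.simps by (rule nn_integral_add) measurable
    also have "(\<integral>\<^sup>+b. ennreal (\<epsilon> * s) * (\<Sum>i\<in>UNIV. ennreal (b $ i)) + ennreal ?C * (\<Sum>i\<in>UNIV. ennreal ((b $ i) powr p)) \<partial>\<nu>) =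
        ennreal (\<epsilon> * s) * 1 + ennreal ?C * ennreal \<rho>"
      unfolding H1[symmetric] Hp[symmetric]
      by (subst nn_integral_add) (auto simp: nn_integral_cmult)
    also have "\<dots> = ennreal (\<epsilon> * s) + ennreal (?C * \<rho>)"
      by (simp only: mult_1_right ennreal_mult[OF C' \<rho>(1)])
    also have "\<dots> = ennreal (\<epsilon> * s + ?C * \<rho>)"
      using \<epsilon> Suc.prems C(1) \<rho> by (intro ennreal_plus[symmetric] mult_nonneg_nonneg) auto
    also have "\<epsilon> * s + ?C * \<rho> = \<epsilon> * s + C * \<rho> ^ Suc n * s powr p" by simp
    finally show ?case .
  qed
  show ?thesis
  proof (rule ennreal_le_epsilon)
    fix e :: real assume e: "0 < e"
    \<comment> \<open>s + 1 rather than s, so that s = 0 is allowed and still \<epsilon> s <= e /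
      2.\<close>
    define \<epsilon> where "\<epsilon> = e / (2 * (s + 1))"
    have \<epsilon>: "0 < \<epsilon>" "\<epsilon> * s \<le> e / 2"
      using e s by (auto simp: \<epsilon>_def field_simps)
    obtain C where C: "0 \<le> C" "\<And>s. 0 \<le> s \<Longrightarrow> laplace_defect Z s \<le> \<epsilon> * s + C * s powr p"
      using laplace_defect_small[OF \<epsilon>(1)] by blast
    have "(\<lambda>n. C * \<rho> ^ n * s powr p) \<longlonglongrightarrow> C * 0 * s powr p"
      using \<rho> by (intro tendsto_intros LIMSEQ_power_zero) auto
    then have "\<forall>\<^sub>F n in sequentially. C * \<rho> ^ n * s powr p < e / 2"
      using e by (intro order_tendstoD(2)) auto
    then obtain n where n: "C * \<rho> ^ n * s powr p < e / 2"
      by (auto dest: eventually_happens)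
    have "ennreal (laplace_defect Z s) \<le> branching_sum \<nu> n s + ennreal (\<epsilon> * s + C * \<rho> ^ n * s powr p)"
      by (rule claim[OF s \<epsilon>(1) C])
    also have "\<dots> \<le> (SUP n. branching_sum \<nu> n s) + ennreal e"
      using n \<epsilon>(2) by (intro add_mono SUP_upper ennreal_leI) auto
    finally show "ennreal (laplace_defect Z s) \<le> (SUP n. branching_sum \<nu> n s) + ennreal e" .
  qed
qed

text \<open>By Tonelli and scaling, the weighted integral of the defect is E Z^p times a constant
  \<open>?c\<close>. It is bounded by the supremum of the weighted integrals of
  \<open>branching_sum\<close>, which are bounded uniformly in n.\<close>

lemma smoothing_fixed_point_moment: "integrable Z (\<lambda>z. z powr p)"
proof -
  note [measurable] = branching_sum_measurable laplace_defect_measurable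
  obtain B where B: "\<And>n. (\<integral>\<^sup>+u. branching_sum \<nu> n u * moment_weight p u \<partial>lborel) \<le> ennreal B"
    using branching_sum_weighted by blast
  let ?g = "\<lambda>u::real. ennreal (exp (- u) - 1 + u)"
  let ?c = "\<integral>\<^sup>+u. ?g u * moment_weight p u \<partial>lborel"
  have "?c * (\<integral>\<^sup>+z. ennreal (max 0 z powr p) \<partial>Z) = (\<integral>\<^sup>+z. ?c * ennreal (max 0 z powr p) \<partial>Z)"
    by (rule nn_integral_cmult[symmetric]) measurable
  also have "\<dots> = (\<integral>\<^sup>+z. (\<integral>\<^sup>+s. ?g (s * max 0 z) * moment_weight p s \<partial>lborel) \<partial>Z)"
    by (intro nn_integral_cong) (subst moment_weight_scaling, auto simp: mult.commute)
  also have "\<dots> = (\<integral>\<^sup>+s. (\<integral>\<^sup>+z. ?g (s * max 0 z) * moment_weight p s \<partial>Z) \<partial>lborel)"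
  proof -
    interpret pr: pair_sigma_finite Z lborel ..
    show ?thesis by (rule pr.Fubini'[symmetric]) measurable
  qed
  also have "\<dots> = (\<integral>\<^sup>+s. ennreal (laplace_defect Z s) * moment_weight p s \<partial>lborel)"
  proof (rule nn_integral_cong)
    fix s :: real
    show "(\<integral>\<^sup>+z. ?g (s * max 0 z) * moment_weight p s \<partial>Z) = ennreal (laplace_defect Z s) * moment_weight p s"
    proof (cases "0 < s")
      case True
      have "(\<integral>\<^sup>+z. ?g (s * max 0 z) \<partial>Z) = ennreal (laplace_defect Z s)"
        unfolding laplace_defect_def using True
        by (intro nn_integral_eq_integral defect_integrable AE_I2 exp_remainder_bounds(1)) auto
      then show ?thesis by (subst nn_integral_multc) auto
    qed (simp add: moment_weight_def)
  qed
  also have "\<dots> \<le> (\<integral>\<^sup>+s. (SUP n. branching_sum \<nu> n s * moment_weight p s) \<partial>lborel)"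
  proof (rule nn_integral_mono)
    fix s :: real
    show "ennreal (laplace_defect Z s) * moment_weight p s \<le> (SUP n. branching_sum \<nu> n s * moment_weight p s)"
    proof (cases "0 < s")
      case True
      have "ennreal (laplace_defect Z s) * moment_weight p s \<le> (SUP n. branching_sum \<nu> n s) * moment_weight p s"
        using True by (intro mult_right_mono laplace_defect_le_branching_sum) auto
      then show ?thesis by (simp add: SUP_mult_right_ennreal)
    qed (simp add: moment_weight_def)
  qed
  also have "\<dots> = (SUP n. \<integral>\<^sup>+s. branching_sum \<nu> n s * moment_weight p s \<partial>lborel)"
  proof (rule nn_integral_monotone_convergence_SUP)
    show "incseq (\<lambda>n s. branching_sum \<nu> n s * moment_weight p s)"
      using branching_sum_mono by (auto simp: incseq_def le_fun_def intro!: mult_right_mono)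
  qed measurable
  also have "\<dots> \<le> ennreal B" by (intro SUP_least B)
  finally have fin: "?c * (\<integral>\<^sup>+z. ennreal (max 0 z powr p) \<partial>Z) \<le> ennreal B" .
  \<comment> \<open>Positivity of \<open>?c\<close>, without which an infinite moment could hide: on
    [1, 2] one has exp (- u) - 1 + u >= exp (- u) >= exp (- 2).\<close>
  have "0 < ennreal (exp (- 2) * 2 powr (- 1 - p))" by simp
  also have "ennreal (exp (- 2) * 2 powr (- 1 - p)) = (\<integral>\<^sup>+u. ennreal (exp (- 2) * 2 powr (- 1 - p)) * indicator {1..2::real} u \<partial>lborel)"
    by (simp add: nn_integral_cmult_indicator)
  also have "\<dots> \<le> ?c"
  proof (rule nn_integral_mono)
    fix u :: real
    show "ennreal (exp (- 2) * 2 powr (- 1 - p)) * indicator {1..2} u \<le> ?g u * moment_weight p u"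
    proof (cases "u \<in> {1..2}")
      case True
      have "exp (- 2) * 2 powr (- 1 - p) \<le> (exp (- u) - 1 + u) * u powr (- 1 - p)"
      proof (intro mult_mono powr_mono2')
        have "exp (- 2) \<le> exp (- u)" "1 \<le> u" using True by auto
        then show "exp (- 2) \<le> exp (- u) - 1 + u" by linarith
        show "0 \<le> exp (- u) - 1 + u" using True exp_remainder_bounds(1)[of u] by simp
      qed (use True p in auto)
      then show ?thesis
        using True exp_remainder_bounds(1)[of u] by (simp add: moment_weight_def ennreal_mult[symmetric] ennreal_leI)
    qed simp
  qed
  finally have "0 < ?c" .
  then have "?c * \<infinity> = \<infinity>" by (simp add: ennreal_mult_top)
  then have "(\<integral>\<^sup>+z. ennreal (max 0 z powr p) \<partial>Z) \<noteq> \<infinity>"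
    using fin by (metis ennreal_less_top infinity_ennreal_def not_le)
  then have "(\<integral>\<^sup>+z. ennreal (max 0 z powr p) \<partial>Z) < \<infinity>"
    by (simp add: less_top)
  then have "integrable Z (\<lambda>z. max 0 z powr p)"
    by (intro integrableI_nonneg) auto
  moreover have "AE z in Z. max 0 z powr p = z powr p"
    using Z0 by eventually_elim (simp add: max_absorb2)
  ultimately show ?thesis
    by (subst integrable_cong_AE[of "\<lambda>z. z powr p" Z "\<lambda>z. max 0 z powr p"]) (auto elim: eventually_mono)
qed

end

section \<open>The case of finite variance\<close>

text \<open>By independence the integral of \<tau>^(Q r) over [0, 1], equal to 1 / (1 + Q r), splits
  off from Q(\<gamma> r) + 1. For r = 1 and Q = Q(\<gamma>) the value is 1.\<close>

lemma coeff_law_moment: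
  fixes L :: "(real ^ 'n::finite) measure"
  assumes L: "prob_space L" and setsL: "sets L = sets borel"
    and \<gamma>: "0 < \<gamma>" and r: "0 < r" "0 < 1 + Q * r"
    and int: "integrable L (\<lambda>a. \<Sum>i\<in>UNIV. (a $ i) powr (\<gamma> * r))"
  shows "(\<integral>\<^sup>+b. (\<Sum>i\<in>UNIV. ennreal ((b $ i) powr r)) \<partial>coeff_law L \<gamma> Q) = ennreal ((QQ L (\<gamma> * r) + 1) / (1 + Q * r))"
proof -
  interpret L: prob_space L by (rule L)
  interpret U: prob_space unit_uniform by (rule prob_space_unit_uniform)
  interpret UL: pair_prob_space unit_uniform L ..
  have [measurable]: "(\<lambda>a. a $ i) \<in> borel_measurable (borel :: (real ^ 'n) measure)" for i
    by (rule vec_nth_measurable)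
  have [measurable]: "(\<lambda>a. a $ i) \<in> borel_measurable L" for i
    by (rule vec_nth_measurable_L[OF L setsL])
  let ?S = "\<lambda>a::real ^ 'n. \<Sum>i\<in>UNIV. (a $ i) powr (\<gamma> * r)"
  have "(\<integral>\<^sup>+b. (\<Sum>i\<in>UNIV. ennreal ((b $ i) powr r)) \<partial>coeff_law L \<gamma> Q) =
      (\<integral>\<^sup>+q. (\<Sum>i\<in>UNIV. ennreal (((snd q $ i) powr \<gamma> * fst q powr Q) powr r)) \<partial>(unit_uniform \<Otimes>\<^sub>M L))"
    unfolding coeff_law_def
    by (subst nn_integral_distr[OF coeff_measurable[OF L setsL]]) (simp_all add: split_beta')
  also have "\<dots> = (\<integral>\<^sup>+q. ennreal (fst q powr (Q * r)) * ennreal (?S (snd q)) \<partial>(unit_uniform \<Otimes>\<^sub>M L))"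
  proof (rule nn_integral_cong)
    fix q :: "real \<times> (real ^ 'n)"
    have "(\<Sum>i\<in>UNIV. ennreal (((snd q $ i) powr \<gamma> * fst q powr Q) powr r)) =
        (\<Sum>i\<in>UNIV. ennreal (fst q powr (Q * r) * (snd q $ i) powr (\<gamma> * r)))"
      by (simp add: powr_mult powr_powr mult.commute)
    also have "\<dots> = ennreal (\<Sum>i\<in>UNIV. fst q powr (Q * r) * (snd q $ i) powr (\<gamma> * r))"
      by (rule sum_ennreal) simp
    also have "\<dots> = ennreal (fst q powr (Q * r)) * ennreal (?S (snd q))"
      unfolding sum_distrib_left[symmetric] by (intro ennreal_mult sum_nonneg) auto
    finally show "(\<Sum>i\<in>UNIV. ennreal (((snd q $ i) powr \<gamma> * fst q powr Q) powr r)) =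
        ennreal (fst q powr (Q * r)) * ennreal (?S (snd q))" .
  qed
  also have "\<dots> = (\<integral>\<^sup>+\<tau>. (\<integral>\<^sup>+a. ennreal (\<tau> powr (Q * r)) * ennreal (?S a) \<partial>L) \<partial>unit_uniform)"
    by (subst L.nn_integral_fst[symmetric]) auto
  also have "\<dots> = (\<integral>\<^sup>+\<tau>. ennreal (\<tau> powr (Q * r)) * (\<integral>\<^sup>+a. ennreal (?S a) \<partial>L) \<partial>unit_uniform)"
    by (intro nn_integral_cong nn_integral_cmult) measurable
  also have "\<dots> = (\<integral>\<^sup>+\<tau>. ennreal (\<tau> powr (Q * r)) \<partial>unit_uniform) * (\<integral>\<^sup>+a. ennreal (?S a) \<partial>L)"
    by (rule nn_integral_multc) measurable
  also have "(\<integral>\<^sup>+a. ennreal (?S a) \<partial>L) = ennreal (QQ L (\<gamma> * r) + 1)"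
    unfolding QQ_def using int by (subst nn_integral_eq_integral) (auto intro!: sum_nonneg)
  also have "(\<integral>\<^sup>+\<tau>. ennreal (\<tau> powr (Q * r)) \<partial>unit_uniform) = (\<integral>\<^sup>+\<tau>. ennreal (\<tau> powr (Q * r)) * indicator {0..1} \<tau> \<partial>lborel)"
    unfolding unit_uniform_def by (subst nn_integral_density) (auto simp: mult.commute)
  also have "\<dots> = ennreal (1 powr (Q * r + 1) / (Q * r + 1))"
    using r by (intro nn_integral_has_integral_lebesgue' has_integral_powr_from_0) auto
  also have "ennreal (1 powr (Q * r + 1) / (Q * r + 1)) * ennreal (QQ L (\<gamma> * r) + 1) =
      ennreal ((QQ L (\<gamma> * r) + 1) / (1 + Q * r))"
  proof -
    have "0 \<le> QQ L (\<gamma> * r) + 1"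
      unfolding QQ_def by (simp add: integral_nonneg_AE sum_nonneg)
    then show ?thesis using r by (simp add: ennreal_mult[symmetric] add.commute)
  qed
  finally show ?thesis .
qed

text \<open>Otherwise the sum of the powers would vanish almost surely, and with it all
  coefficients, against a mean number of positive ones above 1.\<close>

lemma QQ_gt_minus_one:
  fixes L :: "(real ^ 'n::finite) measure"
  assumes nonneg: "AE a in L. \<forall>i. 0 \<le> a $ i" and A2: "(\<integral>a. real (card {i. 0 < a $ i}) \<partial>L) > 1"
    and int: "integrable L (\<lambda>a. \<Sum>i\<in>UNIV. (a $ i) powr s)"
  shows "- 1 < QQ L s"
proof (rule ccontr)
  assume "\<not> - 1 < QQ L s"
  then have "(\<integral>a. (\<Sum>i\<in>UNIV. (a $ i) powr s) \<partial>L) \<le> 0" by (simp add: QQ_def)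
  moreover have "0 \<le> (\<integral>a. (\<Sum>i\<in>UNIV. (a $ i) powr s) \<partial>L)"
    by (intro integral_nonneg_AE AE_I2 sum_nonneg) simp
  ultimately have "(\<integral>a. (\<Sum>i\<in>UNIV. (a $ i) powr s) \<partial>L) = 0" by simp
  then have "AE a in L. (\<Sum>i\<in>UNIV. (a $ i) powr s) = 0"
    using int by (subst (asm) integral_nonneg_eq_0_iff_AE) (auto intro!: AE_I2 sum_nonneg)
  then have "AE a in L. real (card {i. 0 < a $ i}) = 0"
    by eventually_elim (auto simp: sum_nonneg_eq_0_iff)
  then have "(\<integral>a. real (card {i. 0 < a $ i}) \<partial>L) = 0" by (rule integral_eq_zero_AE)
  then show False using A2 by simp
qed

lemma laplace_of_real:
  "laplace Z (complex_of_real s) = complex_of_real (\<integral>z. exp (- (s * max 0 z)) \<partial>Z)"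
  unfolding laplace_def integral_complex_of_real[symmetric] by (simp flip: exp_of_real)

text \<open>With exponent \<delta> / \<gamma>, between 1 and 2, the contraction factor is \<rho> =
  (Q(\<delta>) + 1) / (1 + Q(\<gamma>) \<delta> / \<gamma>). Since both terms are positive, \<rho> <
  1 means Q(\<delta>) / \<delta> < Q(\<gamma>) / \<gamma>.\<close>

lemma zeta_infty_moment:
  fixes L :: "(real ^ 'n::finite) measure"
  assumes L: "prob_space L" and setsL: "sets L = sets borel" and nonneg: "AE a in L. \<forall>i. 0 \<le> a $ i"
    and A2: "(\<integral>a. real (card {i. 0 < a $ i}) \<partial>L) > 1"
    and \<gamma>: "0 < \<gamma>" and \<delta>: "\<gamma> < \<delta>" "\<delta> < 2 * \<gamma>"
    and Q_fin: "integrable L (\<lambda>a. \<Sum>i\<in>UNIV. (a $ i) powr \<gamma>)" "integrable L (\<lambda>a. \<Sum>i\<in>UNIV. (a $ i) powr \<delta>)"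
    and mu_lt: "mu L \<delta> < mu L \<gamma>" and Z: "zeta_infty L \<gamma> Z"
  shows "integrable Z (\<lambda>z. z powr (\<delta> / \<gamma>))"
proof -
  let ?Q = "QQ L \<gamma>" and ?p = "\<delta> / \<gamma>"
  let ?\<nu> = "coeff_law L \<gamma> (QQ L \<gamma>)"
  define \<rho> where "\<rho> = (QQ L \<delta> + 1) / (1 + ?Q * ?p)"
  have Q1: "- 1 < ?Q" "- 1 < QQ L \<delta>"
    using QQ_gt_minus_one[OF nonneg A2] Q_fin by auto
  have lt: "QQ L \<delta> < ?Q * ?p"
    using mu_lt \<gamma> \<delta> by (simp add: mu_def field_simps)
  have p: "1 < ?p" "?p < 2" using \<gamma> \<delta> by (auto simp: field_simps)
  have \<rho>: "0 \<le> \<rho>" "\<rho> < 1" unfolding \<rho>_def using Q1 lt by (auto simp: divide_less_eq)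
  have Zd: "real_distribution Z" by (rule Z_real_distribution[OF L setsL Z])
  interpret \<nu>: prob_space ?\<nu> by (rule prob_space_coeff_law[OF L setsL])
  note \<nu> = prob_space_coeff_law[OF L setsL, of \<gamma> ?Q] sets_coeff_law[OF L setsL, of \<gamma> ?Q]
  note \<nu>0 = coeff_law_nonneg[OF L setsL, of \<gamma> ?Q]
  show ?thesis
  proof (rule smoothing_fixed_point_moment[OF \<nu> \<nu>0 Zd Z_nonneg[OF L setsL Z] _ _ _ p \<rho>])
    show "integrable Z (\<lambda>z. z)" "(\<integral>z. z \<partial>Z) = 1" using Z by (simp_all add: zeta_infty_def)
    show "(\<integral>z. exp (- (s * max 0 z)) \<partial>Z) = (\<integral>b. (\<Prod>i\<in>UNIV. (\<integral>z. exp (- (s * b $ i * max 0 z)) \<partial>Z)) \<partial>?\<nu>)"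
      if s: "0 \<le> s" for s
    proof -
      have "complex_of_real (\<integral>z. exp (- (s * max 0 z)) \<partial>Z) = laplace (smoothing_law ?\<nu> Z) (complex_of_real s)"
        by (simp only: laplace_of_real[symmetric] zeta_infty_fixed_point[OF L setsL Z])
      also have "\<dots> = (\<integral>b. (\<Prod>i\<in>UNIV. laplace Z (complex_of_real s * complex_of_real (b $ i))) \<partial>?\<nu>)"
        using s by (intro laplace_smoothing[OF L setsL Z \<nu> \<nu>0]) simp
      also have "\<dots> = complex_of_real (\<integral>b. (\<Prod>i\<in>UNIV. (\<integral>z. exp (- (s * b $ i * max 0 z)) \<partial>Z)) \<partial>?\<nu>)"
        unfolding of_real_mult[symmetric] laplace_of_real of_real_prod[symmetric] integral_complex_of_real ..
      finally show ?thesis unfolding of_real_eq_iff .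
    qed
    have "(\<integral>\<^sup>+b. (\<Sum>i\<in>UNIV. ennreal ((b $ i) powr 1)) \<partial>?\<nu>) = ennreal ((QQ L (\<gamma> * 1) + 1) / (1 + ?Q * 1))"
      by (rule coeff_law_moment[OF L setsL \<gamma>]) (use Q1 Q_fin in auto)
    moreover have "(\<integral>\<^sup>+b. (\<Sum>i\<in>UNIV. ennreal ((b $ i) powr 1)) \<partial>?\<nu>) = (\<integral>\<^sup>+b. (\<Sum>i\<in>UNIV. ennreal (b $ i)) \<partial>?\<nu>)"
      by (rule nn_integral_cong_AE) (use \<nu>0 in \<open>eventually_elim, simp\<close>)
    moreover have "(QQ L (\<gamma> * 1) + 1) / (1 + ?Q * 1) = 1" using Q1 by simp
    ultimately show "(\<integral>\<^sup>+b. (\<Sum>i\<in>UNIV. ennreal (b $ i)) \<partial>?\<nu>) = 1"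
      by (simp only: ennreal_1)
    have "(\<integral>\<^sup>+b. (\<Sum>i\<in>UNIV. ennreal ((b $ i) powr ?p)) \<partial>?\<nu>) = ennreal ((QQ L (\<gamma> * ?p) + 1) / (1 + ?Q * ?p))"
      by (rule coeff_law_moment[OF L setsL \<gamma>]) (use p Q1 lt Q_fin \<gamma> in auto)
    then show "(\<integral>\<^sup>+b. (\<Sum>i\<in>UNIV. ennreal ((b $ i) powr ?p)) \<partial>?\<nu>) = ennreal \<rho>"
      using \<gamma> by (simp add: \<rho>_def)
  qed
qed

section \<open>Gaussian scale mixtures\<close>

lemma product_integral:
  fixes a :: "'a \<Rightarrow> real" and b :: "'b \<Rightarrow> real"
  assumes "sigma_finite_measure M1" "sigma_finite_measure M2" and a: "integrable M1 a" and b: "integrable M2 b"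
  shows "integrable (M1 \<Otimes>\<^sub>M M2) (\<lambda>(x, y). a x * b y)"
    and "(\<integral>q. (\<lambda>(x, y). a x * b y) q \<partial>(M1 \<Otimes>\<^sub>M M2)) = (\<integral>x. a x \<partial>M1) * (\<integral>y. b y \<partial>M2)"
proof -
  interpret M1: sigma_finite_measure M1 by fact
  interpret M2: sigma_finite_measure M2 by fact
  interpret pair_sigma_finite M1 M2 ..
  note [measurable] = borel_measurable_integrable[OF a] borel_measurable_integrable[OF b]
  show int: "integrable (M1 \<Otimes>\<^sub>M M2) (\<lambda>(x, y). a x * b y)"
    by (rule Fubini_integrable) (use a b in \<open>auto simp: abs_mult\<close>)
  show "(\<integral>q. (\<lambda>(x, y). a x * b y) q \<partial>(M1 \<Otimes>\<^sub>M M2)) = (\<integral>x. a x \<partial>M1) * (\<integral>y. b y \<partial>M2)"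
    using integral_fst'[OF int] by simp
qed

text \<open>V is realised as sqrt (v Z) times an independent standard normal variable, identified by
  its characteristic function; each moment then factorises. A moment of order \<delta> / 2 of Z
  yields one of order \<delta> of V.\<close>

lemma gaussian_mixture_moments:
  assumes V: "real_distribution V" and Z: "real_distribution Z" and Z0: "AE z in Z. 0 \<le> z"
    and Zint: "integrable Z (\<lambda>z. z)" and Zmean: "(\<integral>z. z \<partial>Z) = 1"
    and V_char: "\<And>\<xi>. char V \<xi> = (CLINT z|Z. complex_of_real (exp (- v * (\<xi> * z powr (1 / 2))\<^sup>2 / 2)))"
    and v: "0 \<le> v" and \<delta>: "0 < \<delta>" "integrable Z (\<lambda>z. z powr (\<delta> / 2))"
  shows "integrable V (\<lambda>x. \<bar>x\<bar> powr \<delta>)" "integrable V (\<lambda>x. x)" "(\<integral>x. x \<partial>V) = 0"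
    "integrable V (\<lambda>x. x\<^sup>2)" "(\<integral>x. x\<^sup>2 \<partial>V) = v"
proof -
  let ?N = std_normal_distribution
  interpret V: real_distribution V by fact
  interpret Z: real_distribution Z by fact
  interpret N: real_distribution ?N by (rule real_dist_normal_dist)
  interpret ZN: pair_prob_space Z ?N ..
  let ?X = "\<lambda>(z, g). sqrt v * (max 0 z powr (1 / 2)) * g"
  have Xm [measurable]: "?X \<in> borel_measurable (Z \<Otimes>\<^sub>M ?N)" by measurable
  define W where "W = distr (Z \<Otimes>\<^sub>M ?N) borel ?X"
  have Wd: "real_distribution W"
  proof -
    interpret prob_space W unfolding W_def by (rule ZN.P.prob_space_distr[OF Xm])
    show ?thesis by unfold_locales (simp add: W_def)
  qed
  have "char W = char V"
  proof
    fix \<xi>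
    have int: "integrable (Z \<Otimes>\<^sub>M ?N) (\<lambda>q. iexp (\<xi> * ?X q))"
      by (rule ZN.P.integrable_const_bound[of _ 1]) auto
    have "char W \<xi> = (\<integral>q. iexp (\<xi> * ?X q) \<partial>(Z \<Otimes>\<^sub>M ?N))"
      unfolding char_def W_def by (subst integral_distr) auto
    also have "\<dots> = (\<integral>z. (\<integral>g. iexp (\<xi> * ?X (z, g)) \<partial>?N) \<partial>Z)"
      by (rule ZN.integral_fst'[OF int, symmetric])
    also have "\<dots> = (\<integral>z. char ?N (\<xi> * (sqrt v * max 0 z powr (1 / 2))) \<partial>Z)"
      unfolding char_def by (simp only: prod.case mult.assoc)
    also have "\<dots> = (\<integral>z. complex_of_real (exp (- v * (\<xi> * z powr (1 / 2))\<^sup>2 / 2)) \<partial>Z)"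
    proof (rule integral_cong_AE)
      show "AE z in Z. char ?N (\<xi> * (sqrt v * max 0 z powr (1 / 2))) = complex_of_real (exp (- v * (\<xi> * z powr (1 / 2))\<^sup>2 / 2))"
        using Z0
      proof eventually_elim
        case (elim z)
        have "(\<xi> * (sqrt v * w))\<^sup>2 = v * (\<xi> * w)\<^sup>2" for w
          using v by (simp add: power_mult_distrib)
        then show ?case using elim by (simp only: char_std_normal_distribution max_absorb2 mult_minus_left)
      qed
      have "(\<lambda>z. \<xi> * (sqrt v * max 0 z powr (1 / 2))) \<in> borel_measurable Z" by measurable
      then show "(\<lambda>z. char ?N (\<xi> * (sqrt v * max 0 z powr (1 / 2)))) \<in> borel_measurable Z"
        by (rule measurable_compose[OF _ N.char_measurable])
      show "(\<lambda>z. complex_of_real (exp (- v * (\<xi> * z powr (1 / 2))\<^sup>2 / 2))) \<in> borel_measurable Z"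
        by measurable
    qed
    also have "\<dots> = char V \<xi>" by (rule V_char[symmetric])
    finally show "char W \<xi> = char V \<xi>" .
  qed
  then have W: "W = V" by (rule Levy_uniqueness[OF Wd V])
  have sf: "sigma_finite_measure Z" "sigma_finite_measure ?N"
    by (simp_all add: Z.sigma_finite_measure_axioms N.sigma_finite_measure_axioms)
  have N_int: "integrable ?N (\<lambda>g. g ^ k)" for k
    using integrable_std_normal_moment[of k] by (subst integrable_density) auto
  have N_moment: "(\<integral>g. g ^ k \<partial>?N) = (\<integral>g. std_normal_density g * g ^ k \<partial>lborel)" for k
    by (subst integral_density) auto
  \<comment> \<open>All functions needed (x, its square and |x|^\<delta>) split on the product into
    a factor in z and one in g.\<close>
  have transfer: "integrable V f" "(\<integral>x. f x \<partial>V) = (\<integral>z. a z \<partial>Z) * (\<integral>g. b g \<partial>?N)"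
    if f [measurable]: "f \<in> borel_measurable borel" and ab: "integrable Z a" "integrable ?N b"
      and eq: "\<And>z g. f (sqrt v * (max 0 z powr (1 / 2)) * g) = a z * b g" for f a b :: "real \<Rightarrow> real"
  proof -
    have "f (?X q) = (\<lambda>(z, g). a z * b g) q" for q
      using eq by (cases q) simp
    then show "integrable V f" "(\<integral>x. f x \<partial>V) = (\<integral>z. a z \<partial>Z) * (\<integral>g. b g \<partial>?N)"
      using product_integral[OF sf ab] unfolding W[symmetric] W_def
      by (simp_all only: integrable_distr_eq[OF Xm f] integral_distr[OF Xm f])
  qed
  have half: "integrable Z (\<lambda>z. max 0 z powr (1 / 2))"
  proof (rule Bochner_Integration.integrable_bound[where f = "\<lambda>z. 1 + z"])
    show "integrable Z (\<lambda>z. 1 + z)"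
      by (intro Bochner_Integration.integrable_add Z.integrable_const Zint)
    show "(\<lambda>z. max 0 z powr (1 / 2)) \<in> borel_measurable Z" by measurable
    show "AE z in Z. norm (max 0 z powr (1 / 2)) \<le> norm (1 + z)"
      using Z0
    proof eventually_elim
      case (elim z)
      have "sqrt z \<le> 1 + z"
        using elim by (intro real_le_lsqrt) (auto simp: power2_sum)
      then show ?case using elim by (simp add: max_absorb2 powr_half_sqrt)
    qed
  qed
  have max1: "integrable Z (\<lambda>z. max 0 z)" "(\<integral>z. max 0 z \<partial>Z) = 1"
  proof -
    show "integrable Z (\<lambda>z. max 0 z)"
      by (rule Bochner_Integration.integrable_bound[OF Zint]) auto
    have "(\<integral>z. max 0 z \<partial>Z) = (\<integral>z. z \<partial>Z)"
      by (rule integral_cong_AE) (use Z0 in \<open>auto simp: max_absorb2\<close>)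
    then show "(\<integral>z. max 0 z \<partial>Z) = 1" using Zmean by simp
  qed
  have one: "integrable Z (\<lambda>z. sqrt v * max 0 z powr (1 / 2))" using half by simp
  have N1: "(\<integral>g. g ^ 1 \<partial>?N) = 0"
    unfolding N_moment using integral_std_normal_moment_odd[of 0] by simp
  show "integrable V (\<lambda>x. x)"
    by (rule transfer(1)[OF _ one N_int[of 1]]) simp_all
  have "(\<integral>x. x \<partial>V) = (\<integral>z. sqrt v * max 0 z powr (1 / 2) \<partial>Z) * (\<integral>g. g ^ 1 \<partial>?N)"
    by (rule transfer(2)[OF _ one N_int[of 1]]) simp_all
  then show "(\<integral>x. x \<partial>V) = 0" unfolding N1 by simp
  have two: "integrable Z (\<lambda>z. v * max 0 z)" using max1 by simp
  have sq: "(sqrt v * (max 0 z powr (1 / 2)) * g)\<^sup>2 = v * max 0 z * g ^ 2" for z g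
    using v by (simp add: power_mult_distrib powr_half_sqrt)
  have N2: "(\<integral>g. g ^ 2 \<partial>?N) = 1"
    unfolding N_moment using integral_std_normal_moment_even[of 1] by simp
  show "integrable V (\<lambda>x. x\<^sup>2)"
    by (rule transfer(1)[OF _ two N_int[of 2] sq]) simp
  have "(\<integral>x. x\<^sup>2 \<partial>V) = (\<integral>z. v * max 0 z \<partial>Z) * (\<integral>g. g ^ 2 \<partial>?N)"
    by (rule transfer(2)[OF _ two N_int[of 2] sq]) simp
  then show "(\<integral>x. x\<^sup>2 \<partial>V) = v" unfolding N2 using max1(2) by simp
  have Zp: "integrable Z (\<lambda>z. v powr (\<delta> / 2) * max 0 z powr (\<delta> / 2))"
  proof -
    have "AE z in Z. max 0 z powr (\<delta> / 2) = z powr (\<delta> / 2)"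
      using Z0 by eventually_elim (simp add: max_absorb2)
    then have "integrable Z (\<lambda>z. max 0 z powr (\<delta> / 2))"
      using \<delta>(2) by (subst integrable_cong_AE[of _ _ "\<lambda>z. z powr (\<delta> / 2)"]) auto
    then show ?thesis by simp
  qed
  have Np: "integrable ?N (\<lambda>g. \<bar>g\<bar> powr \<delta>)"
  proof (rule Bochner_Integration.integrable_bound[where f = "\<lambda>g. 1 + g ^ (2 * nat \<lceil>\<delta>\<rceil>)"])
    show "AE g in ?N. norm (\<bar>g\<bar> powr \<delta>) \<le> norm (1 + g ^ (2 * nat \<lceil>\<delta>\<rceil>))"
    proof (rule AE_I2)
      fix g :: real
      have e: "0 \<le> g ^ (2 * nat \<lceil>\<delta>\<rceil>)" by simp
      have "\<bar>g\<bar> powr \<delta> \<le> 1 + g ^ (2 * nat \<lceil>\<delta>\<rceil>)"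
      proof (cases "\<bar>g\<bar> \<le> 1")
        case True
        then have "\<bar>g\<bar> powr \<delta> \<le> 1" using \<delta> by (simp add: powr_le1)
        then show ?thesis using e by linarith
      next
        case False
        then have "\<bar>g\<bar> powr \<delta> \<le> \<bar>g\<bar> powr (real (2 * nat \<lceil>\<delta>\<rceil>))"
          using \<delta> by (intro powr_mono) linarith+
        also have "\<dots> = \<bar>g\<bar> ^ (2 * nat \<lceil>\<delta>\<rceil>)" using False by (subst powr_realpow) auto
        also have "\<dots> = g ^ (2 * nat \<lceil>\<delta>\<rceil>)" by (simp add: power_even_abs)
        finally show ?thesis by simp
      qed
      then show "norm (\<bar>g\<bar> powr \<delta>) \<le> norm (1 + g ^ (2 * nat \<lceil>\<delta>\<rceil>))" using e by simp
    qed
  qed (use N_int in auto)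
  show "integrable V (\<lambda>x. \<bar>x\<bar> powr \<delta>)"
  proof (rule transfer(1)[OF _ Zp Np])
    show "\<bar>sqrt v * max 0 z powr (1 / 2) * g\<bar> powr \<delta> = v powr (\<delta> / 2) * max 0 z powr (\<delta> / 2) * \<bar>g\<bar> powr \<delta>" for z g
      using v by (simp add: abs_mult powr_mult powr_powr powr_half_sqrt[symmetric])
  qed simp
qed

section \<open>Taylor estimate of the initial distance\<close>

lemma antiderivative_power_bound:
  fixes u u' :: "real \<Rightarrow> real"
  assumes \<beta>: "0 \<le> \<beta>" and u0: "u 0 = 0"
    and u: "\<And>z. (u has_real_derivative u' z) (at z)" and bound: "\<And>z. \<bar>u' z\<bar> \<le> A * \<bar>z\<bar> powr \<beta>"
  shows "\<bar>u x\<bar> \<le> A / (\<beta> + 1) * \<bar>x\<bar> powr (\<beta> + 1)"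
proof -
  have pos: "\<bar>w x\<bar> \<le> A / (\<beta> + 1) * x powr (\<beta> + 1)"
    if "0 \<le> x" "w 0 = 0" and w: "\<And>z. (w has_real_derivative w' z) (at z)" "\<And>z. \<bar>w' z\<bar> \<le> A * \<bar>z\<bar> powr \<beta>" for w w' x
  proof -
    have "\<bar>w x - w 0\<bar> \<le> A / (\<beta> + 1) * (x - 0) powr (\<beta> + 1)"
    proof (rule holder_of_singular_deriv[OF _ that(1) w(1)])
      show "\<bar>w' z\<bar> \<le> A * (z - 0) powr (\<beta> + 1 - 1)" if "0 < z" for z
        using w(2)[of z] that by simp
    qed (use \<beta> in simp)
    then show ?thesis using that(2) by simp
  qed
  show ?thesis
  proof (cases "0 \<le> x")
    case True
    then show ?thesis using pos[OF True u0 u bound] by simp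
  next
    case False
    have "\<bar>u (- (- x))\<bar> \<le> A / (\<beta> + 1) * (- x) powr (\<beta> + 1)"
    proof (rule pos[where w = "\<lambda>z. u (- z)" and w' = "\<lambda>z. - u' (- z)"])
      show "((\<lambda>z. u (- z)) has_real_derivative - u' (- z)) (at z)" for z
        using u[of "- z"] by (simp add: DERIV_mirror)
      show "\<bar>- u' (- z)\<bar> \<le> A * \<bar>z\<bar> powr \<beta>" for z
        using bound[of "- z"] by simp
    qed (use False u0 in auto)
    then show ?thesis using False by simp
  qed
qed

text \<open>Log-convexity between the points 1 and 2, where Gamma equals 1.\<close>

lemma Gamma_le_one:
  fixes \<alpha> :: real
  assumes "0 < \<alpha>" "\<alpha> \<le> 1"
  shows "Gamma (1 + \<alpha>) \<le> 1"
proof -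
  have "(ln \<circ> Gamma) ((1 - \<alpha>) *\<^sub>R 1 + \<alpha> *\<^sub>R 2) \<le> (1 - \<alpha>) * (ln \<circ> Gamma) (1::real) + \<alpha> * (ln \<circ> Gamma) 2"
    using assms by (intro convex_onD[OF log_convex_Gamma_real]) auto
  also have "\<dots> = 0"
    using Gamma_fact[of 1, where 'a = real] by simp
  finally have "ln (Gamma (1 + \<alpha>)) \<le> 0" by (simp add: algebra_simps)
  then show ?thesis using assms by (simp add: Gamma_real_pos)
qed

text \<open>Integrating the Hoelder bound twice gives the constant 1 / ((\<alpha> + 1) (\<alpha> +
  2)). It is at most 1 / Gamma (3 + \<alpha>), because Gamma (3 + \<alpha>) is that denominator
  times Gamma (1 + \<alpha>) <= 1.\<close>

lemma holder_deriv_taylor: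
  assumes \<alpha>: "0 < \<alpha>" "\<alpha> \<le> 1" and f: "holder_deriv 2 \<alpha> 1 f"
  obtains a b c where "\<And>x. \<bar>f x - (a + b * x + c * x\<^sup>2)\<bar> \<le> 1 / Gamma (3 + \<alpha>) * \<bar>x\<bar> powr (2 + \<alpha>)"
proof -
  obtain F where F: "F 0 = f" "deriv_chain 2 F" "\<And>x y. \<bar>F 2 x - F 2 y\<bar> \<le> 1 * \<bar>x - y\<bar> powr \<alpha>"
    using f unfolding holder_deriv_def by blast
  have d0: "(f has_real_derivative F 1 x) (at x)" and d1: "(F 1 has_real_derivative F 2 x) (at x)" for x
    using deriv_chain_D[OF F(2), of 0 x] deriv_chain_D[OF F(2), of 1 x] F(1) by (simp_all add: numeral_2_eq_2)
  have 1: "\<bar>F 1 x - F 1 0 - F 2 0 * x\<bar> \<le> 1 / (\<alpha> + 1) * \<bar>x\<bar> powr (\<alpha> + 1)" for x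
  proof (rule antiderivative_power_bound[where u' = "\<lambda>z. F 2 z - F 2 0"])
    show "((\<lambda>z. F 1 z - F 1 0 - F 2 0 * z) has_real_derivative F 2 z - F 2 0) (at z)" for z
      by (auto intro!: derivative_eq_intros d1[unfolded One_nat_def])
    show "\<bar>F 2 z - F 2 0\<bar> \<le> 1 * \<bar>z\<bar> powr \<alpha>" for z using F(3)[of z 0] by simp
  qed (use \<alpha> in auto)
  have 2: "\<bar>f x - f 0 - F 1 0 * x - F 2 0 / 2 * x\<^sup>2\<bar> \<le> 1 / (\<alpha> + 1) / ((\<alpha> + 1) + 1) * \<bar>x\<bar> powr ((\<alpha> + 1) + 1)" for x
  proof (rule antiderivative_power_bound[where u' = "\<lambda>z. F 1 z - F 1 0 - F 2 0 * z"])
    show "((\<lambda>z. f z - f 0 - F 1 0 * z - F 2 0 / 2 * z\<^sup>2) has_real_derivative F 1 z - F 1 0 - F 2 0 * z) (at z)" for z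
      by (auto intro!: derivative_eq_intros d0)
  qed (use \<alpha> 1 in auto)
  have G: "1 / (\<alpha> + 1) / ((\<alpha> + 1) + 1) \<le> 1 / Gamma (3 + \<alpha>)"
  proof -
    have "Gamma (\<alpha> + 1 + 1 + 1) = (\<alpha> + 1 + 1) * ((\<alpha> + 1) * Gamma (\<alpha> + 1))"
      using \<alpha> by (subst Gamma_plus1, force elim!: nonpos_Ints_cases)+ simp
    then have "Gamma (3 + \<alpha>) = (\<alpha> + 1 + 1) * ((\<alpha> + 1) * Gamma (1 + \<alpha>))"
      by (simp add: add_ac)
    also have "\<dots> \<le> (\<alpha> + 1 + 1) * ((\<alpha> + 1) * 1)"
      using \<alpha> by (intro mult_left_mono Gamma_le_one) auto
    finally have "1 / ((\<alpha> + 1 + 1) * ((\<alpha> + 1) * 1)) \<le> 1 / Gamma (3 + \<alpha>)"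
      using \<alpha> by (intro divide_left_mono mult_pos_pos Gamma_real_pos) auto
    then show ?thesis by (simp add: mult.commute)
  qed
  show ?thesis
  proof (rule that[of "f 0" "F 1 0" "F 2 0 / 2"])
    fix x
    have "\<bar>f x - f 0 - F 1 0 * x - F 2 0 / 2 * x\<^sup>2\<bar> \<le> 1 / Gamma (3 + \<alpha>) * \<bar>x\<bar> powr ((\<alpha> + 1) + 1)"
      by (rule order_trans[OF 2 mult_right_mono[OF G]]) simp
    then show "\<bar>f x - (f 0 + F 1 0 * x + F 2 0 / 2 * x\<^sup>2)\<bar> \<le> 1 / Gamma (3 + \<alpha>) * \<bar>x\<bar> powr (2 + \<alpha>)"
      by (simp add: algebra_simps)
  qed
qed

text \<open>The quadratic Taylor polynomial has the same mean under both laws, so only the two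
  remainders contribute.\<close>

lemma zolotarev_moment_bound:
  assumes \<delta>: "2 < \<delta>" "\<delta> \<le> 3" and P: "real_distribution P" and Q: "real_distribution Q"
    and iP: "integrable P (\<lambda>x. x)" "integrable P (\<lambda>x. x\<^sup>2)" "integrable P (\<lambda>x. \<bar>x\<bar> powr \<delta>)"
    and iQ: "integrable Q (\<lambda>x. x)" "integrable Q (\<lambda>x. x\<^sup>2)" "integrable Q (\<lambda>x. \<bar>x\<bar> powr \<delta>)"
    and eq: "(\<integral>x. x \<partial>P) = (\<integral>x. x \<partial>Q)" "(\<integral>x. x\<^sup>2 \<partial>P) = (\<integral>x. x\<^sup>2 \<partial>Q)"
  shows "zolotarev \<delta> P Q \<le> ereal (1 / Gamma (1 + \<delta>) * ((\<integral>x. \<bar>x\<bar> powr \<delta> \<partial>P) + (\<integral>x. \<bar>x\<bar> powr \<delta> \<partial>Q)))"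
  unfolding zolotarev_def
proof (rule SUP_least)
  fix f assume "f \<in> {f \<in> zol_class \<delta>. integrable P f \<and> integrable Q f}"
  then have f: "f \<in> zol_class \<delta>" "integrable P f" "integrable Q f" by auto
  \<comment> \<open>The convention 0 < \<alpha> <= 1 includes \<delta> = 3, where m = 2 and \<alpha>
    = 1.\<close>
  have m: "2 = nat (\<lceil>\<delta>\<rceil> - 1)" using \<delta> by linarith
  have "holder_deriv 2 (\<delta> - 2) 1 f"
    using zol_class_iff[OF m refl, of f] f(1) by simp
  then obtain a b c where abc: "\<And>x. \<bar>f x - (a + b * x + c * x\<^sup>2)\<bar> \<le> 1 / Gamma (3 + (\<delta> - 2)) * \<bar>x\<bar> powr (2 + (\<delta> - 2))"
    using \<delta> by (elim holder_deriv_taylor[rotated 2]) auto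
  have r: "\<bar>f x - (a + b * x + c * x\<^sup>2)\<bar> \<le> 1 / Gamma (1 + \<delta>) * \<bar>x\<bar> powr \<delta>" for x
    using abc[of x] by (simp add: algebra_simps)
  interpret P: real_distribution P by fact
  interpret Q: real_distribution Q by fact
  have rem: "\<bar>(\<integral>x. f x \<partial>R) - (a + b * (\<integral>x. x \<partial>R) + c * (\<integral>x. x\<^sup>2 \<partial>R))\<bar> \<le> 1 / Gamma (1 + \<delta>) * (\<integral>x. \<bar>x\<bar> powr \<delta> \<partial>R)"
    if R: "real_distribution R" "integrable R f" "integrable R (\<lambda>x. x)" "integrable R (\<lambda>x. x\<^sup>2)" "integrable R (\<lambda>x. \<bar>x\<bar> powr \<delta>)" for R
  proof -
    interpret R: real_distribution R by fact
    have "(\<integral>x. f x \<partial>R) - (a + b * (\<integral>x. x \<partial>R) + c * (\<integral>x. x\<^sup>2 \<partial>R)) = (\<integral>x. f x - (a + b * x + c * x\<^sup>2) \<partial>R)"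
      using R R.prob_space by simp
    also have "\<bar>\<dots>\<bar> \<le> (\<integral>x. \<bar>f x - (a + b * x + c * x\<^sup>2)\<bar> \<partial>R)"
      by (rule integral_abs_bound)
    also have "\<dots> \<le> (\<integral>x. 1 / Gamma (1 + \<delta>) * \<bar>x\<bar> powr \<delta> \<partial>R)"
      using R by (intro integral_mono r integrable_abs) auto
    finally show ?thesis using R by simp
  qed
  have "(\<integral>x. f x \<partial>P) - (\<integral>x. f x \<partial>Q) \<le> 1 / Gamma (1 + \<delta>) * ((\<integral>x. \<bar>x\<bar> powr \<delta> \<partial>P) + (\<integral>x. \<bar>x\<bar> powr \<delta> \<partial>Q))"
    using rem[OF P f(2) iP] rem[OF Q f(3) iQ] unfolding eq distrib_left by linarith
  then show "ereal ((\<integral>x. f x \<partial>P) - (\<integral>x. f x \<partial>Q)) \<le>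
      ereal (1 / Gamma (1 + \<delta>) * ((\<integral>x. \<bar>x\<bar> powr \<delta> \<partial>P) + (\<integral>x. \<bar>x\<bar> powr \<delta> \<partial>Q)))" by simp
qed

theorem theorem4:
  fixes L :: "(real ^ 'n::finite) measure"
    and F0 Vinf Z :: "real measure"
    and V :: "real \<Rightarrow> real measure"
    and phi :: "real \<Rightarrow> real \<Rightarrow> complex"
    and \<gamma> \<delta> :: real
  assumes N2: "CARD('n) \<ge> 2"
    and L_prob: "prob_space L" and L_sets: "sets L = sets borel"
    and A_nonneg: "AE a in L. \<forall>i. 0 \<le> a $ i"
    and A1: "measure L {a. card {i. 0 < a $ i} \<in> {0, 1}} < 1"
    and A2: "(\<integral>a. real (card {i. 0 < a $ i}) \<partial>L) > 1"
    and A3: "measure L {a. \<forall>i. a $ i \<in> {0, 1}} < 1"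
    and F0_prob: "real_prob F0"
    and gam: "0 < \<gamma>" "\<gamma> \<le> 2"
    and H: "H_gamma \<gamma> F0"
    and del: "\<delta> > \<gamma>"
    and Q_fin: "integrable L (\<lambda>a. \<Sum>i\<in>UNIV. (a $ i) powr \<gamma>)"
               "integrable L (\<lambda>a. \<Sum>i\<in>UNIV. (a $ i) powr \<delta>)"
    and mu_lt: "mu L \<delta> < mu L \<gamma>"
    and phi_sol: "cauchy_solution L (char F0) phi"
    and V_prob: "\<And>t. t \<ge> 0 \<Longrightarrow> real_prob (V t)"
    and V_char: "\<And>t. t \<ge> 0 \<Longrightarrow> char (V t) = phi t"
    and Z: "zeta_infty L \<gamma> Z"
    and Vinf_prob: "real_prob Vinf"
    and Vinf_char: "\<And>\<xi>. char Vinf \<xi> = (CLINT z|Z. g_hat \<gamma> F0 (\<xi> * z powr (1 / \<gamma>)))"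
  shows "(\<forall>t\<ge>0.
            zolotarev \<delta> (distr (V t) borel (\<lambda>x. exp (- mu L \<gamma> * t) * x)) Vinf
              \<le> zolotarev \<delta> F0 Vinf * ereal (exp (- t * \<delta> * (mu L \<gamma> - mu L \<delta>))))
       \<and> (\<gamma> = 2 \<and> \<delta> \<le> 3 \<and> integrable F0 (\<lambda>x. \<bar>x\<bar> powr \<delta>) \<longrightarrow>
            integrable Vinf (\<lambda>x. \<bar>x\<bar> powr \<delta>) \<and>
            (\<forall>t\<ge>0.
              zolotarev \<delta> (distr (V t) borel (\<lambda>x. exp (- mu L \<gamma> * t) * x)) Vinf
                \<le> ereal ((1 / Gamma (1 + \<delta>)) *
                         ((\<integral>x. \<bar>x\<bar> powr \<delta> \<partial>F0) + (\<integral>x. \<bar>x\<bar> powr \<delta> \<partial>Vinf)))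
                  * ereal (exp (- t * \<delta> * (mu L \<gamma> - mu L \<delta>)))))"
proof -
  note contraction = zolotarev_contraction[OF L_prob L_sets A_nonneg F0_prob gam H del Q_fin(2)
      phi_sol V_prob V_char Z Vinf_prob Vinf_char]
  have Fd: "real_distribution F0" and Vd: "real_distribution Vinf"
    using F0_prob Vinf_prob by (simp_all add: real_prob_iff_real_distribution)
  \<comment> \<open>It remains to bound the initial distance: both laws have mean 0 and second
    moment \<open>sigma0sq F0\<close>, the latter for V_infinity because zeta has mean 1.\<close>
  have second: "integrable Vinf (\<lambda>x. \<bar>x\<bar> powr \<delta>) \<and>
      zolotarev \<delta> F0 Vinf \<le> ereal (1 / Gamma (1 + \<delta>) * ((\<integral>x. \<bar>x\<bar> powr \<delta> \<partial>F0) + (\<integral>x. \<bar>x\<bar> powr \<delta> \<partial>Vinf)))"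
    if \<gamma>2: "\<gamma> = 2" and \<delta>3: "\<delta> \<le> 3" and mom: "integrable F0 (\<lambda>x. \<bar>x\<bar> powr \<delta>)"
  proof -
    have F0: "integrable F0 (\<lambda>v. v\<^sup>2)" "0 < sigma0sq F0" "integrable F0 (\<lambda>v. v)" "(\<integral>v. v \<partial>F0) = 0"
      using H \<gamma>2 by (simp_all add: H_gamma_def sigma0sq_def)
    have char2: "char Vinf \<xi> = (CLINT z|Z. complex_of_real (exp (- sigma0sq F0 * (\<xi> * z powr (1 / 2))\<^sup>2 / 2)))" for \<xi>
      using Vinf_char[of \<xi>] \<gamma>2 by (simp add: g_hat_def)
    \<comment> \<open>Here \<delta> <= 3 < 2 \<gamma> = 4, so the exponent \<delta> / 2 stays below
      2.\<close>
    have Zp: "integrable Z (\<lambda>z. z powr (\<delta> / 2))"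
      using zeta_infty_moment[OF L_prob L_sets A_nonneg A2 gam(1) del _ Q_fin mu_lt Z] \<gamma>2 \<delta>3 by simp
    have Z1: "integrable Z (\<lambda>z. z)" "(\<integral>z. z \<partial>Z) = 1" using Z by (simp_all add: zeta_infty_def)
    note VM = gaussian_mixture_moments[OF Vd Z_real_distribution[OF L_prob L_sets Z] Z_nonneg[OF L_prob L_sets Z]
        Z1 char2 less_imp_le[OF F0(2)] _ Zp]
    have \<delta>0: "0 < \<delta>" using gam del by simp
    have "zolotarev \<delta> F0 Vinf \<le> ereal (1 / Gamma (1 + \<delta>) * ((\<integral>x. \<bar>x\<bar> powr \<delta> \<partial>F0) + (\<integral>x. \<bar>x\<bar> powr \<delta> \<partial>Vinf)))"
      using del \<gamma>2 \<delta>3 F0(4) VM(3,5)[OF \<delta>0]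
      by (intro zolotarev_moment_bound[OF _ _ Fd Vd F0(3,1) mom VM(2,4,1)[OF \<delta>0]]) (simp_all add: sigma0sq_def)
    then show ?thesis using VM(1)[OF \<delta>0] by blast
  qed
  show ?thesis
  proof (intro conjI impI allI)
    fix t :: real assume t: "0 \<le> t"
    show "zolotarev \<delta> (distr (V t) borel (\<lambda>x. exp (- mu L \<gamma> * t) * x)) Vinf
        \<le> zolotarev \<delta> F0 Vinf * ereal (exp (- t * \<delta> * (mu L \<gamma> - mu L \<delta>)))"
      by (rule contraction[OF _ _ t])
  next
    assume a: "\<gamma> = 2 \<and> \<delta> \<le> 3 \<and> integrable F0 (\<lambda>x. \<bar>x\<bar> powr \<delta>)"
    then show "integrable Vinf (\<lambda>x. \<bar>x\<bar> powr \<delta>)" using second by blast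
    fix t :: real assume t: "0 \<le> t"
    have "zolotarev \<delta> (distr (V t) borel (\<lambda>x. exp (- mu L \<gamma> * t) * x)) Vinf
        \<le> zolotarev \<delta> F0 Vinf * ereal (exp (- t * \<delta> * (mu L \<gamma> - mu L \<delta>)))"
      by (rule contraction[OF _ _ t])
    also have "\<dots> \<le> ereal ((1 / Gamma (1 + \<delta>)) *
          ((\<integral>x. \<bar>x\<bar> powr \<delta> \<partial>F0) + (\<integral>x. \<bar>x\<bar> powr \<delta> \<partial>Vinf))) * ereal (exp (- t * \<delta> * (mu L \<gamma> - mu L \<delta>)))"
      using second a by (intro ereal_mult_right_mono) auto
    finally show "zolotarev \<delta> (distr (V t) borel (\<lambda>x. exp (- mu L \<gamma> * t) * x)) Vinf \<le>
        ereal ((1 / Gamma (1 + \<delta>)) *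
          ((\<integral>x. \<bar>x\<bar> powr \<delta> \<partial>F0) + (\<integral>x. \<bar>x\<bar> powr \<delta> \<partial>Vinf))) * ereal (exp (- t * \<delta> * (mu L \<gamma> - mu L \<delta>)))" .
  qed
qed

end
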